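(* (i) Let $k\in\{3,4\}$ and let $F$ be a graph with $\chi(F)>k$. Then $\mathrm{ex}_k(n,\text{Berge-}F)=\mathrm{ex}(n,K_k,F)$ for all sufficiently large $n$. (ii) For every fixed integer $k\ge 3$ there exists $r_0=r_0(k)$ such that for every $r\ge r_0$ and every graph $F$ with $\chi(F)=r+1$, we have $\mathrm{ex}_k(n,\text{Berge-}F)=\mathrm{ex}(n,K_k,F)$ for all sufficiently large $n$.
   Context: All graphs and hypergraphs are finite and simple; hyperedges of a hypergraph are distinct, and a hypergraph is $k$-uniform if each hyperedge has exactly $k$ vertices. Given a hypergraph $\mathcal{H}$ and a graph $G$ (with the vertices of $G$ being vertices of $\mathcal{H}$), $\mathcal{H}$ is a Berge-$G$ (a Berge copy of $G$) if there is a bijection between the hyperedges of $\mathcal{H}$ and the edges of $G$ such that each hyperedge contains its image. A hypergraph is Berge-$F$-free if no subhypergraph of it is a Berge-$F$. $\mathrm{ex}_k(n,\text{Berge-}F)$ denotes the largest number of hyperedges in an $n$-vertex $k$-uniform Berge-$F$-free hypergraph. A graph is $F$-free if it does not contain $F$ as a (not necessarily induced) subgraph. For graphs $H,G$, $\mathcal{N}(H,G)$ is the number of (not necessarily induced) copies of $H$ in $G$, and $\mathrm{ex}(n,H,F)=\max\{\mathcal{N}(H,G): G \text{ is an } n\text{-vertex } F\text{-free graph}\}$. $K_k$ is the complete graph on $k$ vertices and $\chi$ denotes the chromatic number. "Sufficiently large $n$" means $n$ larger than a threshold depending only on $F$ and $k$. *)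

theory Defs
  imports Complex_Main
begin

text \<open>A hypergraph is a pair of a vertex set and a set of hyperedges. Hyperedges form a set, so
  they are distinct; a finite simple graph is a 2-uniform hypergraph.\<close>

type_synonym 'a hypergraph = "'a set \<times> 'a set set"

abbreviation verts :: "'a hypergraph \<Rightarrow> 'a set" where
  "verts \<equiv> fst"

abbreviation edges :: "'a hypergraph \<Rightarrow> 'a set set" where
  "edges \<equiv> snd"

definition is_hypergraph :: "'a hypergraph \<Rightarrow> bool" where
  "is_hypergraph H \<longleftrightarrow> finite (verts H) \<and> (\<forall>e\<in>edges H. e \<subseteq> verts H)"

definition uniform_hypergraph :: "nat \<Rightarrow> 'a hypergraph \<Rightarrow> bool" where
  "uniform_hypergraph k H \<longleftrightarrow> is_hypergraph H \<and> (\<forall>e\<in>edges H. card e = k)"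

definition is_graph :: "'a hypergraph \<Rightarrow> bool" where
  "is_graph G \<longleftrightarrow> uniform_hypergraph 2 G"

definition subhypergraph :: "'a hypergraph \<Rightarrow> 'a hypergraph \<Rightarrow> bool" where
  "subhypergraph S H \<longleftrightarrow> is_hypergraph S \<and> verts S \<subseteq> verts H \<and> edges S \<subseteq> edges H"

definition isomorphic :: "'a hypergraph \<Rightarrow> 'b hypergraph \<Rightarrow> bool" where
  "isomorphic G H \<longleftrightarrow>
     (\<exists>\<phi>. bij_betw \<phi> (verts G) (verts H) \<and> edges H = (\<lambda>e. \<phi> ` e) ` edges G)"

definition complete_graph :: "nat \<Rightarrow> nat hypergraph" where
  "complete_graph k = ({..<k}, {e. e \<subseteq> {..<k} \<and> card e = 2})"

definition proper_colouring :: "'a hypergraph \<Rightarrow> nat \<Rightarrow> ('a \<Rightarrow> nat) \<Rightarrow> bool" where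
  "proper_colouring G c f \<longleftrightarrow>
     (\<forall>v\<in>verts G. f v < c) \<and> (\<forall>u v. {u, v} \<in> edges G \<longrightarrow> f u \<noteq> f v)"

definition chromatic_number :: "'a hypergraph \<Rightarrow> nat" where
  "chromatic_number G = (LEAST c. \<exists>f. proper_colouring G c f)"

definition contains_copy :: "'b hypergraph \<Rightarrow> 'a hypergraph \<Rightarrow> bool" where
  "contains_copy F G \<longleftrightarrow> (\<exists>S. subhypergraph S G \<and> isomorphic F S)"

text \<open>Copies are counted as subgraphs, not as embeddings.\<close>

definition num_copies :: "'b hypergraph \<Rightarrow> 'a hypergraph \<Rightarrow> nat" where
  "num_copies H G = card {S. subhypergraph S G \<and> isomorphic H S}"

text \<open>Here \<open>G\<close> is a concrete graph on vertices of \<open>H\<close>.\<close>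

definition berge_copy_of :: "'a hypergraph \<Rightarrow> 'a hypergraph \<Rightarrow> bool" where
  "berge_copy_of H G \<longleftrightarrow> verts G \<subseteq> verts H \<and>
     (\<exists>f. bij_betw f (edges H) (edges G) \<and> (\<forall>h\<in>edges H. f h \<subseteq> h))"

text \<open>\<open>F\<close> is given up to isomorphism: \<open>H\<close> is a Berge-\<open>F\<close> if some graph on vertices of \<open>H\<close>
  isomorphic to \<open>F\<close> has \<open>H\<close> as a Berge copy.\<close>

definition is_berge :: "'b hypergraph \<Rightarrow> 'a hypergraph \<Rightarrow> bool" where
  "is_berge F H \<longleftrightarrow> (\<exists>G. is_graph G \<and> isomorphic F G \<and> berge_copy_of H G)"

definition berge_free :: "'b hypergraph \<Rightarrow> 'a hypergraph \<Rightarrow> bool" where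
  "berge_free F H \<longleftrightarrow> \<not> (\<exists>S. subhypergraph S H \<and> is_berge F S)"

text \<open>Both extremal numbers range over vertex sets consisting of natural numbers; up to isomorphism
  this covers all finite (hyper)graphs. The maxima are over finite sets (see the lemmas below),
  nonempty as soon as \<open>F\<close> has an edge.\<close>

definition ex_berge :: "nat \<Rightarrow> nat \<Rightarrow> 'b hypergraph \<Rightarrow> nat" where
  "ex_berge k n F = Max {card (edges H) | H :: nat hypergraph.
     uniform_hypergraph k H \<and> card (verts H) = n \<and> berge_free F H}"

definition ex_copies :: "nat \<Rightarrow> 'c hypergraph \<Rightarrow> 'b hypergraph \<Rightarrow> nat" where
  "ex_copies n H F = Max {num_copies H G | G :: nat hypergraph.
     is_graph G \<and> card (verts G) = n \<and> \<not> contains_copy F G}"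

lemma finite_ex_berge_values:
  "finite {card (edges H) | H :: nat hypergraph.
     uniform_hypergraph k H \<and> card (verts H) = n \<and> berge_free F H}" (is "finite ?A")
proof (rule finite_subset)
  show "?A \<subseteq> {..2 ^ n}"
  proof clarsimp
    fix V :: "nat set" and E
    assume "uniform_hypergraph k (V, E)"
    then have "finite V" "E \<subseteq> Pow V"
      by (auto simp: uniform_hypergraph_def is_hypergraph_def)
    then have "card E \<le> card (Pow V)" by (intro card_mono) auto
    then show "card E \<le> 2 ^ card V" using \<open>finite V\<close> by (simp add: card_Pow)
  qed
qed simp

lemma finite_ex_copies_values:
  "finite {num_copies H G | G :: nat hypergraph.
     is_graph G \<and> card (verts G) = n \<and> \<not> contains_copy F G}" (is "finite ?A")
proof (rule finite_subset)
  show "?A \<subseteq> {..2 ^ n * 2 ^ (2 ^ n)}"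
  proof clarsimp
    fix V :: "nat set" and E
    assume "is_graph (V, E)"
    then have V: "finite V" "E \<subseteq> Pow V"
      by (auto simp: is_graph_def uniform_hypergraph_def is_hypergraph_def)
    have "num_copies H (V, E) \<le> card (Pow V \<times> Pow (Pow V))"
      unfolding num_copies_def
      by (intro card_mono) (use V in \<open>fastforce simp: subhypergraph_def\<close>)+
    then show "num_copies H (V, E) \<le> 2 ^ card V * 2 ^ (2 ^ card V)"
      using V(1) by (simp add: card_cartesian_product card_Pow)
  qed
qed simp

lemma chromatic_number_attained:
  assumes "is_graph G"
  shows "\<exists>f. proper_colouring G (chromatic_number G) f"
proof -
  have fin: "finite (verts G)" and 2: "\<And>e. e \<in> edges G \<Longrightarrow> card e = 2 \<and> e \<subseteq> verts G"
    using assms by (auto simp: is_graph_def uniform_hypergraph_def is_hypergraph_def)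
  obtain f where f: "bij_betw f (verts G) {0..<card (verts G)}"
    using ex_bij_betw_finite_nat[OF fin] by blast
  have "proper_colouring G (card (verts G)) f"
    unfolding proper_colouring_def
  proof (intro conjI ballI allI impI)
    fix v assume "v \<in> verts G" then show "f v < card (verts G)"
      using bij_betw_apply[OF f] by fastforce
  next
    fix u v assume "{u, v} \<in> edges G"
    then have "u \<noteq> v" "u \<in> verts G" "v \<in> verts G"
      using 2[of "{u, v}"] by (cases "u = v"; auto)+
    then show "f u \<noteq> f v"
      using f by (auto simp: bij_betw_def inj_on_def)
  qed
  then have "\<exists>f. proper_colouring G (card (verts G)) f" by blast
  then show ?thesis unfolding chromatic_number_def by (rule LeastI)
qed

end

theory Submission
  imports Defs "HOL-Analysis.Convex"
begin

text \<open>A Hall-type argument turns a Berge-\<open>F\<close>-free \<open>k\<close>-graph into an \<open>F\<close>-free graph with a blue-red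
  edge colouring whose weight, blue \<open>k\<close>-cliques plus red edges, is at least the number of
  hyperedges. So it suffices that, for large \<open>n\<close>, some colouring of maximum weight has no red edge.
  Take an optimum with fewest red edges, and suppose \<open>uv\<close> is red. Recolouring \<open>uv\<close> blue cannot
  create a blue \<open>k\<close>-clique, so the common blue neighbourhood of \<open>u\<close> and \<open>v\<close> has no \<open>(k-2)\<close>-clique.

  Let \<open>\<chi>(F) = r + 1\<close>. The weight of the Turan graph shows that the blue graph has almost the maximum
  number of \<open>k\<close>-cliques, and the Moon-Moser inequalities then force almost all degrees to be at least
  about \<open>(1 - 1/r) n\<close>. This replaces the removal lemma: a complete \<open>r\<close>-partite subgraph on such
  vertices yields a few vertices with about \<open>(1 - 1/r) n\<close> common neighbours. Replacing any vertex \<open>u\<close>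
  by a twin of these creates no copy of \<open>F\<close>, so by optimality \<open>u\<close> lies in almost as many
  \<open>k\<close>-cliques as a vertex of the Turan graph. Conversely, a set without \<open>(k-2)\<close>-cliques has at most
  about \<open>(k-3) n/r\<close> vertices, so \<open>u\<close> or \<open>v\<close> has degree at most about \<open>(r+k-3) n/(2r)\<close> and lies in too
  few \<open>k\<close>-cliques, provided that \<open>((r+k-3)/(2r))\<close> to the power \<open>k - 1\<close> is less than \<open>1 - (k-1)/r\<close>.
  This inequality holds for \<open>k = 3, 4\<close> and all \<open>r \<ge> k\<close>, and for every \<open>k\<close> once \<open>r\<close> is large.
  Below, \<open>l\<close> stands for \<open>k - 1\<close>.\<close>

section \<open>Counting cliques\<close>

text \<open>An \<open>F\<close>-free graph may contain (r+1)-cliques; what is excluded is the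
  complete (r+1)-partite graph with parts of size at least \<open>card (verts F)\<close>. Hence
  Turan-type ratios hold only up to an error, which is small because very many (r+1)-cliques would
  produce such a subgraph. The numerical inequality compares two counts of (k-1)-cliques. A
  neighbourhood of size b n contains at most about (b n)^(k-1)/(k-1)! times the product of 1 - s/r
  over s < k-1, whereas for a vertex of the Turan graph b is 1 and the product runs over 1 \<le> s
  \<le> k-1; the quotient of the two products telescopes to 1 - (k-1)/r. For k = r = 5 the
  inequality fails, as 0.7^4 > 0.2, so this comparison covers larger k only for larger r. Red edges
  are harmless in the asymptotics because k \<ge> 3: there are at most n^2 in total and n at one
  vertex, against clique counts of order n^k and n^(k-1). Maximum weight alone does not rule out a
  red edge, since recolouring it may create just one clique, which only balances the lost edge;
  hence the second minimisation.\<close>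

definition cliques :: "('a \<Rightarrow> 'a \<Rightarrow> bool) \<Rightarrow> 'a set \<Rightarrow> nat \<Rightarrow> 'a set set" where
  "cliques adj V s = {Q. Q \<subseteq> V \<and> finite Q \<and> card Q = s \<and> pairwise adj Q}"

text \<open>For \<open>P = {x}\<close> this is the neighbourhood of \<open>x\<close>. The vertex set
  is separate from the relation, so that clique bounds can be applied inside neighbourhoods.\<close>

definition common_nbrs :: "('a \<Rightarrow> 'a \<Rightarrow> bool) \<Rightarrow> 'a set \<Rightarrow> 'a set \<Rightarrow> 'a set" where
  "common_nbrs adj V P = {x \<in> V. \<forall>y\<in>P. adj x y}"

lemma finite_cliques [simp]: "finite V \<Longrightarrow> finite (cliques adj V s)"
  by (rule finite_subset[of _ "Pow V"]) (auto simp: cliques_def)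

lemma finite_common_nbrs [simp]: "finite V \<Longrightarrow> finite (common_nbrs adj V P)"
  by (simp add: common_nbrs_def)

lemma cliques_mono: "W \<subseteq> V \<Longrightarrow> cliques adj W s \<subseteq> cliques adj V s"
  by (auto simp: cliques_def)

lemma cliques_0 [simp]: "cliques adj V 0 = {{}}"
  by (auto simp: cliques_def)

lemma cliques_1: "cliques adj V (Suc 0) = (\<lambda>x. {x}) ` V"
  by (auto simp: cliques_def card_1_singleton_iff pairwise_def)

lemma card_cliques_1 [simp]: "card (cliques adj V (Suc 0)) = card V"
  by (simp add: cliques_1 card_image)

lemma card_cliques_le_power:
  assumes "finite V"
  shows "card (cliques adj V s) \<le> card V ^ s"
proof -
  have "cliques adj V s \<subseteq> {Q. Q \<subseteq> V \<and> card Q = s}"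
    by (auto simp: cliques_def)
  then have "card (cliques adj V s) \<le> card {Q. Q \<subseteq> V \<and> card Q = s}"
    by (rule card_mono[rotated]) (use assms in auto)
  then have "card (cliques adj V s) \<le> card V choose s"
    using n_subsets[OF assms] by simp
  also have "\<dots> \<le> card V ^ s"
    by (cases "s \<le> card V") (auto simp: binomial_le_pow binomial_eq_0)
  finally show ?thesis .
qed

text \<open>Double counting: an s-clique \<open>P\<close> with a common neighbour \<open>x\<close>
  is the same as an (s+1)-clique \<open>insert x P\<close> with a marked vertex \<open>x\<close>,
  because irreflexivity puts \<open>x\<close> outside \<open>P\<close>. The free weight
  \<open>g\<close> yields both the first and the second moment of the number of extensions.\<close>

lemma sum_cliques_extend:
  fixes g :: "'a set \<Rightarrow> 'a \<Rightarrow> 'b::comm_monoid_add"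
  assumes fin: "finite V" and adj: "symp adj" "irreflp adj"
  shows "(\<Sum>P\<in>cliques adj V s. \<Sum>x\<in>common_nbrs adj V P. g P x) =
         (\<Sum>Q\<in>cliques adj V (Suc s). \<Sum>x\<in>Q. g (Q - {x}) x)"
proof -
  have finQ: "\<forall>Q\<in>cliques adj V (Suc s). finite Q"
    by (auto simp: cliques_def)
  have "(\<Sum>P\<in>cliques adj V s. \<Sum>x\<in>common_nbrs adj V P. g P x) =
     (\<Sum>(P,x)\<in>(SIGMA P:cliques adj V s. common_nbrs adj V P). g P x)"
    using fin by (intro sum.Sigma) auto
  also have "\<dots> = (\<Sum>(Q,x)\<in>(SIGMA Q:cliques adj V (Suc s). Q). g (Q - {x}) x)"
  proof (rule sum.reindex_bij_witness[of _ "\<lambda>(Q,x). (Q - {x}, x)" "\<lambda>(P,x). (insert x P, x)"], goal_cases)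
    case (1 a)
    then obtain P x where "a = (P, x)" "P \<in> cliques adj V s" "x \<in> common_nbrs adj V P" by auto
    moreover have "x \<notin> P" using calculation adj(2) by (auto simp: common_nbrs_def irreflp_def)
    ultimately show ?case by auto
  next
    case (2 a)
    then obtain P x where a: "a = (P, x)" "P \<in> cliques adj V s" "x \<in> common_nbrs adj V P" by auto
    moreover have "x \<notin> P" using a adj(2) by (auto simp: common_nbrs_def irreflp_def)
    ultimately show ?case using adj(1)
      by (auto simp: cliques_def common_nbrs_def pairwise_insert symp_def)
  next
    case (3 b)
    then show ?case by auto
  next
    case (4 b)
    then show ?case by (auto simp: cliques_def common_nbrs_def pairwise_def)
  next
    case (5 a)
    then obtain P x where "a = (P, x)" "P \<in> cliques adj V s" "x \<in> common_nbrs adj V P" by auto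
    moreover have "x \<notin> P" using calculation adj(2) by (auto simp: common_nbrs_def irreflp_def)
    ultimately show ?case by auto
  qed
  also have "\<dots> = (\<Sum>Q\<in>cliques adj V (Suc s). \<Sum>x\<in>Q. g (Q - {x}) x)"
    using fin finQ by (intro sum.Sigma[symmetric]) auto
  finally show ?thesis .
qed

lemma sum_card_common_nbrs:
  assumes "finite V" "symp adj" "irreflp adj"
  shows "(\<Sum>P\<in>cliques adj V s. card (common_nbrs adj V P)) = Suc s * card (cliques adj V (Suc s))"
proof -
  have "(\<Sum>P\<in>cliques adj V s. card (common_nbrs adj V P)) = (\<Sum>Q\<in>cliques adj V (Suc s). card Q)"
    using sum_cliques_extend[OF assms, of "\<lambda>_ _. 1::nat" s] by simp
  also have "\<dots> = (\<Sum>Q\<in>cliques adj V (Suc s). Suc s)"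
    by (intro sum.cong) (auto simp: cliques_def)
  finally show ?thesis by simp
qed

text \<open>A vertex adjacent to all but one element of an \<open>(s+1)\<close>-clique \<open>Q\<close>, for two different choices of
  that element, is adjacent to all of \<open>Q\<close>.\<close>

lemma sum_card_common_nbrs_sq:
  assumes "finite V" "symp adj" "irreflp adj"
  shows "(\<Sum>P\<in>cliques adj V s. (card (common_nbrs adj V P))\<^sup>2)
    \<le> card V * card (cliques adj V (Suc s)) + s * (s + 2) * card (cliques adj V (Suc (Suc s)))"
proof -
  have "(\<Sum>P\<in>cliques adj V s. (card (common_nbrs adj V P))\<^sup>2) =
      (\<Sum>Q\<in>cliques adj V (Suc s). \<Sum>x\<in>Q. card (common_nbrs adj V (Q - {x})))"
    using sum_cliques_extend[OF assms, of "\<lambda>P x. card (common_nbrs adj V P)" s]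
    by (simp add: power2_eq_square)
  also have "\<dots> \<le> (\<Sum>Q\<in>cliques adj V (Suc s). card V + s * card (common_nbrs adj V Q))"
  proof (rule sum_mono)
    fix Q assume "Q \<in> cliques adj V (Suc s)"
    then have Q: "finite Q" "card Q = Suc s" by (auto simp: cliques_def)
    have "(\<Sum>x\<in>Q. card (common_nbrs adj V (Q - {x}))) =
        (\<Sum>x\<in>Q. \<Sum>y\<in>V. if y \<in> common_nbrs adj V (Q - {x}) then 1 else 0)"
      using assms(1) by (intro sum.cong refl) (simp add: sum.If_cases common_nbrs_def Int_def conj_commute)
    also have "\<dots> = (\<Sum>y\<in>V. \<Sum>x\<in>Q. if y \<in> common_nbrs adj V (Q - {x}) then 1 else 0)"
      by (rule sum.swap)
    also have "\<dots> \<le> (\<Sum>y\<in>V. 1 + s * (if y \<in> common_nbrs adj V Q then 1 else 0))"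
    proof (rule sum_mono)
      fix y assume y: "y \<in> V"
      let ?X = "{x \<in> Q. y \<in> common_nbrs adj V (Q - {x})}"
      have eq: "(\<Sum>x\<in>Q. if y \<in> common_nbrs adj V (Q - {x}) then 1 else 0) = card ?X"
        using Q(1) by (simp add: sum.If_cases Int_def)
      show "(\<Sum>x\<in>Q. if y \<in> common_nbrs adj V (Q - {x}) then 1 else 0)
          \<le> 1 + s * (if y \<in> common_nbrs adj V Q then 1 else 0)"
      proof (cases "y \<in> common_nbrs adj V Q")
        case True
        have "card ?X \<le> card Q" by (rule card_mono) (use Q in auto)
        then show ?thesis using True eq Q by simp
      next
        case False
        have "card ?X \<le> Suc 0"
        proof (subst card_le_Suc0_iff_eq)
          show "finite ?X" using Q by simp
          show "\<forall>a1\<in>?X. \<forall>a2\<in>?X. a1 = a2"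
            using False y by (auto simp: common_nbrs_def)
        qed
        then show ?thesis using eq False by simp
      qed
    qed
    also have "\<dots> = card V + s * (\<Sum>y\<in>V. if y \<in> common_nbrs adj V Q then 1 else 0)"
      unfolding sum.distrib sum_distrib_left[symmetric] by simp
    also have "(\<Sum>y\<in>V. if y \<in> common_nbrs adj V Q then 1 else 0) = card (common_nbrs adj V Q)"
      using assms(1) by (simp add: sum.If_cases common_nbrs_def Int_def conj_commute)
    finally show "(\<Sum>x\<in>Q. card (common_nbrs adj V (Q - {x}))) \<le> card V + s * card (common_nbrs adj V Q)" .
  qed
  also have "\<dots> = card V * card (cliques adj V (Suc s)) + s * (s + 2) * card (cliques adj V (Suc (Suc s)))"
    unfolding sum.distrib sum_distrib_left[symmetric]
    using sum_card_common_nbrs[OF assms, of "Suc s"] by (simp add: algebra_simps)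
  finally show ?thesis .
qed

text \<open>Cauchy-Schwarz for the numbers of extensions of the s-cliques, whose first and second
  moments are now known.\<close>

lemma moon_moser:
  assumes "finite V" "symp adj" "irreflp adj"
  shows "(Suc s * card (cliques adj V (Suc s)))\<^sup>2 \<le> card (cliques adj V s) *
    (card V * card (cliques adj V (Suc s)) + s * (s + 2) * card (cliques adj V (Suc (Suc s))))"
proof -
  have "(\<Sum>P\<in>cliques adj V s. real (card (common_nbrs adj V P)))\<^sup>2 \<le>
     (\<Sum>P\<in>cliques adj V s. (real (card (common_nbrs adj V P)))\<^sup>2) * real (card (cliques adj V s))"
    by (rule sum_squared_le_sum_of_squares)
  then have "real ((Suc s * card (cliques adj V (Suc s)))\<^sup>2) \<le> 
     real ((\<Sum>P\<in>cliques adj V s. (card (common_nbrs adj V P))\<^sup>2) * card (cliques adj V s))"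
    unfolding sum_card_common_nbrs[OF assms, symmetric] by simp
  then have "(Suc s * card (cliques adj V (Suc s)))\<^sup>2 \<le> 
     (\<Sum>P\<in>cliques adj V s. (card (common_nbrs adj V P))\<^sup>2) * card (cliques adj V s)"
    by (simp only: of_nat_le_iff)
  also have "\<dots> \<le> (card V * card (cliques adj V (Suc s)) + s * (s + 2) * card (cliques adj V (Suc (Suc s))))
      * card (cliques adj V s)"
    by (intro mult_right_mono sum_card_common_nbrs_sq assms) simp
  finally show ?thesis by (simp add: mult.commute)
qed

text \<open>Each vertex of an s-clique spoils at most \<open>q\<close> candidates for an extension,
  itself included, since irreflexivity makes it a non-neighbour of itself. Summing over all
  s-cliques counts each (s+1)-clique s + 1 times.\<close>

lemma card_cliques_greedy_step:
  assumes "finite W" "symp adj" "irreflp adj"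
    and miss: "\<And>x. x \<in> W \<Longrightarrow> real (card {y \<in> W. \<not> adj x y}) \<le> q"
  shows "(real (card W) - real s * q) * real (card (cliques adj W s))
    \<le> real (Suc s) * real (card (cliques adj W (Suc s)))"
proof -
  have "(real (card W) - real s * q) \<le> real (card (common_nbrs adj W P))" if P: "P \<in> cliques adj W s" for P
  proof -
    have P': "finite P" "card P = s" "P \<subseteq> W" using P by (auto simp: cliques_def)
    have "W \<subseteq> common_nbrs adj W P \<union> (\<Union>x\<in>P. {y \<in> W. \<not> adj x y})"
      using assms(2) by (auto simp: common_nbrs_def symp_def)
    then have "card W \<le> card (common_nbrs adj W P \<union> (\<Union>x\<in>P. {y \<in> W. \<not> adj x y}))"
      by (intro card_mono) (use assms(1) P' in auto)
    also have "\<dots> \<le> card (common_nbrs adj W P) + card (\<Union>x\<in>P. {y \<in> W. \<not> adj x y})"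
      by (rule card_Un_le)
    also have "card (\<Union>x\<in>P. {y \<in> W. \<not> adj x y}) \<le> (\<Sum>x\<in>P. card {y \<in> W. \<not> adj x y})"
      by (rule card_UN_le) (use P' in auto)
    finally have "card W \<le> card (common_nbrs adj W P) + (\<Sum>x\<in>P. card {y \<in> W. \<not> adj x y})"
      by simp
    then have "real (card W) \<le> real (card (common_nbrs adj W P) + (\<Sum>x\<in>P. card {y \<in> W. \<not> adj x y}))"
      by (rule of_nat_mono)
    then have "real (card W) \<le> real (card (common_nbrs adj W P)) + (\<Sum>x\<in>P. real (card {y \<in> W. \<not> adj x y}))"
      by simp
    also have "(\<Sum>x\<in>P. real (card {y \<in> W. \<not> adj x y})) \<le> (\<Sum>x\<in>P. q)"
      by (rule sum_mono) (use P' miss in auto)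
    finally show ?thesis using P' by simp
  qed
  then have "(\<Sum>P\<in>cliques adj W s. real (card W) - real s * q) \<le> (\<Sum>P\<in>cliques adj W s. real (card (common_nbrs adj W P)))"
    by (rule sum_mono)
  also have "\<dots> = real (\<Sum>P\<in>cliques adj W s. card (common_nbrs adj W P))"
    by simp
  also have "\<dots> = real (Suc s * card (cliques adj W (Suc s)))"
    unfolding sum_card_common_nbrs[OF assms(1-3)] ..
  finally show ?thesis by (simp add: algebra_simps)
qed

text \<open>\<open>p j\<close> is a lower bound for the number of choices at step \<open>j\<close>;
  its sign condition lets the factors be multiplied. The factorial accounts for the orders in which
  one clique is built.\<close>

lemma card_cliques_greedy:
  assumes "finite W" "symp adj" "irreflp adj"
    and miss: "\<And>x. x \<in> W \<Longrightarrow> real (card {y \<in> W. \<not> adj x y}) \<le> q"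
    and nonneg: "\<And>j. j < s \<Longrightarrow> 0 \<le> p j" and le: "\<And>j. j < s \<Longrightarrow> p j \<le> real (card W) - real j * q"
  shows "(\<Prod>j<s. p j) \<le> fact s * real (card (cliques adj W s))"
  using nonneg le
proof (induction s)
  case (Suc s)
  have "(\<Prod>j<Suc s. p j) = p s * (\<Prod>j<s. p j)" by simp
  also have "\<dots> \<le> p s * (fact s * real (card (cliques adj W s)))"
    using Suc by (intro mult_left_mono) auto
  also have "\<dots> \<le> (real (card W) - real s * q) * (fact s * real (card (cliques adj W s)))"
    using Suc.prems by (intro mult_right_mono) auto
  also have "\<dots> = fact s * ((real (card W) - real s * q) * real (card (cliques adj W s)))"
    by simp
  also have "\<dots> \<le> fact s * (real (Suc s) * real (card (cliques adj W (Suc s))))"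
    by (intro mult_left_mono card_cliques_greedy_step assms) auto
  also have "\<dots> = fact (Suc s) * real (card (cliques adj W (Suc s)))" by simp
  finally show ?case .
qed auto

text \<open>The complete \<open>s\<close>-partite graph with parts of size \<open>t\<close>, as a
  subgraph that need not be induced. The list order lets adjacency be asked only from earlier to
  later parts; for irreflexive \<open>adj\<close> this makes the parts disjoint.\<close>

definition has_blowup :: "('a \<Rightarrow> 'a \<Rightarrow> bool) \<Rightarrow> 'a set \<Rightarrow> nat \<Rightarrow> nat \<Rightarrow> bool" where
  "has_blowup adj V s t \<longleftrightarrow> (\<exists>As. length As = s \<and> (\<forall>A\<in>set As. A \<subseteq> V \<and> card A = t) \<and>
     sorted_wrt (\<lambda>A B. \<forall>x\<in>A. \<forall>y\<in>B. adj x y) As)"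

section \<open>Complete multipartite subgraphs\<close>

text \<open>The theorem of Erdos on dense \<open>s\<close>-partite systems, for ordered tuples. For
  a bounded set \<open>W\<close> of heads, a positive proportion of the tails is extended by at
  least \<open>t\<close> of them; pigeonholing over the subsets of \<open>W\<close> fixes these
  heads. The clause that every chosen vertex lies on a tuple of \<open>\<F>\<close> supplies
  adjacency: a vertex of a retained tail stands behind every chosen head in some tuple of
  \<open>\<F>\<close>.\<close>

lemma box_blowup:
  assumes t: "1 \<le> t" and "0 < \<gamma>"
  shows "\<exists>N. \<forall>adj V \<F>. finite V \<longrightarrow> N \<le> card V \<longrightarrow>
    \<F> \<subseteq> {xs. length xs = s \<and> set xs \<subseteq> V \<and> sorted_wrt adj xs} \<longrightarrow> \<gamma> * real (card V) ^ s \<le> real (card \<F>) \<longrightarrow>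
    (\<exists>As. length As = s \<and> (\<forall>A\<in>set As. A \<subseteq> (V :: 'a set) \<and> card A = t \<and> (\<forall>b\<in>A. \<exists>p\<in>\<F>. b \<in> set p)) \<and>
      sorted_wrt (\<lambda>A B. \<forall>x\<in>A. \<forall>y\<in>B. adj x y) As)"
  using assms(2)
proof (induction s arbitrary: \<gamma>)
  case 0
  show ?case by (rule exI[of _ 0]) auto
next
  case (Suc s)
  \<comment> \<open>\<open>M\<close> heads with at least \<gamma>/2 n^s tails each give M \<gamma>/2
    n^s incidences. Tails met by fewer than \<open>t\<close> heads account for at most t n^s, which
    this choice makes at most half of that.\<close>
  define M where "M = nat \<lceil>4 * real t / \<gamma>\<rceil>"
  have "4 * real t / \<gamma> \<le> real M" unfolding M_def by (rule real_nat_ceiling_ge)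
  then have M: "real t \<le> real M * (\<gamma> / 4)" using Suc.prems by (simp add: field_simps)
  \<comment> \<open>A proportion \<gamma>/4 of the tails survives and is split among the 2^M subsets
    of \<open>W\<close>.\<close>
  define \<gamma>' where "\<gamma>' = \<gamma> / 4 / 2 ^ M"
  have \<gamma>': "0 < \<gamma>'" using Suc.prems by (simp add: \<gamma>'_def)
  from Suc.IH[OF this] obtain N' where N': "\<And>adj V \<F>. finite V \<Longrightarrow> N' \<le> card V \<Longrightarrow>
    \<F> \<subseteq> {xs. length xs = s \<and> set xs \<subseteq> V \<and> sorted_wrt adj xs} \<Longrightarrow> \<gamma>' * real (card V) ^ s \<le> real (card \<F>) \<Longrightarrow>
    (\<exists>As. length As = s \<and> (\<forall>A\<in>set As. A \<subseteq> (V :: 'a set) \<and> card A = t \<and> (\<forall>b\<in>A. \<exists>p\<in>\<F>. b \<in> set p)) \<and>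
      sorted_wrt (\<lambda>A B. \<forall>x\<in>A. \<forall>y\<in>B. adj x y) As)"
    by blast
  define N where "N = max (max N' 1) (nat \<lceil>2 * real M / \<gamma>\<rceil>)"
  show ?case
  proof (rule exI[of _ N], intro allI impI)
    fix adj and V :: "'a set" and \<F>
    assume fin: "finite V" and N: "N \<le> card V"
      and \<F>: "\<F> \<subseteq> {xs. length xs = Suc s \<and> set xs \<subseteq> V \<and> sorted_wrt adj xs}"
      and big: "\<gamma> * real (card V) ^ Suc s \<le> real (card \<F>)"
    define n where "n = card V"
    have n: "N' \<le> n" "1 \<le> n" using N by (auto simp: N_def n_def)
    have "2 * real M / \<gamma> \<le> real n"
      using N real_nat_ceiling_ge[of "2 * real M / \<gamma>"] by (simp add: N_def n_def)
    then have Mn: "real M \<le> \<gamma> / 2 * real n" using Suc.prems by (simp add: field_simps)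
    define L where "L = {p. set p \<subseteq> V \<and> length p = s}"
    have finL: "finite L" and cardL: "card L = n ^ s"
      using fin by (simp_all add: L_def n_def finite_lists_length_eq card_lists_length_eq)
    define T where "T x = {p \<in> L. x # p \<in> \<F>}" for x
    have cardT: "card (T x) \<le> n ^ s" for x
      using card_mono[OF finL, of "T x"] cardL by (auto simp: T_def)
    have "card \<F> = card (\<Union>x\<in>V. (#) x ` T x)"
    proof (intro arg_cong[where f = card] equalityI subsetI)
      fix xs assume "xs \<in> \<F>"
      moreover from this \<F> obtain x p where "xs = x # p" "x \<in> V" "p \<in> L"
        by (cases xs) (auto simp: L_def)
      ultimately show "xs \<in> (\<Union>x\<in>V. (#) x ` T x)"
        by (auto simp: T_def)
    qed (auto simp: T_def)
    also have "\<dots> = (\<Sum>x\<in>V. card ((#) x ` T x))"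
      using fin finL by (intro card_UN_disjoint) (auto simp: T_def)
    also have "\<dots> = (\<Sum>x\<in>V. card (T x))"
      by (simp add: card_image)
    finally have card\<F>: "card \<F> = (\<Sum>x\<in>V. card (T x))" .
    define X where "X = {x \<in> V. \<gamma> / 2 * real n ^ s \<le> real (card (T x))}"
    have "real (card \<F>) = (\<Sum>x\<in>V. real (card (T x)))" using card\<F> by simp
    also have "\<dots> \<le> (\<Sum>x\<in>V. (if x \<in> X then real n ^ s else 0) + \<gamma> / 2 * real n ^ s)"
    proof (rule sum_mono)
      fix x assume "x \<in> V"
      then have "real (card (T x)) < \<gamma> / 2 * real n ^ s" if "x \<notin> X"
        using that by (simp add: X_def)
      moreover have "real (card (T x)) \<le> real n ^ s"
        using cardT[of x] by (metis of_nat_le_iff of_nat_power)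
      moreover have "0 \<le> \<gamma> / 2 * real n ^ s" using Suc.prems by simp
      ultimately show "real (card (T x)) \<le> (if x \<in> X then real n ^ s else 0) + \<gamma> / 2 * real n ^ s"
        by argo
    qed
    also have "\<dots> = real (card X) * real n ^ s + \<gamma> / 2 * real n ^ Suc s"
    proof -
      have "V \<inter> X = X" by (auto simp: X_def)
      then show ?thesis using fin
        by (simp add: sum.distrib sum.If_cases n_def)
    qed
    finally have "\<gamma> / 2 * real n * real n ^ s \<le> real (card X) * real n ^ s"
      using big by (simp add: n_def)
    then have "\<gamma> / 2 * real n \<le> real (card X)" using n by simp
    with Mn have "M \<le> card X" by simp
    then obtain W where W: "W \<subseteq> X" "card W = M" "finite W"
      by (rule obtain_subset_with_card_n)
    have WV: "W \<subseteq> V" using W by (auto simp: X_def)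
    define S where "S p = {x \<in> W. x # p \<in> \<F>}" for p
    define L' where "L' = {p \<in> L. t \<le> card (S p)}"
    have S_le: "card (S p) \<le> M" for p
      using card_mono[OF W(3), of "S p"] W by (auto simp: S_def)
    have "real M * (\<gamma> / 2 * real n ^ s) \<le> (\<Sum>x\<in>W. real (card (T x)))"
    proof -
      have "(\<Sum>x\<in>W. \<gamma> / 2 * real n ^ s) \<le> (\<Sum>x\<in>W. real (card (T x)))"
        by (rule sum_mono) (use W in \<open>auto simp: X_def\<close>)
      then show ?thesis using W by simp
    qed
    also have "(\<Sum>x\<in>W. real (card (T x))) = (\<Sum>x\<in>W. \<Sum>p\<in>L. if x # p \<in> \<F> then 1 else 0)"
      using finL by (intro sum.cong refl) (simp add: T_def sum.If_cases Int_def)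
    also have "\<dots> = (\<Sum>p\<in>L. \<Sum>x\<in>W. if x # p \<in> \<F> then 1 else 0)"
      by (rule sum.swap)
    also have "\<dots> = (\<Sum>p\<in>L. real (card (S p)))"
      using W by (intro sum.cong refl) (simp add: S_def sum.If_cases Int_def)
    also have "\<dots> \<le> (\<Sum>p\<in>L. (if p \<in> L' then real M else 0) + real t)"
      by (rule sum_mono) (use S_le in \<open>auto simp: L'_def add_increasing2\<close>)
    also have "\<dots> = real (card L') * real M + real t * real n ^ s"
    proof -
      have "L \<inter> L' = L'" by (auto simp: L'_def)
      then show ?thesis using finL cardL
        by (simp add: sum.distrib sum.If_cases)
    qed
    also have "\<dots> \<le> real (card L') * real M + real M * (\<gamma> / 4) * real n ^ s"
      using M by (intro add_left_mono mult_right_mono) auto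
    finally have "real M * (\<gamma> / 4 * real n ^ s) \<le> real M * real (card L')"
      by (simp add: algebra_simps)
    moreover have "0 < real M" using M t Suc.prems by (cases "M = 0") auto
    ultimately have L': "\<gamma> / 4 * real n ^ s \<le> real (card L')" by simp
    have finL': "finite L'" using finL by (simp add: L'_def)
    have "\<exists>A\<in>Pow W. \<gamma>' * real n ^ s \<le> real (card {p \<in> L'. S p = A})"
    proof (rule ccontr)
      assume "\<not> ?thesis"
      then have "\<And>A. A \<in> Pow W \<Longrightarrow> real (card {p \<in> L'. S p = A}) < \<gamma>' * real n ^ s" by (meson not_le)
      then have "(\<Sum>A\<in>Pow W. real (card {p \<in> L'. S p = A})) < (\<Sum>A\<in>Pow W. \<gamma>' * real n ^ s)"
        using W by (intro sum_strict_mono) auto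
      also have "\<dots> = \<gamma> / 4 * real n ^ s" using W by (simp add: card_Pow \<gamma>'_def)
      also have "(\<Sum>A\<in>Pow W. real (card {p \<in> L'. S p = A})) = real (\<Sum>A\<in>Pow W. card {p \<in> L'. S p = A})"
        by simp
      also have "(\<Sum>A\<in>Pow W. card {p \<in> L'. S p = A}) = card (\<Union>A\<in>Pow W. {p \<in> L'. S p = A})"
        using W finL' by (intro card_UN_disjoint[symmetric]) auto
      also have "(\<Union>A\<in>Pow W. {p \<in> L'. S p = A}) = L'" by (auto simp: S_def)
      finally show False using L' by simp
    qed
    then obtain A where A: "A \<subseteq> W" "\<gamma>' * real n ^ s \<le> real (card {p \<in> L'. S p = A})" by auto
    define \<F>' where "\<F>' = {p \<in> L'. S p = A}"
    have "0 < \<gamma>' * real n ^ s" using \<gamma>' n by simp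
    with A(2) have "0 < real (card \<F>')" unfolding \<F>'_def by linarith
    then have ne: "\<F>' \<noteq> {}" by auto
    then have "t \<le> card A" by (auto simp: \<F>'_def L'_def)
    then obtain A' where A': "A' \<subseteq> A" "card A' = t" "finite A'"
      by (rule obtain_subset_with_card_n)
    have cons: "x # p \<in> \<F>" if "x \<in> A'" "p \<in> \<F>'" for x p
      using that A' by (auto simp: \<F>'_def S_def)
    \<comment> \<open>One retained head shows that the retained tails are themselves sorted tuples
      in \<open>V\<close>; it exists because 1 \<le> t.\<close>
    obtain x0 where "x0 \<in> A'" using A' t by fastforce
    then have "\<F>' \<subseteq> {xs. length xs = s \<and> set xs \<subseteq> V \<and> sorted_wrt adj xs}"
      using cons \<F> by fastforce
    from N'[OF fin _ this] A(2) n obtain As where As: "length As = s"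
      "\<forall>A\<in>set As. A \<subseteq> V \<and> card A = t \<and> (\<forall>b\<in>A. \<exists>p\<in>\<F>'. b \<in> set p)"
      "sorted_wrt (\<lambda>A B. \<forall>x\<in>A. \<forall>y\<in>B. adj x y) As"
      by (auto simp: n_def \<F>'_def)
    show "\<exists>As. length As = Suc s \<and> (\<forall>A\<in>set As. A \<subseteq> V \<and> card A = t \<and> (\<forall>b\<in>A. \<exists>p\<in>\<F>. b \<in> set p)) \<and>
      sorted_wrt (\<lambda>A B. \<forall>x\<in>A. \<forall>y\<in>B. adj x y) As"
    proof (intro exI[of _ "A' # As"] conjI)
      show "length (A' # As) = Suc s" using As by simp
      have "\<exists>p\<in>\<F>. b \<in> set p" if "b \<in> A'" for b
        using ne cons[OF that] by (metis all_not_in_conv list.set_intros(1))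
      moreover have "\<exists>p\<in>\<F>. b \<in> set p" if b: "b \<in> B" "B \<in> set As" for b B
      proof -
        obtain p where "p \<in> \<F>'" "b \<in> set p"
          using bspec[OF As(2) b(2)] b(1) by metis
        then show ?thesis using cons[OF \<open>x0 \<in> A'\<close>] by (meson list.set_intros(2))
      qed
      ultimately show "\<forall>A\<in>set (A' # As). A \<subseteq> V \<and> card A = t \<and> (\<forall>b\<in>A. \<exists>p\<in>\<F>. b \<in> set p)"
        using As A' A WV by auto
      have "adj x y" if y: "x \<in> A'" "y \<in> B" "B \<in> set As" for x y B
      proof -
        obtain p where "p \<in> \<F>'" "y \<in> set p"
          using bspec[OF As(2) y(3)] y(2) by metis
        moreover from this have "sorted_wrt adj (x # p)" using cons[OF y(1)] \<F> by blast
        ultimately show ?thesis by simp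
      qed
      then show "sorted_wrt (\<lambda>A B. \<forall>x\<in>A. \<forall>y\<in>B. adj x y) (A' # As)"
        using As by auto
    qed
  qed
qed

lemma has_blowup_if_many_cliques:
  assumes t: "1 \<le> t" and "0 < \<gamma>"
  shows "\<exists>N. \<forall>adj (V :: 'a set). finite V \<longrightarrow> N \<le> card V \<longrightarrow>
    \<gamma> * real (card V) ^ s \<le> real (card (cliques adj V s)) \<longrightarrow> has_blowup adj V s t"
proof -
  from box_blowup[OF assms, of s, where 'a = 'a] obtain N where N: "\<And>adj V \<F>. finite V \<Longrightarrow> N \<le> card V \<Longrightarrow>
    \<F> \<subseteq> {xs. length xs = s \<and> set xs \<subseteq> V \<and> sorted_wrt adj xs} \<Longrightarrow> \<gamma> * real (card V) ^ s \<le> real (card \<F>) \<Longrightarrow>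
    (\<exists>As. length As = s \<and> (\<forall>A\<in>set As. A \<subseteq> (V :: 'a set) \<and> card A = t \<and> (\<forall>b\<in>A. \<exists>p\<in>\<F>. b \<in> set p)) \<and>
      sorted_wrt (\<lambda>A B. \<forall>x\<in>A. \<forall>y\<in>B. adj x y) As)"
    by blast
  show ?thesis
  proof (rule exI[of _ N], intro allI impI)
    fix adj and V :: "'a set"
    assume fin: "finite V" and "N \<le> card V" and big: "\<gamma> * real (card V) ^ s \<le> real (card (cliques adj V s))"
    define \<F> where "\<F> = {xs. length xs = s \<and> set xs \<subseteq> V \<and> sorted_wrt adj xs}"
    have fin\<F>: "finite \<F>"
      by (rule finite_subset[OF _ finite_lists_length_eq[OF fin, of s]]) (auto simp: \<F>_def)
    have "cliques adj V s \<subseteq> set ` \<F>"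
    proof
      fix Q assume "Q \<in> cliques adj V s"
      then have Q: "finite Q" "card Q = s" "Q \<subseteq> V" "pairwise adj Q" by (auto simp: cliques_def)
      from finite_distinct_list[OF Q(1)] obtain xs where xs: "set xs = Q" "distinct xs" by blast
      have "sorted_wrt adj xs"
        unfolding sorted_wrt_iff_nth_less
        using xs Q(4) by (auto simp: pairwise_def nth_eq_iff_index_eq)
      then have "xs \<in> \<F>" using xs Q distinct_card[OF xs(2)] by (auto simp: \<F>_def)
      then show "Q \<in> set ` \<F>" using xs by auto
    qed
    then have "card (cliques adj V s) \<le> card \<F>" using fin\<F> by (rule surj_card_le[rotated])
    with big have "\<gamma> * real (card V) ^ s \<le> real (card \<F>)" by simp
    from N[OF fin \<open>N \<le> card V\<close> _ this, of adj] show "has_blowup adj V s t"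
      by (auto simp: \<F>_def has_blowup_def)
  qed
qed

text \<open>Vertices are classified by their neighbourhoods in the union \<open>K\<close> of the
  parts. More than \<open>h\<close> of them with the same trace would, together with
  \<open>h\<close> vertices of the trace in every part, form a blow-up with one more part; there are
  at most 2^(r t) traces.\<close>

lemma card_extending_vertices_le:
  assumes fin: "finite V" and As: "length As = r" "\<And>A. A \<in> set As \<Longrightarrow> A \<subseteq> V \<and> card A = t"
    "sorted_wrt (\<lambda>A B. \<forall>x\<in>A. \<forall>y\<in>B. adj x y) As"
    and no: "\<not> has_blowup adj V (Suc r) h"
  shows "card {x \<in> V. \<forall>A\<in>set As. h \<le> card {y \<in> A. adj x y}} \<le> 2 ^ (r * t) * h"
proof -
  define X where "X = {x \<in> V. \<forall>A\<in>set As. h \<le> card {y \<in> A. adj x y}}"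
  define K where "K = \<Union> (set As)"
  have finK: "finite K" using As(2) fin by (auto simp: K_def intro: finite_subset)
  have "card K \<le> (\<Sum>A\<in>set As. card A)"
    unfolding K_def by (rule card_Union_le_sum_card)
  also have "\<dots> = card (set As) * t" using As(2) by simp
  also have "\<dots> \<le> r * t" using card_length[of As] As(1) by simp
  finally have cardK: "card K \<le> r * t" .
  have finX: "finite X" using fin by (simp add: X_def)
  have small: "card {x \<in> X. {y \<in> K. adj x y} = P} \<le> h" for P
  proof (rule ccontr)
    assume neg: "\<not> ?thesis"
    then have "h \<le> card {x \<in> X. {y \<in> K. adj x y} = P}" by simp
    then obtain Y where Y: "Y \<subseteq> {x \<in> X. {y \<in> K. adj x y} = P}" "card Y = h"
      by (rule obtain_subset_with_card_n)
    define C where "C A = (SOME B. B \<subseteq> A \<inter> P \<and> card B = h)" for A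
    obtain x0 where x0: "x0 \<in> X" "{y \<in> K. adj x0 y} = P"
    proof -
      have "{x \<in> X. {y \<in> K. adj x y} = P} \<noteq> {}" using neg by fastforce
      then show ?thesis using that by blast
    qed
    have C: "C A \<subseteq> A \<inter> P \<and> card (C A) = h" if "A \<in> set As" for A
    proof -
      have "{y \<in> A. adj x0 y} = A \<inter> P" using x0 that by (auto simp: K_def)
      then have "h \<le> card (A \<inter> P)" using x0 that by (auto simp: X_def)
      then have "\<exists>B. B \<subseteq> A \<inter> P \<and> card B = h" by (meson obtain_subset_with_card_n)
      then show ?thesis unfolding C_def by (rule someI_ex)
    qed
    have "has_blowup adj V (Suc r) h"
      unfolding has_blowup_def
    proof (intro exI[of _ "Y # map C As"] conjI)
      show "length (Y # map C As) = Suc r" using As by simp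
      show "\<forall>A\<in>set (Y # map C As). A \<subseteq> V \<and> card A = h"
      proof
        fix A assume "A \<in> set (Y # map C As)"
        then consider "A = Y" | A0 where "A = C A0" "A0 \<in> set As" by auto
        then show "A \<subseteq> V \<and> card A = h"
        proof cases
          case 1
          then show ?thesis using Y by (auto simp: X_def)
        next
          case 2
          then show ?thesis using C[OF 2(2)] As(2)[OF 2(2)] by auto
        qed
      qed
      have "sorted_wrt (\<lambda>A B. \<forall>x\<in>C A. \<forall>y\<in>C B. adj x y) As"
        by (rule sorted_wrt_mono_rel[OF _ As(3)]) (use C in blast)
      moreover have "adj x y" if "x \<in> Y" "A \<in> set As" "y \<in> C A" for x y A
        using that Y C[OF that(2)] by blast
      ultimately show "sorted_wrt (\<lambda>A B. \<forall>x\<in>A. \<forall>y\<in>B. adj x y) (Y # map C As)"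
        by (simp add: sorted_wrt_map)
    qed
    with no show False ..
  qed
  have "X = (\<Union>P\<in>Pow K. {x \<in> X. {y \<in> K. adj x y} = P})" by auto
  then have "card X = card (\<Union>P\<in>Pow K. {x \<in> X. {y \<in> K. adj x y} = P})" by simp
  also have "\<dots> \<le> (\<Sum>P\<in>Pow K. card {x \<in> X. {y \<in> K. adj x y} = P})"
    by (rule card_UN_le) (use finK in simp)
  also have "\<dots> \<le> (\<Sum>P\<in>Pow K. h)" by (rule sum_mono) (rule small)
  also have "\<dots> = 2 ^ card K * h" using finK by (simp add: card_Pow)
  also have "\<dots> \<le> 2 ^ (r * t) * h" using cardK by (intro mult_right_mono power_increasing) auto
  finally show ?thesis by (simp add: X_def)
qed

section \<open>Ratios of consecutive clique counts\<close>

text \<open>If all ratios from \<open>j\<close> to \<open>r\<close> exceeded \<tau> n, their product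
  would contradict \<open>small\<close>; so the bound holds at some \<open>m\<close> between
  \<open>j\<close> and \<open>r\<close>. The Moon-Moser inequality carries it down from
  \<open>i + 1\<close> to \<open>i\<close>, because the Turan ratios 1 - i/r satisfy the recursion
  with equality.\<close>

lemma moon_moser_ratio:
  fixes c :: "nat \<Rightarrow> real"
  assumes n: "0 \<le> n" and c: "\<And>s. 0 \<le> c s"
    and mm: "\<And>s. (real (Suc s) * c (Suc s))\<^sup>2 \<le> c s * (n * c (Suc s) + real s * real (s + 2) * c (s + 2))"
    and r: "0 < r" and j: "j \<le> r" and \<tau>: "0 \<le> \<tau>"
    and small: "c (Suc r) < c j * (\<tau> * n / real (Suc r)) ^ (Suc r - j)"
    and s: "s \<le> j"
  shows "real (Suc s) * c (Suc s) \<le> (1 - real s / real r + \<tau>) * n * c s"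
proof -
  have "\<exists>m\<in>{j..r}. real (Suc m) * c (Suc m) \<le> \<tau> * n * c m"
  proof (rule ccontr)
    assume "\<not> ?thesis"
    then have *: "\<tau> * n * c m \<le> real (Suc m) * c (Suc m)" if "j \<le> m" "m \<le> r" for m
      using that by (auto simp: not_le intro: less_imp_le)
    have "c j * (\<tau> * n / real (Suc r)) ^ i \<le> c (j + i)" if "i \<le> Suc r - j" for i
      using that
    proof (induction i)
      case (Suc i)
      have "c j * (\<tau> * n / real (Suc r)) ^ Suc i = (\<tau> * n / real (Suc r)) * (c j * (\<tau> * n / real (Suc r)) ^ i)"
        by simp
      also have "\<dots> \<le> (\<tau> * n / real (Suc r)) * c (j + i)"
        using Suc n \<tau> by (intro mult_left_mono) auto
      also have "\<dots> = (\<tau> * n * c (j + i)) / real (Suc r)" by simp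
      also have "\<dots> \<le> (real (Suc (j + i)) * c (Suc (j + i))) / real (Suc r)"
        using *[of "j + i"] Suc.prems by (intro divide_right_mono) auto
      also have "\<dots> \<le> (real (Suc r) * c (Suc (j + i))) / real (Suc r)"
        using Suc.prems c by (intro divide_right_mono mult_right_mono) auto
      finally show ?case by simp
    qed simp
    from this[of "Suc r - j"] show False using small j by simp
  qed
  then obtain m where m: "j \<le> m" "m \<le> r" "real (Suc m) * c (Suc m) \<le> \<tau> * n * c m" by auto
  have "s \<le> m" using s m by simp
  then show ?thesis
  proof (induction rule: inc_induct)
    case base
    have "\<tau> * n * c m \<le> (1 - real m / real r + \<tau>) * n * c m"
      using m n c r by (intro mult_right_mono) auto
    with m(3) show ?case by linarith
  next
    case (step i)
    have ir: "real i \<le> real r" using step m by simp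
    show ?case
    \<comment> \<open>The Moon-Moser inequality has to be divided by this count.\<close>
    proof (cases "c (Suc i) = 0")
      case True
      have "0 \<le> 1 - real i / real r" using ir r by simp
      then show ?thesis using True c n \<tau> by simp
    next
      case False
      then have pos: "0 < c (Suc i)" using c[of "Suc i"] by simp
      have IH: "real (i + 2) * c (i + 2) \<le> (1 - real (Suc i) / real r + \<tau>) * n * c (Suc i)"
        using step.IH by simp
      have "(real (Suc i))\<^sup>2 * c (Suc i) * c (Suc i) = (real (Suc i) * c (Suc i))\<^sup>2"
        by (simp add: power2_eq_square)
      also have "\<dots> \<le> c i * (n * c (Suc i) + real i * (real (i + 2) * c (i + 2)))"
        using mm[of i] by (simp only: mult.assoc)
      also have "\<dots> \<le> c i * (n * c (Suc i) + real i * ((1 - real (Suc i) / real r + \<tau>) * n * c (Suc i)))"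
        by (intro mult_left_mono add_left_mono IH c) auto
      also have "\<dots> = (c i * n * (1 + real i * (1 - real (Suc i) / real r + \<tau>))) * c (Suc i)"
        by (simp add: algebra_simps)
      finally have "(real (Suc i))\<^sup>2 * c (Suc i) \<le> c i * n * (1 + real i * (1 - real (Suc i) / real r + \<tau>))"
        using pos by simp
      also have "1 + real i * (1 - real (Suc i) / real r + \<tau>) = real (Suc i) * (1 - real i / real r) + real i * \<tau>"
        using r by (simp add: field_simps)
      also have "c i * n * (real (Suc i) * (1 - real i / real r) + real i * \<tau>)
          \<le> c i * n * (real (Suc i) * (1 - real i / real r) + real (Suc i) * \<tau>)"
        using c n \<tau> by (intro mult_left_mono add_left_mono mult_right_mono) auto
      also have "\<dots> = real (Suc i) * ((1 - real i / real r + \<tau>) * n * c i)"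
        by (simp add: algebra_simps)
      finally have "real (Suc i) * (real (Suc i) * c (Suc i)) \<le> real (Suc i) * ((1 - real i / real r + \<tau>) * n * c i)"
        by (simp add: power2_eq_square mult.assoc)
      then show ?thesis by (simp only: mult_le_cancel_left_pos of_nat_0_less_iff zero_less_Suc)
    qed
  qed
qed

section \<open>Near-extremal graphs\<close>

lemma has_blowup_mono: "has_blowup adj W s t \<Longrightarrow> W \<subseteq> V \<Longrightarrow> has_blowup adj V s t"
proof -
  assume "has_blowup adj W s t" and WV: "W \<subseteq> V"
  then obtain As where "length As = s" "\<forall>A\<in>set As. A \<subseteq> W \<and> card A = t"
    "sorted_wrt (\<lambda>A B. \<forall>x\<in>A. \<forall>y\<in>B. adj x y) As"
    by (auto simp: has_blowup_def)
  then show ?thesis using WV unfolding has_blowup_def by (intro exI[of _ As]) auto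
qed

text \<open>Without the blow-up there are fewer than \<gamma> n^(r+1) cliques on r + 1 vertices. The
  lower bound on the j-cliques turns this into the relative smallness that
  \<open>moon_moser_ratio\<close> asks for, and \<gamma> is solved from that requirement.\<close>

lemma clique_ratio_upper:
  assumes h: "1 \<le> h" and r: "0 < r" and j: "j \<le> r" and c0: "0 < c0" and \<tau>: "0 < \<tau>"
  shows "\<exists>N. \<forall>adj (V :: 'a set) s. finite V \<longrightarrow> symp adj \<longrightarrow> irreflp adj \<longrightarrow> N \<le> card V \<longrightarrow>
    \<not> has_blowup adj V (Suc r) h \<longrightarrow> c0 * real (card V) ^ j \<le> real (card (cliques adj V j)) \<longrightarrow> s \<le> j \<longrightarrow>
    real (Suc s) * real (card (cliques adj V (Suc s))) \<le>
      (1 - real s / real r + \<tau>) * real (card V) * real (card (cliques adj V s))"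
proof -
  define \<gamma> where "\<gamma> = c0 * (\<tau> / real (Suc r)) ^ (Suc r - j)"
  have "0 < \<gamma>" using c0 \<tau> by (simp add: \<gamma>_def)
  from has_blowup_if_many_cliques[OF h this, of "Suc r", where 'a = 'a]
  obtain N where N: "\<And>adj (V :: 'a set). finite V \<Longrightarrow> N \<le> card V \<Longrightarrow>
      \<gamma> * real (card V) ^ Suc r \<le> real (card (cliques adj V (Suc r))) \<Longrightarrow> has_blowup adj V (Suc r) h"
    by blast
  show ?thesis
  proof (rule exI[of _ N], intro allI impI)
    fix adj and V :: "'a set" and s
    assume V: "finite V" "symp adj" "irreflp adj" "N \<le> card V" "\<not> has_blowup adj V (Suc r) h"
      and cj: "c0 * real (card V) ^ j \<le> real (card (cliques adj V j))" and s: "s \<le> j"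
    define n where "n = real (card V)"
    have "real (card (cliques adj V (Suc r))) < \<gamma> * n ^ Suc r"
      using N[of V adj] V unfolding n_def by linarith
    also have "\<gamma> * n ^ Suc r = (c0 * n ^ j) * (\<tau> * n / real (Suc r)) ^ (Suc r - j)"
    proof -
      have "n ^ Suc r = n ^ j * n ^ (Suc r - j)" using j by (simp flip: power_add)
      then show ?thesis by (simp add: \<gamma>_def power_mult_distrib power_divide del: power_Suc)
    qed
    also have "\<dots> \<le> real (card (cliques adj V j)) * (\<tau> * n / real (Suc r)) ^ (Suc r - j)"
      using cj \<tau> by (intro mult_right_mono) (auto simp: n_def)
    finally have small: "real (card (cliques adj V (Suc r))) < real (card (cliques adj V j)) * (\<tau> * n / real (Suc r)) ^ (Suc r - j)" .
    show "real (Suc s) * real (card (cliques adj V (Suc s))) \<le>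
      (1 - real s / real r + \<tau>) * real (card V) * real (card (cliques adj V s))"
    proof (rule moon_moser_ratio[OF _ _ _ r j _ small[unfolded n_def] s])
      fix s
      have "real ((Suc s * card (cliques adj V (Suc s)))\<^sup>2) \<le> real (card (cliques adj V s) *
        (card V * card (cliques adj V (Suc s)) + s * (s + 2) * card (cliques adj V (Suc (Suc s)))))"
        using moon_moser[OF V(1-3), of s] by (rule of_nat_mono)
      then show "(real (Suc s) * real (card (cliques adj V (Suc s))))\<^sup>2 \<le> real (card (cliques adj V s)) *
        (real (card V) * real (card (cliques adj V (Suc s))) + real s * real (s + 2) * real (card (cliques adj V (s + 2))))"
        by (simp add: algebra_simps)
    qed (use \<tau> in auto)
  qed
qed

lemma card_cliques_prod_upper:
  assumes "\<And>s. s < j \<Longrightarrow> 0 \<le> \<rho> s"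
    and "\<And>s. s < j \<Longrightarrow> real (Suc s) * real (card (cliques adj V (Suc s))) \<le>
      \<rho> s * real (card V) * real (card (cliques adj V s))"
  shows "fact j * real (card (cliques adj V j)) \<le> real (card V) ^ j * (\<Prod>s<j. \<rho> s)"
  using assms
proof (induction j)
  case (Suc j)
  have "fact (Suc j) * real (card (cliques adj V (Suc j))) =
      fact j * (real (Suc j) * real (card (cliques adj V (Suc j))))" by simp
  also have "\<dots> \<le> fact j * (\<rho> j * real (card V) * real (card (cliques adj V j)))"
    using Suc.prems by (intro mult_left_mono) auto
  also have "\<dots> = \<rho> j * real (card V) * (fact j * real (card (cliques adj V j)))" by simp
  also have "\<dots> \<le> \<rho> j * real (card V) * (real (card V) ^ j * (\<Prod>s<j. \<rho> s))"
    using Suc by (intro mult_left_mono) auto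
  finally show ?case by (simp add: mult_ac)
qed simp

lemma degree_sums:
  assumes "finite V" "symp adj" "irreflp adj"
  shows "(\<Sum>x\<in>V. card (common_nbrs adj V {x})) = 2 * card (cliques adj V 2)"
    and "(\<Sum>x\<in>V. (card (common_nbrs adj V {x}))\<^sup>2) \<le>
      card V * card (cliques adj V 2) + 3 * card (cliques adj V 3)"
  using sum_card_common_nbrs[OF assms, of "Suc 0"] sum_card_common_nbrs_sq[OF assms, of "Suc 0"]
  by (simp_all add: cliques_1 sum.reindex numeral_2_eq_2 numeral_3_eq_3)

text \<open>A Chebyshev argument. The k-clique count is a product of ratios, none of which exceeds
  its Turan value by much, so none falls short by much either; the ratio at s = 1 gives an average
  degree of about (1 - 1/r) n. The ratio at s = 2 bounds the triangles, hence the sum of the squared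
  degrees, and the degrees are concentrated.\<close>

lemma card_low_degree_le:
  assumes k: "3 \<le> k" "k \<le> r" and h: "1 \<le> h" and \<kappa>: "0 < \<kappa>"
  shows "\<exists>N. \<exists>\<eta>>0. \<forall>adj (V :: 'a set). finite V \<longrightarrow> symp adj \<longrightarrow> irreflp adj \<longrightarrow> N \<le> card V \<longrightarrow>
    \<not> has_blowup adj V (Suc r) h \<longrightarrow>
    real (card V) ^ k * ((\<Prod>s<k. 1 - real s / real r) - \<eta>) \<le> fact k * real (card (cliques adj V k)) \<longrightarrow>
    real (card {x \<in> V. real (card (common_nbrs adj V {x})) < (1 - 1 / real r - \<kappa>) * real (card V)})
      \<le> \<kappa> * real (card V)"
proof -
  \<comment> \<open>The squared deviations of the degrees from \<mu> n will sum to at most (\<tau>/2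
    + \<mu> \<epsilon>) n^3 with \<tau> < \<epsilon>, and Chebyshev asks for \<kappa>^3 n^3. The cap
    1/2 keeps \<mu> - \<epsilon> nonnegative.\<close>
  define \<epsilon> where "\<epsilon> = min (\<kappa> ^ 3 / 2) (1 / 2)"
  have \<epsilon>: "0 < \<epsilon>" "\<epsilon> \<le> \<kappa> ^ 3 / 2" "\<epsilon> \<le> 1 / 2" using \<kappa> by (auto simp: \<epsilon>_def)
  define \<mu> where "\<mu> = 1 - 1 / real r"
  have r3: "3 \<le> r" using k by simp
  then have \<mu>: "1 / 2 \<le> \<mu>" "\<mu> \<le> 1" by (auto simp: \<mu>_def field_simps)
  define P where "P = (\<Prod>s<k. 1 - real s / real r)"
  have fpos: "0 < 1 - real s / real r" if "s < k" for s
    using that k by (auto simp: field_simps)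
  have P: "0 < P" unfolding P_def by (intro prod_pos) (use fpos in auto)
  \<comment> \<open>Upper bounds for the ratios in the hypothetical case that the edge ratio, at s =
    1, is below \<mu> - \<epsilon>. Their product at \<tau> = 0 is P - \<epsilon> Q, which is less
    than P - \<eta>, so some \<tau> > 0 still contradicts the clique count.\<close>
  define \<rho> where "\<rho> \<tau> s = (if s = 1 then \<mu> - \<epsilon> else 1 - real s / real r + \<tau>)" for \<tau> :: real and s
  have split1: "(\<Prod>s<k. f s) = f 1 * (\<Prod>s\<in>{..<k} - {1}. f s)" for f :: "nat \<Rightarrow> real"
    by (rule prod.remove) (use k in auto)
  define Q where "Q = (\<Prod>s\<in>{..<k} - {1}. 1 - real s / real r)"
  have Q: "0 < Q" unfolding Q_def by (intro prod_pos) (use fpos in auto)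
  have PQ: "P = \<mu> * Q" unfolding P_def Q_def \<mu>_def split1 by simp
  have "(\<Prod>s<k. \<rho> 0 s) = (\<mu> - \<epsilon>) * Q"
    unfolding split1 by (auto simp: \<rho>_def Q_def intro!: prod.cong)
  then have "(\<Prod>s<k. \<rho> 0 s) = P - \<epsilon> * Q" using PQ by (simp add: algebra_simps)
  define \<eta> where "\<eta> = min (\<epsilon> * Q / 2) (P / 2)"
  have \<eta>: "0 < \<eta>" "\<eta> \<le> P / 2" "\<eta> < \<epsilon> * Q" using \<epsilon> P Q by (auto simp: \<eta>_def min_def)
  have "((\<lambda>\<tau>. \<Prod>s<k. \<rho> \<tau> s) \<longlongrightarrow> (\<Prod>s<k. \<rho> 0 s)) (at_right 0)"
    unfolding \<rho>_def by (intro tendsto_intros) (auto intro!: tendsto_eq_intros)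
  then have "\<forall>\<^sub>F \<tau> in at_right 0. (\<Prod>s<k. \<rho> \<tau> s) < P - \<eta>"
    using \<open>_ = P - \<epsilon> * Q\<close> \<eta> by (intro order_tendstoD) auto
  moreover have "\<forall>\<^sub>F \<tau> in at_right 0. \<tau> < \<epsilon>"
    by (rule order_tendstoD(2)[OF tendsto_ident_at \<epsilon>(1)])
  moreover have "\<forall>\<^sub>F \<tau> :: real in at_right 0. 0 < \<tau>" by (rule eventually_at_right_less)
  ultimately have "\<forall>\<^sub>F \<tau> in at_right 0. (\<Prod>s<k. \<rho> \<tau> s) < P - \<eta> \<and> \<tau> < \<epsilon> \<and> 0 < \<tau>"
    by eventually_elim auto
  then obtain \<tau> where \<tau>: "(\<Prod>s<k. \<rho> \<tau> s) < P - \<eta>" "\<tau> < \<epsilon>" "0 < \<tau>"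
    using eventually_happens'[OF trivial_limit_at_right_real] by blast
  define c0 where "c0 = P / 2 / fact k"
  have c0: "0 < c0" using P by (simp add: c0_def)
  have r0: "0 < r" using k by simp
  from clique_ratio_upper[OF h r0 k(2) c0 \<tau>(3), where 'a = 'a] obtain N
    where N: "\<And>adj (V :: 'a set) s. finite V \<Longrightarrow> symp adj \<Longrightarrow> irreflp adj \<Longrightarrow> N \<le> card V \<Longrightarrow>
    \<not> has_blowup adj V (Suc r) h \<Longrightarrow> c0 * real (card V) ^ k \<le> real (card (cliques adj V k)) \<Longrightarrow> s \<le> k \<Longrightarrow>
    real (Suc s) * real (card (cliques adj V (Suc s))) \<le>
      (1 - real s / real r + \<tau>) * real (card V) * real (card (cliques adj V s))"
    by blast
  show ?thesis
  proof (intro exI[of _ "max N 1"] exI[of _ \<eta>] conjI allI impI)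
    show "0 < \<eta>" by (rule \<eta>(1))
    fix adj and V :: "'a set"
    assume V: "finite V" "symp adj" "irreflp adj" and N': "max N 1 \<le> card V"
      and noV: "\<not> has_blowup adj V (Suc r) h"
      and ck: "real (card V) ^ k * ((\<Prod>s<k. 1 - real s / real r) - \<eta>) \<le> fact k * real (card (cliques adj V k))"
    define n where "n = real (card V)"
    have n: "0 < n" using N' by (auto simp: n_def)
    define c where "c s = real (card (cliques adj V s))" for s
    have "n ^ k * (P / 2) \<le> n ^ k * (P - \<eta>)" using \<eta> n by (intro mult_left_mono) auto
    also have "\<dots> \<le> fact k * c k" using ck by (simp add: n_def P_def c_def)
    finally have "c0 * n ^ k \<le> c k" by (simp add: c0_def field_simps)
    then have ratio: "real (Suc s) * c (Suc s) \<le> (1 - real s / real r + \<tau>) * n * c s" if "s \<le> k" for s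
      using N[OF V _ noV _ that] N' by (simp add: c_def n_def)
    have c1: "c 1 = n" by (simp add: c_def n_def)
    have c2: "(\<mu> - \<epsilon>) * n\<^sup>2 \<le> 2 * c 2"
    proof (rule ccontr)
      assume "\<not> ?thesis"
      then have neg: "2 * c 2 \<le> (\<mu> - \<epsilon>) * n\<^sup>2" by simp
      have "fact k * real (card (cliques adj V k)) \<le> real (card V) ^ k * (\<Prod>s<k. \<rho> \<tau> s)"
      proof (rule card_cliques_prod_upper)
        fix s assume s: "s < k"
        show "0 \<le> \<rho> \<tau> s" using \<mu> \<epsilon> fpos[OF s] \<tau> by (auto simp: \<rho>_def)
        show "real (Suc s) * real (card (cliques adj V (Suc s))) \<le> \<rho> \<tau> s * real (card V) * real (card (cliques adj V s))"
        proof (cases "s = 1")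
          case True
          then show ?thesis using neg c1
            by (simp add: \<rho>_def c_def n_def power2_eq_square numeral_2_eq_2)
        next
          case False
          then show ?thesis using ratio[of s] s by (simp add: \<rho>_def c_def n_def)
        qed
      qed
      also have "\<dots> < real (card V) ^ k * (P - \<eta>)"
        using \<tau>(1) n by (intro mult_strict_left_mono) (auto simp: n_def)
      finally show False using ck by (simp add: P_def)
    qed
    define d where "d x = real (card (common_nbrs adj V {x}))" for x
    have S: "(\<Sum>x\<in>V. d x) = 2 * c 2"
      using arg_cong[OF degree_sums(1)[OF V], of real] by (simp add: d_def c_def)
    have "real (\<Sum>x\<in>V. (card (common_nbrs adj V {x}))\<^sup>2) \<le>
      real (card V * card (cliques adj V 2) + 3 * card (cliques adj V 3))"
      using degree_sums(2)[OF V] by (rule of_nat_mono)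
    then have "(\<Sum>x\<in>V. (d x)\<^sup>2) \<le> n * c 2 + 3 * c 3" by (simp add: d_def n_def c_def)
    also have "3 * c 3 \<le> (1 - 2 / real r + \<tau>) * n * c 2"
      using ratio[of 2] k by (simp add: numeral_3_eq_3)
    finally have S2: "(\<Sum>x\<in>V. (d x)\<^sup>2) \<le> (\<mu> + \<tau> / 2) * n * (2 * c 2)"
      by (simp add: \<mu>_def algebra_simps)
    have "d x \<le> n" for x
      unfolding d_def n_def using V by (simp add: card_mono common_nbrs_def)
    then have "(\<Sum>x\<in>V. d x) \<le> (\<Sum>x\<in>V. n)" by (intro sum_mono)
    then have S_le: "2 * c 2 \<le> n * n" using S by (simp add: n_def)
    have "(\<Sum>x\<in>V. (d x - \<mu> * n)\<^sup>2) = (\<Sum>x\<in>V. (d x)\<^sup>2 - 2 * \<mu> * n * d x + (\<mu> * n)\<^sup>2)"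
      by (intro sum.cong refl) (simp add: power2_eq_square algebra_simps)
    also have "\<dots> = (\<Sum>x\<in>V. (d x)\<^sup>2) - 2 * \<mu> * n * (2 * c 2) + n * (\<mu> * n)\<^sup>2"
      by (simp add: sum.distrib sum_subtractf sum_distrib_left[symmetric] S n_def)
    also have "\<dots> \<le> (\<mu> + \<tau> / 2) * n * (2 * c 2) - 2 * \<mu> * n * (2 * c 2) + n * (\<mu> * n)\<^sup>2"
      using S2 by simp
    also have "\<dots> = (\<tau> / 2 * n) * (2 * c 2) - (\<mu> * n) * (2 * c 2) + n * (\<mu> * n)\<^sup>2"
      by (simp add: algebra_simps)
    also have "\<dots> \<le> (\<tau> / 2 * n) * (n * n) - (\<mu> * n) * ((\<mu> - \<epsilon>) * n\<^sup>2) + n * (\<mu> * n)\<^sup>2"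
      using S_le c2 \<tau> \<mu> n by (intro add_right_mono diff_mono mult_left_mono) auto
    also have "\<dots> = (\<tau> / 2 + \<mu> * \<epsilon>) * n ^ 3"
      by (simp add: power2_eq_square power3_eq_cube algebra_simps)
    also have "\<dots> \<le> \<kappa> ^ 3 * n ^ 3"
    proof (rule mult_right_mono)
      have "\<mu> * \<epsilon> \<le> 1 * \<epsilon>" using \<mu> \<epsilon> by (intro mult_right_mono) auto
      then show "\<tau> / 2 + \<mu> * \<epsilon> \<le> \<kappa> ^ 3" using \<tau> \<epsilon> by linarith
    qed (use n in simp)
    finally have var: "(\<Sum>x\<in>V. (d x - \<mu> * n)\<^sup>2) \<le> \<kappa> ^ 3 * n ^ 3" .
    define B where "B = {x \<in> V. d x < (\<mu> - \<kappa>) * n}"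
    have "real (card B) * (\<kappa> * n)\<^sup>2 = (\<Sum>x\<in>B. (\<kappa> * n)\<^sup>2)" by simp
    also have "\<dots> \<le> (\<Sum>x\<in>B. (d x - \<mu> * n)\<^sup>2)"
    proof (rule sum_mono)
      fix x assume "x \<in> B"
      then have "\<kappa> * n \<le> \<mu> * n - d x" by (simp add: B_def algebra_simps)
      then have "(\<kappa> * n)\<^sup>2 \<le> (\<mu> * n - d x)\<^sup>2" using \<kappa> n by (intro power_mono) auto
      then show "(\<kappa> * n)\<^sup>2 \<le> (d x - \<mu> * n)\<^sup>2" by (simp add: power2_commute)
    qed
    also have "\<dots> \<le> (\<Sum>x\<in>V. (d x - \<mu> * n)\<^sup>2)"
      using V by (intro sum_mono2) (auto simp: B_def)
    also note var
    also have "\<kappa> ^ 3 * n ^ 3 = (\<kappa> * n) * (\<kappa> * n)\<^sup>2" by (simp add: power2_eq_square power3_eq_cube)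
    finally have "real (card B) \<le> \<kappa> * n" using \<kappa> n by simp
    then show "real (card {x \<in> V. real (card (common_nbrs adj V {x})) < (1 - 1 / real r - \<kappa>) * real (card V)})
      \<le> \<kappa> * real (card V)" by (simp add: B_def d_def \<mu>_def n_def)
  qed
qed

lemma card_nonadj:
  assumes "finite V" "symp adj" "x \<in> V" "W \<subseteq> V"
    and "(1 - 1 / real r - \<kappa>) * real (card V) \<le> real (card (common_nbrs adj V {x}))"
  shows "real (card {y \<in> W. \<not> adj x y}) \<le> (1 / real r + \<kappa>) * real (card V)"
proof -
  have "{y \<in> V. \<not> adj x y} \<union> common_nbrs adj V {x} = V" "{y \<in> V. \<not> adj x y} \<inter> common_nbrs adj V {x} = {}"
    using assms(2) by (auto simp: common_nbrs_def symp_def)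
  then have "card {y \<in> V. \<not> adj x y} + card (common_nbrs adj V {x}) = card V"
    using assms(1) by (metis card_Un_disjoint finite_Un)
  moreover have "card {y \<in> W. \<not> adj x y} \<le> card {y \<in> V. \<not> adj x y}"
    using assms by (intro card_mono) auto
  ultimately have "real (card {y \<in> W. \<not> adj x y}) + real (card (common_nbrs adj V {x})) \<le> real (card V)"
    by linarith
  then show ?thesis using assms(5) by (simp add: algebra_simps)
qed

text \<open>In a complete \<open>r\<close>-partite graph with large parts, almost every vertex has few neighbours in
  some part; a part \<open>A\<close> for which this happens for about \<open>n/r\<close> vertices has almost no non-neighbours
  elsewhere, so a few of its vertices still have almost \<open>(1 - 1/r) n\<close> common neighbours.\<close>

lemma blowup_common_nbrs:
  fixes V :: "'a set"
  assumes fin: "finite V" and adj: "symp adj" and r: "0 < r" and h: "1 \<le> h" and \<kappa>: "0 < \<kappa>" "\<kappa> \<le> 1"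
    and As: "length As = r" "\<And>A. A \<in> set As \<Longrightarrow> A \<subseteq> V \<and> card A = t"
      "sorted_wrt (\<lambda>A B. \<forall>x\<in>A. \<forall>y\<in>B. adj x y) As"
    and no: "\<not> has_blowup adj V (Suc r) h"
    and deg: "\<And>A x. A \<in> set As \<Longrightarrow> x \<in> A \<Longrightarrow>
      (1 - 1 / real r - \<kappa>) * real (card V) \<le> real (card (common_nbrs adj V {x}))"
    and t: "2 * m \<le> t" "real h \<le> \<kappa> * real t / 2"
    and n: "2 ^ (r * t) * real h \<le> \<kappa> * real (card V)"
  shows "\<exists>A\<subseteq>V. card A = m \<and> (1 - 1 / real r - (3 + 6 * real m) * \<kappa>) * real (card V) \<le> real (card (common_nbrs adj V A))"
proof -
  define n where "n = real (card V)"
  \<comment> \<open>The vertices with almost no neighbours in \<open>A\<close>. A vertex outside all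
    these sets has \<open>h\<close> neighbours in every part, and there are few such vertices; so
    one of the at most \<open>r\<close> sets has about n/r elements.\<close>
  define C where "C A = {x \<in> V. card {y \<in> A. adj x y} < h}" for A
  have finC: "finite (C A)" for A using fin by (simp add: C_def)
  define X where "X = {x \<in> V. \<forall>A\<in>set As. h \<le> card {y \<in> A. adj x y}}"
  have "card X \<le> 2 ^ (r * t) * h"
    unfolding X_def using card_extending_vertices_le[OF fin As no] .
  then have "real (card X) \<le> real (2 ^ (r * t) * h)" by (rule of_nat_mono)
  then have X: "real (card X) \<le> \<kappa> * n" using n by (simp add: n_def)
  have ht: "0 < real t" "real h \<le> real t / 2"
  proof -
    have "1 \<le> real h" using h by simp
    then have "0 < \<kappa> * real t" using t(2) by linarith
    then show "0 < real t" using \<kappa> by (simp add: zero_less_mult_iff)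
    then have "\<kappa> * real t \<le> 1 * real t" using \<kappa> by (intro mult_right_mono) auto
    then show "real h \<le> real t / 2" using t(2) by linarith
  qed
  have "\<exists>A\<in>set As. (1 - \<kappa>) * n \<le> real r * real (card (C A))"
  proof (rule ccontr)
    assume "\<not> ?thesis"
    then have neg: "\<And>A. A \<in> set As \<Longrightarrow> real (card (C A)) \<le> (1 - \<kappa>) * n / real r"
      and neg': "\<And>A. A \<in> set As \<Longrightarrow> real r * real (card (C A)) < (1 - \<kappa>) * n"
      using r by (auto simp: field_simps not_le intro: less_imp_le)
    have "V \<subseteq> (\<Union>A\<in>set As. C A) \<union> X" by (auto simp: X_def C_def not_le)
    then have "card V \<le> card ((\<Union>A\<in>set As. C A) \<union> X)"
      using fin finC by (intro card_mono) (auto simp: X_def)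
    also have "\<dots> \<le> card (\<Union>A\<in>set As. C A) + card X" by (rule card_Un_le)
    also have "card (\<Union>A\<in>set As. C A) \<le> (\<Sum>A\<in>set As. card (C A))" by (rule card_UN_le) simp
    finally have "card V \<le> (\<Sum>A\<in>set As. card (C A)) + card X" by simp
    then have "n \<le> real ((\<Sum>A\<in>set As. card (C A)) + card X)" unfolding n_def by (rule of_nat_mono)
    then have le: "n \<le> (\<Sum>A\<in>set As. real (card (C A))) + \<kappa> * n" using X by simp
    obtain A0 where A0: "A0 \<in> set As" using As(1) r by (metis length_greater_0_conv nth_mem)
    have sgl: "0 < (1 - \<kappa>) * n" using neg'[OF A0] by (smt (verit) mult_nonneg_nonneg of_nat_0_le_iff)
    have "real r * (\<Sum>A\<in>set As. real (card (C A))) = (\<Sum>A\<in>set As. real r * real (card (C A)))"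
      by (rule sum_distrib_left)
    also have "\<dots> < (\<Sum>A\<in>set As. (1 - \<kappa>) * n)"
      using neg' A0 by (intro sum_strict_mono) auto
    also have "\<dots> = real (card (set As)) * ((1 - \<kappa>) * n)" by simp
    also have "\<dots> \<le> real r * ((1 - \<kappa>) * n)"
      using card_length[of As] As(1) sgl by (intro mult_right_mono) auto
    finally have "(\<Sum>A\<in>set As. real (card (C A))) < (1 - \<kappa>) * n" using r by simp
    with le show False by (simp add: algebra_simps)
  qed
  then obtain A where A: "A \<in> set As" and bigC: "(1 - \<kappa>) * n \<le> real r * real (card (C A))" by auto
  have AV: "A \<subseteq> V" "card A = t" using As(2)[OF A] by auto
  have finA: "finite A" using AV fin finite_subset by blast
  define nn where "nn y = {x \<in> V. \<not> adj y x}" for y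
  have finn: "finite (nn y)" for y using fin by (simp add: nn_def)
  have nn: "real (card (nn y)) \<le> (1 / real r + \<kappa>) * n" if "y \<in> A" for y
    unfolding nn_def n_def using that AV by (intro card_nonadj[OF fin adj _ subset_refl deg[OF A]]) auto
  \<comment> \<open>Non-adjacent pairs between \<open>A\<close> and \<open>C A\<close> are counted
    from both sides. Nearly all pairs are non-adjacent, which uses up the roughly n/r non-neighbours
    that a vertex of \<open>A\<close> can have; few are left outside \<open>C A\<close>.\<close>
  have "real (card (C A)) * (real t - real h) = (\<Sum>x\<in>C A. real t - real h)" by simp
  also have "\<dots> \<le> (\<Sum>x\<in>C A. real (card {y \<in> A. \<not> adj y x}))"
  proof (rule sum_mono)
    fix x assume x: "x \<in> C A"
    have "A = {y \<in> A. adj x y} \<union> {y \<in> A. \<not> adj y x}" using adj by (auto simp: symp_def)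
    then have "card A \<le> card {y \<in> A. adj x y} + card {y \<in> A. \<not> adj y x}"
      using card_Un_le[of "{y \<in> A. adj x y}" "{y \<in> A. \<not> adj y x}"] by simp
    then show "real t - real h \<le> real (card {y \<in> A. \<not> adj y x})"
      using x AV by (auto simp: C_def)
  qed
  also have "\<dots> = (\<Sum>x\<in>C A. \<Sum>y\<in>A. if \<not> adj y x then 1 else 0)"
    using finA by (intro sum.cong refl) (simp add: sum.If_cases Int_def)
  also have "\<dots> = (\<Sum>y\<in>A. \<Sum>x\<in>C A. if \<not> adj y x then 1 else 0)" by (rule sum.swap)
  also have "\<dots> = (\<Sum>y\<in>A. real (card (nn y \<inter> C A)))"
    using finC by (intro sum.cong refl) (auto simp: sum.If_cases nn_def C_def intro!: arg_cong[where f = card])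
  finally have cnt: "real (card (C A)) * (real t - real h) \<le> (\<Sum>y\<in>A. real (card (nn y \<inter> C A)))" .
  have split: "real (card (nn y)) = real (card (nn y \<inter> C A)) + real (card (nn y - C A))" for y
    using card_Int_Diff[OF finn, of y "C A"] by simp
  have "(\<Sum>y\<in>A. real (card (nn y))) \<le> (\<Sum>y\<in>A. (1 / real r + \<kappa>) * n)"
    using nn by (rule sum_mono)
  then have tot: "(\<Sum>y\<in>A. real (card (nn y \<inter> C A))) + (\<Sum>y\<in>A. real (card (nn y - C A))) \<le> real t * ((1 / real r + \<kappa>) * n)"
    unfolding split sum.distrib using AV by simp
  have n0: "0 \<le> n" by (simp add: n_def)
  define E where "E = 3 * \<kappa> * n"
  have out: "(\<Sum>y\<in>A. real (card (nn y - C A))) \<le> real t * E"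
  proof -
    have "(1 - \<kappa>) * n / real r * (real t - real h) \<le> real (card (C A)) * (real t - real h)"
      using bigC ht r by (intro mult_right_mono) (auto simp: field_simps)
    moreover have "a \<le> b \<Longrightarrow> b \<le> s \<Longrightarrow> s + u \<le> v \<Longrightarrow> u \<le> v - a" for a b s u v :: real
      by linarith
    ultimately have "(\<Sum>y\<in>A. real (card (nn y - C A))) \<le> real t * ((1 / real r + \<kappa>) * n) - (1 - \<kappa>) * n / real r * (real t - real h)"
      using cnt tot by blast
    also have "\<dots> = real t * \<kappa> * n + (real t - (1 - \<kappa>) * (real t - real h)) * (n / real r)"
      using r by (simp add: field_simps)
    also have "real t - (1 - \<kappa>) * (real t - real h) = real h + \<kappa> * real t - \<kappa> * real h"
      by (simp add: algebra_simps)
    also have "(real h + \<kappa> * real t - \<kappa> * real h) * (n / real r) \<le> (2 * \<kappa> * real t) * n"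
    proof (rule mult_mono)
      have "0 \<le> \<kappa> * real h" "0 \<le> \<kappa> * real t" using \<kappa> by auto
      then show "real h + \<kappa> * real t - \<kappa> * real h \<le> 2 * \<kappa> * real t" using t(2) by linarith
      show "n / real r \<le> n" using r n0 by (simp add: divide_le_eq mult_le_cancel_left1)
    qed (use \<kappa> n0 in auto)
    finally show ?thesis by (simp add: E_def algebra_simps)
  qed
  \<comment> \<open>Markov: at most half of \<open>A\<close> can exceed twice the average bound
    \<open>E\<close>, and 2 m \<le> t.\<close>
  define G where "G = {y \<in> A. real (card (nn y - C A)) \<le> 2 * E}"
  have finG: "finite G" using finA by (simp add: G_def)
  have "m \<le> card G"
  proof (rule ccontr)
    assume "\<not> ?thesis"
    then have lt: "real (card G) < real t / 2" using t(1) by linarith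
    have cAG: "real (card (A - G)) = real t - real (card G)"
      using AV finA by (subst card_Diff_subset) (auto simp: G_def card_mono of_nat_diff intro: finite_subset)
    have ne: "A - G \<noteq> {}"
    proof
      assume "A - G = {}"
      then have "real (card (A - G)) = 0" by (metis card.empty of_nat_0)
      then show False using cAG lt ht by linarith
    qed
    have "real t / 2 * (2 * E) \<le> real (card (A - G)) * (2 * E)"
      using cAG lt n0 \<kappa> by (intro mult_right_mono) (auto simp: E_def)
    also have "\<dots> = (\<Sum>y\<in>A - G. 2 * E)" by simp
    also have "\<dots> < (\<Sum>y\<in>A - G. real (card (nn y - C A)))"
      using finA ne by (intro sum_strict_mono) (auto simp: G_def)
    also have "\<dots> \<le> (\<Sum>y\<in>A. real (card (nn y - C A)))"
      using finA by (intro sum_mono2) auto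
    also note out
    finally show False by simp
  qed
  then obtain A' where A': "A' \<subseteq> G" "card A' = m" "finite A'"
    by (rule obtain_subset_with_card_n)
  have A'V: "A' \<subseteq> V" using A' AV by (auto simp: G_def)
  have "V \<subseteq> common_nbrs adj V A' \<union> (C A \<union> (\<Union>y\<in>A'. nn y - C A))"
    using adj by (auto simp: common_nbrs_def nn_def symp_def)
  then have "card V \<le> card (common_nbrs adj V A' \<union> (C A \<union> (\<Union>y\<in>A'. nn y - C A)))"
    by (intro card_mono) (use fin finC finn A' in auto)
  also have "\<dots> \<le> card (common_nbrs adj V A') + card (C A \<union> (\<Union>y\<in>A'. nn y - C A))" by (rule card_Un_le)
  also have "card (C A \<union> (\<Union>y\<in>A'. nn y - C A)) \<le> card (C A) + card (\<Union>y\<in>A'. nn y - C A)" by (rule card_Un_le)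
  also have "card (\<Union>y\<in>A'. nn y - C A) \<le> (\<Sum>y\<in>A'. card (nn y - C A))" by (rule card_UN_le) (use A' in auto)
  finally have "card V \<le> card (common_nbrs adj V A') + (card (C A) + (\<Sum>y\<in>A'. card (nn y - C A)))" by simp
  then have "n \<le> real (card (common_nbrs adj V A') + (card (C A) + (\<Sum>y\<in>A'. card (nn y - C A))))"
    unfolding n_def by (rule of_nat_mono)
  then have "n \<le> real (card (common_nbrs adj V A')) + real (card (C A)) + (\<Sum>y\<in>A'. real (card (nn y - C A)))"
    by simp
  also have "(\<Sum>y\<in>A'. real (card (nn y - C A))) \<le> (\<Sum>y\<in>A'. 2 * E)"
    by (rule sum_mono) (use A' in \<open>auto simp: G_def\<close>)
  finally have main: "n \<le> real (card (common_nbrs adj V A')) + real (card (C A)) + real m * (2 * E)"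
    using A' by simp
  \<comment> \<open>The same count bounds \<open>C A\<close> from above by (1/r + 3 \<kappa>) n. The
    common neighbourhood of \<open>A'\<close> misses at most \<open>C A\<close> and 2 E = 6 \<kappa>
    n further vertices for each of its \<open>m\<close> elements, whence the constant 3 + 6
    m.\<close>
  have "real (card (C A)) * (real t - real h) \<le> real t * ((1 / real r + \<kappa>) * n)"
    by (rule order_trans[OF cnt order_trans[OF _ tot]]) (simp add: sum_nonneg)
  also have "\<dots> \<le> ((1 + \<kappa>) * (real t - real h)) * ((1 / real r + \<kappa>) * n)"
  proof (rule mult_right_mono)
    have "(1 + \<kappa>) * (real t - real h) = real t + \<kappa> * real t - real h - \<kappa> * real h" by (simp add: algebra_simps)
    moreover have "\<kappa> * real h \<le> \<kappa> * (real t / 2)" using ht \<kappa> by (intro mult_left_mono) auto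
    ultimately show "real t \<le> (1 + \<kappa>) * (real t - real h)" using t(2) by linarith
  qed (use \<kappa> n0 in auto)
  finally have "(real t - real h) * real (card (C A)) \<le> (real t - real h) * ((1 + \<kappa>) * ((1 / real r + \<kappa>) * n))"
    by (simp add: mult_ac)
  then have "real (card (C A)) \<le> (1 + \<kappa>) * ((1 / real r + \<kappa>) * n)"
    using ht by simp
  also have "\<dots> = ((1 + \<kappa>) * (1 / real r + \<kappa>)) * n" by simp
  also have "\<dots> \<le> (1 / real r + 3 * \<kappa>) * n"
  proof (rule mult_right_mono)
    have "\<kappa> / real r \<le> \<kappa>" using \<kappa> r by (simp add: divide_le_eq mult_le_cancel_left1)
    moreover have "\<kappa> * \<kappa> \<le> \<kappa>" using \<kappa> by (simp add: mult_le_one mult_left_le)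
    moreover have "(1 + \<kappa>) * (1 / real r + \<kappa>) = 1 / real r + \<kappa> / real r + \<kappa> + \<kappa> * \<kappa>"
      by (simp add: algebra_simps add_divide_distrib)
    ultimately show "(1 + \<kappa>) * (1 / real r + \<kappa>) \<le> 1 / real r + 3 * \<kappa>" by linarith
  qed (rule n0)
  finally have "n - (1 / real r + 3 * \<kappa>) * n - real m * (2 * E) \<le> real (card (common_nbrs adj V A'))"
    using main by linarith
  also have "n - (1 / real r + 3 * \<kappa>) * n - real m * (2 * E) = (1 - 1 / real r - (3 + 6 * real m) * \<kappa>) * n"
    by (simp add: E_def algebra_simps)
  finally show ?thesis using A' A'V unfolding n_def by blast
qed

text \<open>Greedy choice inside the set \<open>D\<close> of vertices of high degree gives a
  positive density of r-cliques, hence a blow-up whose vertices all lie in \<open>D\<close>; this is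
  the degree condition that \<open>blowup_common_nbrs\<close> puts on the parts.\<close>

lemma near_extremal_structure:
  assumes k: "3 \<le> k" "k \<le> r" and h: "1 \<le> h" and \<epsilon>: "0 < \<epsilon>"
  shows "\<exists>N. \<exists>\<eta>>0. \<forall>adj (V :: 'a set). finite V \<longrightarrow> symp adj \<longrightarrow> irreflp adj \<longrightarrow> N \<le> card V \<longrightarrow>
    \<not> has_blowup adj V (Suc r) h \<longrightarrow>
    real (card V) ^ k * ((\<Prod>s<k. 1 - real s / real r) - \<eta>) \<le> fact k * real (card (cliques adj V k)) \<longrightarrow>
    (\<exists>D A. D \<subseteq> V \<and> (1 - \<epsilon>) * real (card V) \<le> real (card D) \<and>
      (\<forall>x\<in>D. \<forall>W\<subseteq>V. real (card {y \<in> W. \<not> adj x y}) \<le> (1 / real r + \<epsilon>) * real (card V)) \<and>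
      A \<subseteq> V \<and> card A = m \<and> (1 - 1 / real r - \<epsilon>) * real (card V) \<le> real (card (common_nbrs adj V A)))"
proof -
  have r: "3 \<le> r" "0 < r" using k by auto
  \<comment> \<open>The bound \<epsilon>/(3 + 6 m) absorbs the loss in
    \<open>blowup_common_nbrs\<close>, 1/(2 r^2) leaves n/(2 r) choices at the last of the
    \<open>r\<close> greedy steps, and 1/2 keeps at least half of the vertices in
    \<open>D\<close>.\<close>
  define \<kappa> where "\<kappa> = min (min (\<epsilon> / (3 + 6 * real m)) (1 / (2 * (real r)\<^sup>2))) (min \<epsilon> (1/2))"
  have \<kappa>: "0 < \<kappa>" "\<kappa> \<le> \<epsilon> / (3 + 6 * real m)" "\<kappa> \<le> 1 / (2 * (real r)\<^sup>2)" "\<kappa> \<le> \<epsilon>" "\<kappa> \<le> 1 / 2"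
    using \<epsilon> r unfolding \<kappa>_def by (simp add: add_pos_nonneg, linarith+)
  define t where "t = max (2 * m) (nat \<lceil>2 * real h / \<kappa>\<rceil>)"
  have "2 * real h / \<kappa> \<le> real t"
    using real_nat_ceiling_ge[of "2 * real h / \<kappa>"] unfolding t_def by linarith
  then have th: "real h \<le> \<kappa> * real t / 2" using \<kappa>(1) by (simp add: field_simps)
  have "1 \<le> t"
  proof (rule ccontr)
    assume "\<not> 1 \<le> t" then have "t = 0" by simp
    then show False using th h by simp
  qed
  define \<gamma> where "\<gamma> = (1 / (2 * real r)) ^ r / fact r"
  have \<gamma>: "0 < \<gamma>" using r by (simp add: \<gamma>_def)
  obtain N1 \<eta> where \<eta>: "0 < \<eta>" and N1: "\<And>adj (V :: 'a set). finite V \<Longrightarrow> symp adj \<Longrightarrow> irreflp adj \<Longrightarrow> N1 \<le> card V \<Longrightarrow>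
    \<not> has_blowup adj V (Suc r) h \<Longrightarrow>
    real (card V) ^ k * ((\<Prod>s<k. 1 - real s / real r) - \<eta>) \<le> fact k * real (card (cliques adj V k)) \<Longrightarrow>
    real (card {x \<in> V. real (card (common_nbrs adj V {x})) < (1 - 1 / real r - \<kappa>) * real (card V)})
      \<le> \<kappa> * real (card V)"
    using card_low_degree_le[OF k h \<kappa>(1), where 'a = 'a] by blast
  obtain N2 where N2: "\<And>adj (V :: 'a set). finite V \<Longrightarrow> N2 \<le> card V \<Longrightarrow>
    \<gamma> * real (card V) ^ r \<le> real (card (cliques adj V r)) \<Longrightarrow> has_blowup adj V r t"
    using has_blowup_if_many_cliques[OF \<open>1 \<le> t\<close> \<gamma>, of r, where 'a = 'a] by blast
  define N3 where "N3 = nat \<lceil>2 ^ (r * t) * real h / \<kappa>\<rceil>"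
  show ?thesis
  proof (intro exI[of _ "max N1 (max (2 * N2) N3)"] exI[of _ \<eta>] conjI allI impI)
    show "0 < \<eta>" by (rule \<eta>)
    fix adj and V :: "'a set"
    assume V: "finite V" "symp adj" "irreflp adj" and N: "max N1 (max (2 * N2) N3) \<le> card V"
      and no: "\<not> has_blowup adj V (Suc r) h"
      and ck: "real (card V) ^ k * ((\<Prod>s<k. 1 - real s / real r) - \<eta>) \<le> fact k * real (card (cliques adj V k))"
    define n where "n = real (card V)"
    have n0: "0 \<le> n" by (simp add: n_def)
    define B where "B = {x \<in> V. real (card (common_nbrs adj V {x})) < (1 - 1 / real r - \<kappa>) * n}"
    have B: "real (card B) \<le> \<kappa> * n"
      unfolding B_def n_def by (rule N1[OF V _ no ck]) (use N in simp)
    define D where "D = V - B"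
    have BV: "B \<subseteq> V" by (auto simp: B_def)
    have finD: "finite D" using V by (simp add: D_def)
    have cardD: "(1 - \<kappa>) * n \<le> real (card D)"
    proof -
      have "real (card D) = n - real (card B)"
        unfolding D_def n_def using BV V
        by (subst card_Diff_subset) (auto simp: card_mono of_nat_diff intro: finite_subset)
      then show ?thesis using B by (simp add: algebra_simps)
    qed
    have degD: "(1 - 1 / real r - \<kappa>) * n \<le> real (card (common_nbrs adj V {x}))" if "x \<in> D" for x
      using that by (auto simp: D_def B_def)
    have nonadj: "real (card {y \<in> W. \<not> adj x y}) \<le> (1 / real r + \<kappa>) * n" if "x \<in> D" "W \<subseteq> V" for x W
      unfolding n_def by (rule card_nonadj[OF V(1,2) _ that(2)]) (use that degD in \<open>auto simp: D_def n_def\<close>)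
    have DV: "D \<subseteq> V" by (auto simp: D_def)
    have "(\<Prod>j<r. n / (2 * real r)) \<le> fact r * real (card (cliques adj D r))"
    proof (rule card_cliques_greedy[OF finD V(2,3), of "(1 / real r + \<kappa>) * n"])
      show "real (card {y \<in> D. \<not> adj x y}) \<le> (1 / real r + \<kappa>) * n" if "x \<in> D" for x
        by (rule nonadj[OF that DV])
      show "0 \<le> n / (2 * real r)" using n0 by simp
      fix j assume "j < r"
      then have j: "real j \<le> real r - 1" by linarith
      have "real j * ((1 / real r + \<kappa>) * n) \<le> (real r - 1) * ((1 / real r + \<kappa>) * n)"
        using j n0 \<kappa> by (intro mult_right_mono) auto
      moreover have "(1 - \<kappa>) * n - (real r - 1) * ((1 / real r + \<kappa>) * n) = (1 / real r - real r * \<kappa>) * n"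
        using r by (simp add: field_simps)
      moreover have "1 / (2 * real r) * n \<le> (1 / real r - real r * \<kappa>) * n"
      proof (rule mult_right_mono[OF _ n0])
        have "real r * \<kappa> \<le> real r * (1 / (2 * (real r)\<^sup>2))" using \<kappa>(3) by (intro mult_left_mono) auto
        also have "\<dots> = 1 / (2 * real r)" using r by (simp add: power2_eq_square)
        finally show "1 / (2 * real r) \<le> 1 / real r - real r * \<kappa>" by simp
      qed
      ultimately show "n / (2 * real r) \<le> real (card D) - real j * ((1 / real r + \<kappa>) * n)"
        using cardD by simp
    qed
    moreover have "real (card D) ^ r \<le> n ^ r"
      using DV V by (intro power_mono) (auto simp: n_def card_mono)
    ultimately have "\<gamma> * real (card D) ^ r \<le> real (card (cliques adj D r))"
    proof -
      have "\<gamma> * real (card D) ^ r \<le> \<gamma> * n ^ r"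
        using \<gamma> \<open>real (card D) ^ r \<le> n ^ r\<close> by (intro mult_left_mono) auto
      also have "\<dots> = (\<Prod>j<r. n / (2 * real r)) / fact r" by (simp add: \<gamma>_def power_divide)
      also have "\<dots> \<le> fact r * real (card (cliques adj D r)) / fact r"
        by (rule divide_right_mono) (use \<open>(\<Prod>j<r. n / (2 * real r)) \<le> _\<close> in auto)
      finally show ?thesis by simp
    qed
    moreover have "N2 \<le> card D"
    proof -
      have "(1 - \<kappa>) * n \<ge> 1 / 2 * n" using \<kappa> n0 by (intro mult_right_mono) auto
      moreover have "real (2 * N2) \<le> n" using N by (simp add: n_def)
      ultimately show ?thesis using cardD by simp
    qed
    ultimately have "has_blowup adj D r t" using N2[OF finD] by blast
    then obtain As where As: "length As = r" "\<And>A. A \<in> set As \<Longrightarrow> A \<subseteq> D \<and> card A = t"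
      "sorted_wrt (\<lambda>A B. \<forall>x\<in>A. \<forall>y\<in>B. adj x y) As" by (auto simp: has_blowup_def)
    have "\<exists>A\<subseteq>V. card A = m \<and> (1 - 1 / real r - (3 + 6 * real m) * \<kappa>) * real (card V) \<le> real (card (common_nbrs adj V A))"
    proof (rule blowup_common_nbrs[OF V(1,2) r(2) h \<kappa>(1) _ As(1) _ As(3) no])
      show "2 ^ (r * t) * real h \<le> \<kappa> * real (card V)"
      proof -
        have "2 ^ (r * t) * real h / \<kappa> \<le> real (card V)"
          using N real_nat_ceiling_ge[of "2 ^ (r * t) * real h / \<kappa>"] unfolding N3_def by linarith
        then show ?thesis using \<kappa>(1) by (simp add: field_simps)
      qed
    qed (use As(2) DV degD th \<kappa> in \<open>auto simp: t_def n_def\<close>)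
    then obtain A where A: "A \<subseteq> V" "card A = m"
      "(1 - 1 / real r - (3 + 6 * real m) * \<kappa>) * n \<le> real (card (common_nbrs adj V A))" by (auto simp: n_def)
    have "(3 + 6 * real m) * \<kappa> \<le> \<epsilon>" using \<kappa>(2) by (simp add: field_simps)
    then have "(1 - 1 / real r - \<epsilon>) * n \<le> (1 - 1 / real r - (3 + 6 * real m) * \<kappa>) * n"
      using n0 by (intro mult_right_mono) auto
    then have A3: "(1 - 1 / real r - \<epsilon>) * n \<le> real (card (common_nbrs adj V A))" using A by linarith
    have "(1 - \<epsilon>) * n \<le> (1 - \<kappa>) * n" using \<kappa> n0 by (intro mult_right_mono) auto
    then have D1: "(1 - \<epsilon>) * n \<le> real (card D)" using cardD by linarith
    have "(1 / real r + \<kappa>) * n \<le> (1 / real r + \<epsilon>) * n" using \<kappa> n0 by (intro mult_right_mono) auto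
    then have D2: "\<forall>x\<in>D. \<forall>W\<subseteq>V. real (card {y \<in> W. \<not> adj x y}) \<le> (1 / real r + \<epsilon>) * n"
      using nonadj by (meson order_trans)
    show "\<exists>D A. D \<subseteq> V \<and> (1 - \<epsilon>) * real (card V) \<le> real (card D) \<and>
      (\<forall>x\<in>D. \<forall>W\<subseteq>V. real (card {y \<in> W. \<not> adj x y}) \<le> (1 / real r + \<epsilon>) * real (card V)) \<and>
      A \<subseteq> V \<and> card A = m \<and> (1 - 1 / real r - \<epsilon>) * real (card V) \<le> real (card (common_nbrs adj V A))"
      using DV D1 D2 A(1,2) A3 unfolding n_def by blast
  qed
qed

section \<open>Cliques in common neighbourhoods\<close>

text \<open>The consequence of optimality that concerns the blue graph alone. Making
  \<open>u\<close> a twin of the vertices in \<open>A\<close>, with neighbourhood \<open>W\<close>,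
  trades the cliques through \<open>u\<close> for the l-cliques of \<open>W\<close> and may cost up
  to \<open>card V\<close> red edges. The size of \<open>A\<close> leaves room to reroute a copy of
  \<open>F\<close>.\<close>

definition cloning_bound :: "('a \<Rightarrow> 'a \<Rightarrow> bool) \<Rightarrow> 'a set \<Rightarrow> nat \<Rightarrow> nat \<Rightarrow> bool" where
  "cloning_bound adj V h l \<longleftrightarrow> (\<forall>u\<in>V. \<forall>A W. A \<subseteq> V \<longrightarrow> h \<le> card A \<longrightarrow> u \<notin> A \<longrightarrow> W \<subseteq> V - {u} \<longrightarrow>
     (\<forall>a\<in>A. \<forall>w\<in>W. adj a w) \<longrightarrow>
     card (cliques adj W l) \<le> card (cliques adj (common_nbrs adj V {u}) l) + card V)"

text \<open>Continuity at \<epsilon> = 0, where the first claim becomes the hypothesis: 1 - l/r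
  times the product of 1 - s/r over s < l is the product over 1 \<le> s \<le> l. The term (j + 3)
  \<epsilon> collects three losses in the size of the starting set and one for each earlier greedy
  choice.\<close>

lemma exists_parameter:
  fixes \<beta> :: real
  assumes l: "Suc l \<le> r" and num: "\<beta> ^ l < 1 - real l / real r"
  shows "\<exists>\<epsilon>>0. (\<beta> + real l * \<epsilon>) ^ l * (\<Prod>s<l. 1 - real s / real r + \<epsilon>) <
        (\<Prod>j<l. 1 - real (Suc j) / real r - real (j + 3) * \<epsilon>) - \<epsilon> \<and>
      (\<forall>j<l. 0 \<le> 1 - real (Suc j) / real r - real (j + 3) * \<epsilon>) \<and>
      (\<Prod>j<l. 1 - real (Suc j) / real r) / 2 \<le> (\<Prod>j<l. 1 - real (Suc j) / real r - real (j + 3) * \<epsilon>) - \<epsilon>"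
proof -
  define P1 where "P1 = (\<Prod>j<l. 1 - real (Suc j) / real r)"
  have fpos: "0 < 1 - real (Suc j) / real r" if "j < l" for j
    using that l by (auto simp: field_simps)
  have P1: "0 < P1" unfolding P1_def by (intro prod_pos) (use fpos in auto)
  have pos: "0 < (\<Prod>s<l. 1 - real s / real r)"
    by (intro prod_pos) (use l in \<open>auto simp: field_simps\<close>)
  have "\<beta> ^ l * (\<Prod>s<l. 1 - real s / real r) < (1 - real l / real r) * (\<Prod>s<l. 1 - real s / real r)"
    using num pos by (rule mult_strict_right_mono)
  also have "\<dots> = (\<Prod>s<Suc l. 1 - real s / real r)" by simp
  also have "\<dots> = P1" unfolding P1_def prod.lessThan_Suc_shift by simp
  finally have lim: "\<beta> ^ l * (\<Prod>s<l. 1 - real s / real r) < P1" .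
  have R: "((\<lambda>\<epsilon>. (\<Prod>j<l. 1 - real (Suc j) / real r - real (j + 3) * \<epsilon>) - \<epsilon>) \<longlongrightarrow> P1) (at_right 0)"
    unfolding P1_def by (rule tendsto_eq_intros refl tendsto_prod | simp)+
  have L: "((\<lambda>\<epsilon>. (\<beta> + real l * \<epsilon>) ^ l * (\<Prod>s<l. 1 - real s / real r + \<epsilon>)) \<longlongrightarrow> \<beta> ^ l * (\<Prod>s<l. 1 - real s / real r)) (at_right 0)"
    by (rule tendsto_eq_intros refl tendsto_prod | simp)+
  obtain mid where mid: "\<beta> ^ l * (\<Prod>s<l. 1 - real s / real r) < mid" "mid < P1"
    using dense[OF lim] by blast
  have e1: "\<forall>\<^sub>F \<epsilon> in at_right 0. (\<beta> + real l * \<epsilon>) ^ l * (\<Prod>s<l. 1 - real s / real r + \<epsilon>) < mid"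
    by (rule order_tendstoD(2)[OF L mid(1)])
  have e2: "\<forall>\<^sub>F \<epsilon> in at_right 0. mid < (\<Prod>j<l. 1 - real (Suc j) / real r - real (j + 3) * \<epsilon>) - \<epsilon>"
    by (rule order_tendstoD(1)[OF R mid(2)])
  have e3: "\<forall>\<^sub>F \<epsilon> in at_right 0. P1 / 2 < (\<Prod>j<l. 1 - real (Suc j) / real r - real (j + 3) * \<epsilon>) - \<epsilon>"
    by (rule order_tendstoD(1)[OF R]) (use P1 in simp)
  have e4: "\<forall>\<^sub>F \<epsilon> in at_right 0. \<forall>j\<in>{..<l}. 0 < 1 - real (Suc j) / real r - real (j + 3) * \<epsilon>"
  proof (rule eventually_ball_finite, simp, rule ballI)
    fix j assume "j \<in> {..<l}"
    then have j: "j < l" by simp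
    have "((\<lambda>\<epsilon>. 1 - real (Suc j) / real r - real (j + 3) * \<epsilon>) \<longlongrightarrow> 1 - real (Suc j) / real r) (at_right 0)"
      by (rule tendsto_eq_intros refl | simp)+
    then show "\<forall>\<^sub>F \<epsilon> in at_right 0. 0 < 1 - real (Suc j) / real r - real (j + 3) * \<epsilon>"
      by (rule order_tendstoD(1)[OF _ fpos[OF j]])
  qed
  have e5: "\<forall>\<^sub>F \<epsilon> :: real in at_right 0. 0 < \<epsilon>" by (rule eventually_at_right_less)
  have "\<forall>\<^sub>F \<epsilon> in at_right 0. 0 < \<epsilon> \<and> (\<beta> + real l * \<epsilon>) ^ l * (\<Prod>s<l. 1 - real s / real r + \<epsilon>) <
        (\<Prod>j<l. 1 - real (Suc j) / real r - real (j + 3) * \<epsilon>) - \<epsilon> \<and>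
      (\<forall>j<l. 0 \<le> 1 - real (Suc j) / real r - real (j + 3) * \<epsilon>) \<and>
      P1 / 2 \<le> (\<Prod>j<l. 1 - real (Suc j) / real r - real (j + 3) * \<epsilon>) - \<epsilon>"
    using e1 e2 e3 e4 e5
  proof eventually_elim
    case (elim \<epsilon>)
    then show ?case by (auto intro: less_imp_le)
  qed
  then show ?thesis unfolding P1_def
    by (rule eventually_happens'[OF trivial_limit_at_right_real])
qed

text \<open>The base in \<open>num\<close>, called \<beta> below, satisfies 2 \<beta> - 1 = (l -
  2)/r, the share of vertices that the first l - 2 greedy choices can rule out. So two
  neighbourhoods larger than \<beta> n by a margin share an (l-1)-clique, while a smaller one would
  contain fewer l-cliques than cloning guarantees.\<close>

lemma common_nbrs_contain_clique:
  assumes l: "2 \<le> l" "Suc l \<le> r" and h: "1 \<le> h"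
    and num: "((real r + real l - 2) / (2 * real r)) ^ l < 1 - real l / real r"
  shows "\<exists>N. \<exists>\<eta>>0. \<forall>adj (V :: 'a set) u v. finite V \<longrightarrow> symp adj \<longrightarrow> irreflp adj \<longrightarrow> N \<le> card V \<longrightarrow>
    \<not> has_blowup adj V (Suc r) h \<longrightarrow>
    real (card V) ^ Suc l * ((\<Prod>s<Suc l. 1 - real s / real r) - \<eta>) \<le> fact (Suc l) * real (card (cliques adj V (Suc l))) \<longrightarrow>
    cloning_bound adj V h l \<longrightarrow> u \<in> V \<longrightarrow> v \<in> V \<longrightarrow>
    cliques adj (common_nbrs adj V {u, v}) (l - 1) \<noteq> {}"
proof -
  define \<beta> where "\<beta> = (real r + real l - 2) / (2 * real r)"
  obtain \<epsilon> where \<epsilon>: "0 < \<epsilon>" and \<epsilon>1: "(\<beta> + real l * \<epsilon>) ^ l * (\<Prod>s<l. 1 - real s / real r + \<epsilon>) <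
        (\<Prod>j<l. 1 - real (Suc j) / real r - real (j + 3) * \<epsilon>) - \<epsilon>"
    and \<epsilon>2: "\<And>j. j < l \<Longrightarrow> 0 \<le> 1 - real (Suc j) / real r - real (j + 3) * \<epsilon>"
    and \<epsilon>3: "(\<Prod>j<l. 1 - real (Suc j) / real r) / 2 \<le> (\<Prod>j<l. 1 - real (Suc j) / real r - real (j + 3) * \<epsilon>) - \<epsilon>"
    using exists_parameter[OF l(2) num[folded \<beta>_def]] by blast
  define P1 where "P1 = (\<Prod>j<l. 1 - real (Suc j) / real r)"
  define \<pi> where "\<pi> = (\<Prod>j<l. 1 - real (Suc j) / real r - real (j + 3) * \<epsilon>)"
  have P1: "0 < P1" unfolding P1_def by (intro prod_pos) (use l in \<open>auto simp: field_simps\<close>)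
  define c0 where "c0 = P1 / 2 / fact l"
  have c0: "0 < c0" using P1 by (simp add: c0_def)
  have r0: "0 < r" and lr: "l \<le> r" and k3: "3 \<le> Suc l" using l by auto
  obtain N1 where N1: "\<And>adj (V :: 'a set) s. finite V \<Longrightarrow> symp adj \<Longrightarrow> irreflp adj \<Longrightarrow> N1 \<le> card V \<Longrightarrow>
    \<not> has_blowup adj V (Suc r) h \<Longrightarrow> c0 * real (card V) ^ l \<le> real (card (cliques adj V l)) \<Longrightarrow> s \<le> l \<Longrightarrow>
    real (Suc s) * real (card (cliques adj V (Suc s))) \<le>
      (1 - real s / real r + \<epsilon>) * real (card V) * real (card (cliques adj V s))"
    using clique_ratio_upper[OF h r0 lr c0 \<epsilon>, where 'a = 'a] by blast
  \<comment> \<open>A set of \<open>Suc h\<close> rather than \<open>h\<close> vertices, as one of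
    them may be the vertex to be replaced.\<close>
  obtain N2 \<eta> where \<eta>: "0 < \<eta>" and N2: "\<forall>adj (V :: 'a set). finite V \<longrightarrow> symp adj \<longrightarrow> irreflp adj \<longrightarrow> N2 \<le> card V \<longrightarrow>
    \<not> has_blowup adj V (Suc r) h \<longrightarrow>
    real (card V) ^ Suc l * ((\<Prod>s<Suc l. 1 - real s / real r) - \<eta>) \<le> fact (Suc l) * real (card (cliques adj V (Suc l))) \<longrightarrow>
    (\<exists>D A. D \<subseteq> V \<and> (1 - \<epsilon>) * real (card V) \<le> real (card D) \<and>
      (\<forall>x\<in>D. \<forall>W\<subseteq>V. real (card {y \<in> W. \<not> adj x y}) \<le> (1 / real r + \<epsilon>) * real (card V)) \<and>
      A \<subseteq> V \<and> card A = Suc h \<and> (1 - 1 / real r - \<epsilon>) * real (card V) \<le> real (card (common_nbrs adj V A)))"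
    using near_extremal_structure[OF k3 l(2) h \<epsilon>, where 'a = 'a and m = "Suc h"]
    by (elim exE conjE) (rule that)
  \<comment> \<open>From N1/c0 on, neighbourhoods reach the threshold \<open>N1\<close>; from
    l!/\<epsilon> on, the additive term of the cloning bound is at most \<epsilon> n^l, as l \<ge>
    2.\<close>
  define N where "N = max (max N2 1) (max (nat \<lceil>real N1 / c0\<rceil>) (nat \<lceil>fact l / \<epsilon>\<rceil>))"
  show ?thesis
  proof (intro exI[of _ N] exI[of _ \<eta>] conjI allI impI)
    show "0 < \<eta>" by (rule \<eta>)
    fix adj and V :: "'a set" and u v
    assume V: "finite V" "symp adj" "irreflp adj" and NV: "N \<le> card V"
      and no: "\<not> has_blowup adj V (Suc r) h"
      and ck: "real (card V) ^ Suc l * ((\<Prod>s<Suc l. 1 - real s / real r) - \<eta>) \<le> fact (Suc l) * real (card (cliques adj V (Suc l)))"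
      and clone: "cloning_bound adj V h l" and uv: "u \<in> V" "v \<in> V"
    define n where "n = real (card V)"
    have n1: "1 \<le> n" using NV by (auto simp: N_def n_def)
    then have n0: "0 \<le> n" "0 < n" by auto
    have "real N1 / c0 \<le> n" "fact l / \<epsilon> \<le> n"
      using NV real_nat_ceiling_ge[of "real N1 / c0"] real_nat_ceiling_ge[of "fact l / \<epsilon>"]
      unfolding N_def n_def by linarith+
    then have nN1: "real N1 \<le> c0 * n" and nl: "fact l \<le> \<epsilon> * n" using c0 \<epsilon> by (simp_all add: field_simps)
    have "(1 :: real) \<le> fact l" by (rule fact_ge_1)
    with nl have n\<epsilon>: "1 \<le> \<epsilon> * n" by linarith
    have NN: "N2 \<le> card V" using NV by (simp add: N_def)
    obtain D A where D: "D \<subseteq> V" "(1 - \<epsilon>) * n \<le> real (card D)"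
      and D': "\<forall>x\<in>D. \<forall>W\<subseteq>V. real (card {y \<in> W. \<not> adj x y}) \<le> (1 / real r + \<epsilon>) * n"
      and A: "A \<subseteq> V" "card A = Suc h" "(1 - 1 / real r - \<epsilon>) * n \<le> real (card (common_nbrs adj V A))"
      using N2[rule_format, OF V NN no ck, folded n_def] by (elim exE conjE) (rule that)
    have nonadj: "\<And>x W. x \<in> D \<Longrightarrow> W \<subseteq> V \<Longrightarrow> real (card {y \<in> W. \<not> adj x y}) \<le> (1 / real r + \<epsilon>) * n"
      using D' by blast
    have interD: "real (card X) - \<epsilon> * n \<le> real (card (X \<inter> D))" if "X \<subseteq> V" for X
    proof -
      have "card X + card D = card (X \<union> D) + card (X \<inter> D)"
        using that D V by (intro card_Un_Int) (auto intro: finite_subset)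
      moreover have "card (X \<union> D) \<le> card V" using that D V by (intro card_mono) auto
      ultimately have "real (card X) + real (card D) \<le> n + real (card (X \<inter> D))" unfolding n_def by linarith
      then show ?thesis using D(2) by (simp add: algebra_simps)
    qed
    have greedy: "(\<Prod>j<s. p j) \<le> fact s * real (card (cliques adj W s))"
      if "W \<subseteq> D" "\<And>j. j < s \<Longrightarrow> 0 \<le> p j" "\<And>j. j < s \<Longrightarrow> p j \<le> real (card W) - real j * ((1 / real r + \<epsilon>) * n)" for W s p
    proof (rule card_cliques_greedy[OF _ V(2,3) _ that(2,3)])
      show "finite W" using that D V by (meson finite_subset)
      show "real (card {y \<in> W. \<not> adj x y}) \<le> (1 / real r + \<epsilon>) * n" if "x \<in> W" for x
        using nonadj[of x W] that \<open>W \<subseteq> D\<close> D(1) by blast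
    qed
    have big: "(\<beta> + real l * \<epsilon>) * n < real (card (common_nbrs adj V {w}))" if w: "w \<in> V" for w
    proof (rule ccontr)
      define M where "M = common_nbrs adj V {w}"
      define m where "m = real (card M)"
      assume "\<not> ?thesis"
      then have m_le: "m \<le> (\<beta> + real l * \<epsilon>) * n" by (simp add: m_def M_def)
      have MV: "M \<subseteq> V" by (auto simp: M_def common_nbrs_def)
      have finM: "finite M" using MV V finite_subset by blast
      have mn: "m \<le> n" unfolding m_def n_def using MV V by (simp add: card_mono)
      define W where "W = common_nbrs adj V A \<inter> D - {w}"
      \<comment> \<open>Three losses of \<epsilon> n: in the common neighbourhood itself, from the
        vertices outside \<open>D\<close>, and for removing \<open>w\<close>, as 1 \<le> \<epsilon>
        n.\<close>
      have cardW: "(1 - 1 / real r - 3 * \<epsilon>) * n \<le> real (card W)"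
      proof -
        have fin: "finite (common_nbrs adj V A \<inter> D)" using V by simp
        have "card (common_nbrs adj V A \<inter> D) \<le> Suc (card W)"
          unfolding W_def card_Diff_singleton_if by (simp split: if_split) arith
        then have "real (card (common_nbrs adj V A \<inter> D)) \<le> real (card W) + 1" by simp
        moreover have "common_nbrs adj V A \<subseteq> V" by (auto simp: common_nbrs_def)
        ultimately have "(1 - 1 / real r - \<epsilon>) * n - \<epsilon> * n - \<epsilon> * n \<le> real (card W)"
          using interD[of "common_nbrs adj V A"] A(3) n\<epsilon> by linarith
        then show ?thesis by (simp add: algebra_simps)
      qed
      have "(\<Prod>j<l. (1 - real (Suc j) / real r - real (j + 3) * \<epsilon>) * n) \<le> fact l * real (card (cliques adj W l))"
      proof (rule greedy)
        fix j assume j: "j < l"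
        show "0 \<le> (1 - real (Suc j) / real r - real (j + 3) * \<epsilon>) * n" using \<epsilon>2[OF j] n0 by simp
        have "(1 - real (Suc j) / real r - real (j + 3) * \<epsilon>) * n = (1 - 1 / real r - 3 * \<epsilon>) * n - real j * ((1 / real r + \<epsilon>) * n)"
          using r0 by (simp add: field_simps)
        then show "(1 - real (Suc j) / real r - real (j + 3) * \<epsilon>) * n \<le> real (card W) - real j * ((1 / real r + \<epsilon>) * n)"
          using cardW by linarith
      qed (auto simp: W_def)
      then have lowW: "\<pi> * n ^ l \<le> fact l * real (card (cliques adj W l))"
        by (simp add: prod.distrib \<pi>_def)
      have "h \<le> card (A - {w})" using A by (simp add: card_Diff_singleton_if)
      moreover have "\<forall>a\<in>A - {w}. \<forall>x\<in>W. adj a x"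
        using V(2) by (auto simp: W_def common_nbrs_def symp_def)
      moreover have "A - {w} \<subseteq> V" "W \<subseteq> V - {w}" "w \<notin> A - {w}" using A by (auto simp: W_def common_nbrs_def)
      ultimately have "card (cliques adj W l) \<le> card (cliques adj M l) + card V"
        using clone w unfolding cloning_bound_def M_def by blast
      then have "real (card (cliques adj W l)) \<le> real (card (cliques adj M l)) + n" unfolding n_def by linarith
      then have "\<pi> * n ^ l \<le> fact l * (real (card (cliques adj M l)) + n)"
        by (intro order_trans[OF lowW] mult_left_mono) auto
      also have "\<dots> = fact l * real (card (cliques adj M l)) + fact l * n" by (simp add: algebra_simps)
      also have "fact l * n \<le> (\<epsilon> * n) * n" using nl n0 by (intro mult_right_mono) auto
      also have "(\<epsilon> * n) * n = \<epsilon> * n ^ 2" by (simp add: power2_eq_square)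
      also have "\<epsilon> * n ^ 2 \<le> \<epsilon> * n ^ l" using n1 \<epsilon> l by (intro mult_left_mono power_increasing) auto
      finally have low: "(\<pi> - \<epsilon>) * n ^ l \<le> fact l * real (card (cliques adj M l))"
        by (simp add: algebra_simps)
      have "P1 / 2 * n ^ l \<le> (\<pi> - \<epsilon>) * n ^ l"
        using \<epsilon>3 n0 unfolding P1_def \<pi>_def by (intro mult_right_mono) auto
      with low have "P1 / 2 * n ^ l \<le> fact l * real (card (cliques adj M l))" by linarith
      then have c0n: "c0 * n ^ l \<le> real (card (cliques adj M l))" by (simp add: c0_def field_simps)
      have "c0 * m ^ l \<le> c0 * n ^ l" using mn c0 by (intro mult_left_mono power_mono) (auto simp: m_def)
      with c0n have c0m: "c0 * m ^ l \<le> real (card (cliques adj M l))" by linarith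
      \<comment> \<open>The ratio bounds are to be applied inside \<open>M\<close>, which must
        therefore be large itself: a positive density of l-cliques forces linear size.\<close>
      have "real (card (cliques adj M l)) \<le> real (card M ^ l)"
        using card_cliques_le_power[OF finM] by (rule of_nat_mono)
      then have "c0 * n ^ l \<le> m ^ l" using c0n unfolding m_def of_nat_power by linarith
      also have "\<dots> = m * m ^ (l - 1)" using l by (simp add: power_eq_if)
      also have "\<dots> \<le> m * n ^ (l - 1)" using mn by (intro mult_left_mono power_mono) (auto simp: m_def)
      finally have "(c0 * n) * n ^ (l - 1) \<le> m * n ^ (l - 1)" using l by (simp add: power_eq_if)
      then have "c0 * n \<le> m" using n0 by simp
      with nN1 have "real N1 \<le> real (card M)" unfolding m_def by linarith
      then have "N1 \<le> card M" by simp
      have noM: "\<not> has_blowup adj M (Suc r) h" using no has_blowup_mono[OF _ MV] by blast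
      have "fact l * real (card (cliques adj M l)) \<le> real (card M) ^ l * (\<Prod>s<l. 1 - real s / real r + \<epsilon>)"
      proof (rule card_cliques_prod_upper)
        fix s assume s: "s < l"
        then have "real s / real r \<le> 1" using lr r0 by simp
        then show "0 \<le> 1 - real s / real r + \<epsilon>" using \<epsilon> by simp
        show "real (Suc s) * real (card (cliques adj M (Suc s))) \<le>
           (1 - real s / real r + \<epsilon>) * real (card M) * real (card (cliques adj M s))"
          using N1[OF finM V(2,3) \<open>N1 \<le> card M\<close> noM] c0m s by (simp add: m_def)
      qed
      also have "\<dots> \<le> ((\<beta> + real l * \<epsilon>) * n) ^ l * (\<Prod>s<l. 1 - real s / real r + \<epsilon>)"
      proof (intro mult_right_mono power_mono)
        show "real (card M) \<le> (\<beta> + real l * \<epsilon>) * n" using m_le by (simp add: m_def)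
        show "0 \<le> (\<Prod>s<l. 1 - real s / real r + \<epsilon>)"
        proof (intro prod_nonneg ballI)
          fix s assume "s \<in> {..<l}"
          then have "real s / real r \<le> 1" using lr r0 by simp
          then show "0 \<le> 1 - real s / real r + \<epsilon>" using \<epsilon> by linarith
        qed
      qed simp
      also have "\<dots> = ((\<beta> + real l * \<epsilon>) ^ l * (\<Prod>s<l. 1 - real s / real r + \<epsilon>)) * n ^ l"
        by (simp add: power_mult_distrib)
      also have "\<dots> < (\<pi> - \<epsilon>) * n ^ l"
        using \<epsilon>1 n0 unfolding \<pi>_def by (intro mult_strict_right_mono) auto
      finally show False using low by linarith
    qed
    define Z where "Z = common_nbrs adj V {u, v}"
    have ZV: "Z \<subseteq> V" by (auto simp: Z_def common_nbrs_def)
    have "card (common_nbrs adj V {u}) + card (common_nbrs adj V {v}) =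
       card (common_nbrs adj V {u} \<union> common_nbrs adj V {v}) + card (common_nbrs adj V {u} \<inter> common_nbrs adj V {v})"
      using V by (intro card_Un_Int) auto
    moreover have "common_nbrs adj V {u} \<inter> common_nbrs adj V {v} = Z" by (auto simp: Z_def common_nbrs_def)
    moreover have "card (common_nbrs adj V {u} \<union> common_nbrs adj V {v}) \<le> card V"
      using V by (intro card_mono) (auto simp: common_nbrs_def)
    ultimately have "card (common_nbrs adj V {u}) + card (common_nbrs adj V {v}) \<le> card V + card Z"
      by (metis add_right_mono)
    then have "real (card (common_nbrs adj V {u})) + real (card (common_nbrs adj V {v})) \<le> n + real (card Z)"
      unfolding n_def by linarith
    then have "2 * ((\<beta> + real l * \<epsilon>) * n) - n \<le> real (card Z)" using big[OF uv(1)] big[OF uv(2)] by linarith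
    then have "2 * ((\<beta> + real l * \<epsilon>) * n) - n - \<epsilon> * n \<le> real (card (Z \<inter> D))" using interD[OF ZV] by linarith
    also have "2 * ((\<beta> + real l * \<epsilon>) * n) - n - \<epsilon> * n = ((real l - 2) / real r + (2 * real l - 1) * \<epsilon>) * n"
      using r0 by (simp add: \<beta>_def field_simps)
    finally have cardZ: "((real l - 2) / real r + (2 * real l - 1) * \<epsilon>) * n \<le> real (card (Z \<inter> D))" .
    \<comment> \<open>After at most l - 2 earlier choices there remain at least (l + 1) \<epsilon> n
      candidates, so \<epsilon> n is a safe count for every step.\<close>
    have "(\<Prod>j<l - 1. \<epsilon> * n) \<le> fact (l - 1) * real (card (cliques adj (Z \<inter> D) (l - 1)))"
    proof (rule greedy)
      show "0 \<le> \<epsilon> * n" using n\<epsilon> by linarith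
      fix j assume "j < l - 1"
      then have j: "real j \<le> real l - 2" using l by linarith
      have "real j * ((1 / real r + \<epsilon>) * n) \<le> (real l - 2) * ((1 / real r + \<epsilon>) * n)"
        using j n0 \<epsilon> by (intro mult_right_mono) auto
      moreover have "((real l - 2) / real r + (2 * real l - 1) * \<epsilon>) * n - (real l - 2) * ((1 / real r + \<epsilon>) * n)
        = (real l + 1) * (\<epsilon> * n)" using r0 by (simp add: field_simps)
      moreover have "1 * (\<epsilon> * n) \<le> (real l + 1) * (\<epsilon> * n)" using n\<epsilon> by (intro mult_right_mono) auto
      ultimately show "\<epsilon> * n \<le> real (card (Z \<inter> D)) - real j * ((1 / real r + \<epsilon>) * n)"
        using cardZ by linarith
    qed simp
    moreover have "0 < (\<Prod>j<l - 1. \<epsilon> * n)" using n0 \<epsilon> by (intro prod_pos) auto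
    ultimately have "0 < fact (l - 1) * real (card (cliques adj (Z \<inter> D) (l - 1)))" by linarith
    then have "cliques adj (Z \<inter> D) (l - 1) \<noteq> {}" by (metis card.empty mult_zero_right of_nat_0 less_irrefl)
    then show "cliques adj (common_nbrs adj V {u, v}) (l - 1) \<noteq> {}"
      using cliques_mono[of "Z \<inter> D" Z] by (auto simp: Z_def)
  qed
qed

section \<open>Clique count of the Turan graph and the numerical condition\<close>

text \<open>The classes are the residues mod \<open>r\<close> of an enumeration, so each has at most
  n/r + 1 vertices, told apart by their quotients. The non-neighbours of a vertex are the vertices
  of its class, and the greedy bound applies.\<close>

lemma turan_card_cliques_lower:
  assumes k: "1 \<le> k" "k \<le> r" and \<eta>: "0 < \<eta>"
  shows "\<exists>N. \<forall>V :: 'a set. finite V \<longrightarrow> N \<le> card V \<longrightarrow> (\<exists>col. (\<forall>x. col x < r) \<and>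
    real (card V) ^ k * ((\<Prod>s<k. 1 - real s / real r) - \<eta>) \<le>
      fact k * real (card (cliques (\<lambda>x y. col x \<noteq> col y) V k)))"
proof -
  have r0: "0 < r" using k by simp
  define P where "P = (\<Prod>s<k. 1 - real s / real r)"
  have fpos: "0 < 1 - real s / real r" if "s < k" for s
    using that k by (auto simp: field_simps)
  have T: "((\<lambda>\<epsilon>. \<Prod>s<k. 1 - real s / real r - real s * \<epsilon>) \<longlongrightarrow> P) (at_right 0)"
    unfolding P_def by (rule tendsto_eq_intros refl tendsto_prod | simp)+
  have e1: "\<forall>\<^sub>F \<epsilon> in at_right 0. P - \<eta> < (\<Prod>s<k. 1 - real s / real r - real s * \<epsilon>)"
    by (rule order_tendstoD(1)[OF T]) (use \<eta> in simp)
  have e2: "\<forall>\<^sub>F \<epsilon> in at_right 0. \<forall>s\<in>{..<k}. 0 < 1 - real s / real r - real s * \<epsilon>"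
  proof (rule eventually_ball_finite, simp, rule ballI)
    fix s assume "s \<in> {..<k}"
    then have s: "s < k" by simp
    have "((\<lambda>\<epsilon>. 1 - real s / real r - real s * \<epsilon>) \<longlongrightarrow> 1 - real s / real r) (at_right 0)"
      by (rule tendsto_eq_intros refl | simp)+
    then show "\<forall>\<^sub>F \<epsilon> in at_right 0. 0 < 1 - real s / real r - real s * \<epsilon>"
      by (rule order_tendstoD(1)[OF _ fpos[OF s]])
  qed
  have "\<forall>\<^sub>F \<epsilon> :: real in at_right 0. 0 < \<epsilon>" by (rule eventually_at_right_less)
  with e1 e2 have "\<forall>\<^sub>F \<epsilon> in at_right 0. 0 < \<epsilon> \<and> P - \<eta> < (\<Prod>s<k. 1 - real s / real r - real s * \<epsilon>) \<and>
     (\<forall>s<k. 0 < 1 - real s / real r - real s * \<epsilon>)"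
    by eventually_elim auto
  then obtain \<epsilon> where \<epsilon>: "0 < \<epsilon>" "P - \<eta> < (\<Prod>s<k. 1 - real s / real r - real s * \<epsilon>)"
     "\<And>s. s < k \<Longrightarrow> 0 < 1 - real s / real r - real s * \<epsilon>"
    using eventually_happens'[OF trivial_limit_at_right_real] by blast
  show ?thesis
  proof (rule exI[of _ "nat \<lceil>1 / \<epsilon>\<rceil>"], intro allI impI)
    fix V :: "'a set" assume fin: "finite V" and N: "nat \<lceil>1 / \<epsilon>\<rceil> \<le> card V"
    define n where "n = real (card V)"
    have "1 / \<epsilon> \<le> n" using N real_nat_ceiling_ge[of "1 / \<epsilon>"] unfolding n_def by linarith
    then have n: "1 \<le> \<epsilon> * n" using \<epsilon>(1) by (simp add: field_simps)
    obtain f where f: "bij_betw f V {0..<card V}" using ex_bij_betw_finite_nat[OF fin] by blast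
    define col where "col x = f x mod r" for x
    have cls: "real (card {y \<in> V. \<not> col x \<noteq> col y}) \<le> (1 / real r + \<epsilon>) * n" if "x \<in> V" for x
    proof -
      have "card {y \<in> V. \<not> col x \<noteq> col y} \<le> card {..card V div r}"
      proof (rule card_inj_on_le)
        show "inj_on (\<lambda>y. f y div r) {y \<in> V. \<not> col x \<noteq> col y}"
        proof (rule inj_onI)
          fix y z assume y: "y \<in> {y \<in> V. \<not> col x \<noteq> col y}" and z: "z \<in> {y \<in> V. \<not> col x \<noteq> col y}"
            and eq: "f y div r = f z div r"
          then have "f y mod r = f z mod r" by (simp add: col_def)
          with eq have "f y = f z" by (metis div_mult_mod_eq)
          then show "y = z" using f y z by (auto simp: bij_betw_def inj_on_def)
        qed
        show "(\<lambda>y. f y div r) ` {y \<in> V. \<not> col x \<noteq> col y} \<subseteq> {..card V div r}"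
        proof
          fix z assume "z \<in> (\<lambda>y. f y div r) ` {y \<in> V. \<not> col x \<noteq> col y}"
          then obtain y where "y \<in> V" "z = f y div r" by auto
          moreover have "f y < card V" using bij_betw_apply[OF f \<open>y \<in> V\<close>] by simp
          ultimately show "z \<in> {..card V div r}" by (simp add: div_le_mono)
        qed
      qed simp
      then have "real (card {y \<in> V. \<not> col x \<noteq> col y}) \<le> real (card V div r) + 1" by simp
      also have "real (card V div r) \<le> n / real r" unfolding n_def by (rule of_nat_div_le_of_nat)
      also have "n / real r + 1 \<le> n / real r + \<epsilon> * n" using n by simp
      finally show ?thesis by (simp add: algebra_simps)
    qed
    have "(\<Prod>s<k. (1 - real s / real r - real s * \<epsilon>) * n) \<le> fact k * real (card (cliques (\<lambda>x y. col x \<noteq> col y) V k))"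
    proof (rule card_cliques_greedy[OF fin _ _ cls])
      fix s assume s: "s < k"
      show "0 \<le> (1 - real s / real r - real s * \<epsilon>) * n" using \<epsilon>(3)[OF s] by (simp add: n_def)
      show "(1 - real s / real r - real s * \<epsilon>) * n \<le> real (card V) - real s * ((1 / real r + \<epsilon>) * n)"
        unfolding n_def[symmetric] by (simp add: algebra_simps)
    qed (auto simp: symp_def irreflp_def)
    moreover have "n ^ k * (P - \<eta>) \<le> n ^ k * (\<Prod>s<k. 1 - real s / real r - real s * \<epsilon>)"
      using \<epsilon>(2) by (intro mult_left_mono) (auto simp: n_def)
    ultimately have "n ^ k * (P - \<eta>) \<le> fact k * real (card (cliques (\<lambda>x y. col x \<noteq> col y) V k))"
      by (simp add: prod.distrib mult.commute)
    moreover have "\<forall>x. col x < r" using r0 by (simp add: col_def)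
    ultimately show "\<exists>col. (\<forall>x. col x < r) \<and>
      real (card V) ^ k * ((\<Prod>s<k. 1 - real s / real r) - \<eta>) \<le> fact k * real (card (cliques (\<lambda>x y. col x \<noteq> col y) V k))"
      unfolding n_def P_def by blast
  qed
qed

text \<open>For l = 2 the left side is 1/4, and 1 - 2/r is at least 1/3. For l = 3 the case r = 4 is
  tight, reading 125 < 128 after clearing denominators; hence the factor x - 4 in the
  difference.\<close>

lemma numeric_condition_small:
  assumes "l \<in> {2, 3}" "Suc l \<le> r"
  shows "((real r + real l - 2) / (2 * real r)) ^ l < 1 - real l / real r"
proof (cases "l = 2")
  case True
  then have "3 \<le> r" using assms by simp
  then show ?thesis using True by (simp add: power2_eq_square field_simps)
next
  case False
  then have l: "l = 3" and r: "4 \<le> r" using assms by auto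
  define x where "x = real r"
  have x: "4 \<le> x" using r by (simp add: x_def)
  have "(x + 1) ^ 3 < 8 * x\<^sup>2 * (x - 3)"
  proof -
    have "8 * x\<^sup>2 * (x - 3) - (x + 1) ^ 3 = (x - 4) * (7 * x\<^sup>2 + x + 1) + 3"
      by (simp add: power2_eq_square power3_eq_cube algebra_simps)
    moreover have "0 \<le> (x - 4) * (7 * x\<^sup>2 + x + 1)" using x by (intro mult_nonneg_nonneg) auto
    ultimately show ?thesis by linarith
  qed
  then have "(x + 1) ^ 3 / (8 * x ^ 3) < 8 * x\<^sup>2 * (x - 3) / (8 * x ^ 3)"
    using x by (intro divide_strict_right_mono) auto
  also have "8 * x\<^sup>2 * (x - 3) / (8 * x ^ 3) = 1 - 3 / x"
    using x by (simp add: power2_eq_square power3_eq_cube field_simps)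
  also have "(x + 1) ^ 3 / (8 * x ^ 3) = ((x + 1) / (2 * x)) ^ 3"
    by (simp add: power_divide power_mult_distrib)
  finally show ?thesis using l by (simp add: x_def add.commute)
qed

text \<open>The base is at most 5/8, whose square is already below 3/4, and 3/4 bounds the right
  side from below.\<close>

lemma numeric_condition_large:
  assumes "2 \<le> l" "4 * l \<le> r"
  shows "((real r + real l - 2) / (2 * real r)) ^ l < 1 - real l / real r"
proof -
  have r: "0 < real r" and l4: "4 * real l \<le> real r" using assms by auto
  have b: "(real r + real l - 2) / (2 * real r) \<le> 5 / 8" using l4 r by (simp add: field_simps)
  have b0: "0 \<le> (real r + real l - 2) / (2 * real r)" using assms by (intro divide_nonneg_pos) auto
  have "((real r + real l - 2) / (2 * real r)) ^ l \<le> (5 / 8) ^ l" using b b0 by (intro power_mono) auto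
  also have "(5 / 8) ^ l \<le> (5 / 8 :: real) ^ 2" using assms by (intro power_decreasing) auto
  also have "\<dots> < 3 / 4" by (simp add: power2_eq_square)
  also have "3 / 4 \<le> 1 - real l / real r" using l4 r by (simp add: field_simps)
  finally show ?thesis .
qed

section \<open>Hypergraphs and graphs\<close>

text \<open>If a nonempty proper subset \<open>Y\<close> is tight, it is matched into its
  neighbourhood and the rest outside that. If none is tight, every nonempty proper subset has a
  neighbour to spare, so an arbitrary pair may be matched and removed.\<close>

theorem hall_marriage:
  assumes "finite X" "\<And>x. x \<in> X \<Longrightarrow> finite (N x)"
    and "\<And>Y. Y \<subseteq> X \<Longrightarrow> card Y \<le> card (\<Union>(N ` Y))"
  shows "\<exists>f. inj_on f X \<and> (\<forall>x\<in>X. f x \<in> N x)"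
  using assms
proof (induction "card X" arbitrary: X N rule: less_induct)
  case less
  note fin = less.prems(1) and finN = less.prems(2) and hall = less.prems(3)
  have finU: "finite (\<Union>(N ` Y))" if "Y \<subseteq> X" for Y
    using that fin finN by (meson finite_UN finite_subset subset_iff)
  show ?case
  proof (cases "\<exists>Y. Y \<subset> X \<and> Y \<noteq> {} \<and> card (\<Union>(N ` Y)) = card Y")
    case True
    then obtain Y where Y: "Y \<subset> X" "Y \<noteq> {}" "card (\<Union>(N ` Y)) = card Y" by blast
    have finY: "finite Y" using Y fin finite_subset by blast
    have "\<exists>f. inj_on f Y \<and> (\<forall>x\<in>Y. f x \<in> N x)"
      by (rule less.hyps) (use Y fin finN hall finY psubset_card_mono in \<open>auto\<close>)
    then obtain f where f: "inj_on f Y" "\<forall>x\<in>Y. f x \<in> N x" by blast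
    define N' where "N' x = N x - \<Union>(N ` Y)" for x
    have "\<exists>g. inj_on g (X - Y) \<and> (\<forall>x\<in>X - Y. g x \<in> N' x)"
    proof (rule less.hyps)
      show "card (X - Y) < card X" using Y fin by (intro psubset_card_mono) auto
      fix Z assume Z: "Z \<subseteq> X - Y"
      have finZ: "finite Z" using Z fin finite_subset by blast
      have "card Z + card Y = card (Z \<union> Y)" using Z finZ finY by (intro card_Un_disjoint[symmetric]) auto
      also have "\<dots> \<le> card (\<Union>(N ` (Z \<union> Y)))" by (rule hall) (use Z Y in auto)
      also have "\<Union>(N ` (Z \<union> Y)) = \<Union>(N' ` Z) \<union> \<Union>(N ` Y)" by (auto simp: N'_def)
      also have "card (\<Union>(N' ` Z) \<union> \<Union>(N ` Y)) \<le> card (\<Union>(N' ` Z)) + card (\<Union>(N ` Y))" by (rule card_Un_le)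
      finally show "card Z \<le> card (\<Union>(N' ` Z))" using Y(3) by simp
    qed (use fin finN in \<open>auto simp: N'_def\<close>)
    then obtain g where g: "inj_on g (X - Y)" "\<forall>x\<in>X - Y. g x \<in> N' x" by blast
    show ?thesis
    proof (intro exI[of _ "\<lambda>x. if x \<in> Y then f x else g x"] conjI)
      show "inj_on (\<lambda>x. if x \<in> Y then f x else g x) X"
      proof (rule inj_onI)
        fix x y assume "x \<in> X" "y \<in> X" "(if x \<in> Y then f x else g x) = (if y \<in> Y then f y else g y)"
        moreover have "f a \<noteq> g b" if "a \<in> Y" "b \<in> X - Y" for a b
        proof -
          have "f a \<in> \<Union>(N ` Y)" using f(2) that(1) by auto
          moreover have "g b \<notin> \<Union>(N ` Y)" using g(2) that(2) by (simp add: N'_def)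
          ultimately show ?thesis by metis
        qed
        ultimately show "x = y" using f(1) g(1)
          by (cases "x \<in> Y"; cases "y \<in> Y") (simp_all add: inj_on_def, metis)
      qed
      show "\<forall>x\<in>X. (if x \<in> Y then f x else g x) \<in> N x" using f g by (auto simp: N'_def)
    qed
  next
    case False
    show ?thesis
    proof (cases "X = {}")
      case True
      then show ?thesis by auto
    next
      case ne: False
      then obtain x where x: "x \<in> X" by blast
      have "card {x} \<le> card (\<Union>(N ` {x}))" by (rule hall) (use x in auto)
      then obtain y where y: "y \<in> N x" by fastforce
      define N' where "N' z = N z - {y}" for z
      have "\<exists>g. inj_on g (X - {x}) \<and> (\<forall>z\<in>X - {x}. g z \<in> N' z)"
      proof (rule less.hyps)
        show "card (X - {x}) < card X" using x fin by (intro psubset_card_mono) auto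
        fix Z assume Z: "Z \<subseteq> X - {x}"
        show "card Z \<le> card (\<Union>(N' ` Z))"
        proof (cases "Z = {}")
          case nZ: False
          have "Z \<subset> X" using Z x by auto
          then have "card (\<Union>(N ` Z)) \<noteq> card Z" "card Z \<le> card (\<Union>(N ` Z))"
            using False nZ hall[of Z] by blast+
          then have "card Z < card (\<Union>(N ` Z))" by linarith
          moreover have "\<Union>(N' ` Z) = \<Union>(N ` Z) - {y}" by (auto simp: N'_def)
          moreover have "card (\<Union>(N ` Z)) \<le> Suc (card (\<Union>(N ` Z) - {y}))"
            by (simp add: card_Diff_singleton_if) arith
          ultimately show ?thesis by simp
        qed simp
      qed (use fin finN in \<open>auto simp: N'_def\<close>)
      then obtain g where g: "inj_on g (X - {x})" "\<forall>z\<in>X - {x}. g z \<in> N' z" by blast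
      show ?thesis
      proof (intro exI[of _ "g(x := y)"] conjI)
        show "inj_on (g(x := y)) X"
        proof (rule inj_onI)
          fix a b assume "a \<in> X" "b \<in> X" "(g(x := y)) a = (g(x := y)) b"
          moreover have "g z \<noteq> y" if "z \<in> X - {x}" for z
            using g(2) that by (simp add: N'_def)
          ultimately show "a = b" using g(1)
            by (cases "a = x"; cases "b = x") (simp_all add: inj_on_def, metis)
        qed
        show "\<forall>z\<in>X. (g(x := y)) z \<in> N z" using g y by (auto simp: N'_def)
      qed
    qed
  qed
qed

text \<open>Choose \<open>X\<close> with the surplus
  \<open>|X| - |N(X)|\<close> maximal; Hall's condition then holds for the neighbourhoods of \<open>H - X\<close> outside
  \<open>N(X)\<close>, and for those of \<open>N(X)\<close> inside \<open>X\<close>.\<close>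

lemma maximal_surplus_matching:
  assumes fin: "finite H" and finN: "\<forall>h\<in>H. finite (N h)"
  shows "\<exists>X f g. X \<subseteq> H \<and> inj_on f (H - X) \<and> (\<forall>h\<in>H - X. f h \<in> N h - \<Union>(N ` X)) \<and>
    inj_on g (\<Union>(N ` X)) \<and> (\<forall>p\<in>\<Union>(N ` X). g p \<in> X \<and> p \<in> N (g p))"
proof -
  \<comment> \<open>Integers, as the surplus of a set may be negative.\<close>
  define s where "s X = int (card X) - int (card (\<Union>(N ` X)))" for X
  have "finite (s ` Pow H)" "s ` Pow H \<noteq> {}" using fin by auto
  then have "Max (s ` Pow H) \<in> s ` Pow H" by (rule Max_in)
  then obtain X where X: "X \<subseteq> H" "s X = Max (s ` Pow H)" by auto
  have max: "s Y \<le> s X" if "Y \<subseteq> H" for Y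
    unfolding X(2) using that fin by (intro Max_ge) auto
  have finU: "finite (\<Union>(N ` Y))" if "Y \<subseteq> H" for Y
    using that fin finN by (meson finite_UN finite_subset subset_iff)
  have finS: "finite Y" if "Y \<subseteq> H" for Y using that fin finite_subset by blast
  have "\<exists>f. inj_on f (H - X) \<and> (\<forall>h\<in>H - X. f h \<in> N h - \<Union>(N ` X))"
  proof (rule hall_marriage)
    fix Y assume Y: "Y \<subseteq> H - X"
    then have YH: "Y \<subseteq> H" by auto
    let ?Z = "\<Union>h\<in>Y. N h - \<Union>(N ` X)"
    \<comment> \<open>Adding \<open>Y\<close> to \<open>X\<close> cannot raise the surplus, so it
      brings at least \<open>card Y\<close> new neighbours.\<close>
    have "card (X \<union> Y) = card X + card Y" using Y finS[OF X(1)] finS[OF YH] by (intro card_Un_disjoint) auto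
    moreover have "\<Union>(N ` (X \<union> Y)) = \<Union>(N ` X) \<union> ?Z" by auto
    moreover have "card (\<Union>(N ` X) \<union> ?Z) = card (\<Union>(N ` X)) + card ?Z"
      using finU[OF X(1)] finU[OF YH] by (intro card_Un_disjoint) (auto intro: finite_subset[of _ "\<Union>(N ` Y)"])
    moreover have "s (X \<union> Y) \<le> s X" by (rule max) (use X YH in auto)
    ultimately show "card Y \<le> card ?Z" unfolding s_def by simp
  qed (use fin finN in auto)
  then obtain f where f: "inj_on f (H - X)" "\<forall>h\<in>H - X. f h \<in> N h - \<Union>(N ` X)" by blast
  have "\<exists>g. inj_on g (\<Union>(N ` X)) \<and> (\<forall>p\<in>\<Union>(N ` X). g p \<in> {h \<in> X. p \<in> N h})"
  proof (rule hall_marriage)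
    fix P assume P: "P \<subseteq> \<Union>(N ` X)"
    let ?Y = "\<Union>p\<in>P. {h \<in> X. p \<in> N h}"
    have YX: "?Y \<subseteq> X" by auto
    have finP: "finite P" using P finU[OF X(1)] finite_subset by blast
    \<comment> \<open>Dropping \<open>?Y\<close> from \<open>X\<close> loses all neighbours in
      \<open>P\<close>; as this cannot raise the surplus, \<open>?Y\<close> is at least as large as
      \<open>P\<close>.\<close>
    have "card (X - ?Y) = card X - card ?Y" "card ?Y \<le> card X"
      using YX finS[OF X(1)] by (auto intro!: card_Diff_subset card_mono intro: finite_subset)
    moreover have "card (\<Union>(N ` (X - ?Y))) \<le> card (\<Union>(N ` X) - P)"
      using finU[OF X(1)] by (intro card_mono) auto
    moreover have "card (\<Union>(N ` X) - P) = card (\<Union>(N ` X)) - card P" "card P \<le> card (\<Union>(N ` X))"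
      using P finP finU[OF X(1)] by (auto intro!: card_Diff_subset card_mono)
    moreover have "s (X - ?Y) \<le> s X" by (rule max) (use X in auto)
    ultimately show "card P \<le> card ?Y" unfolding s_def by linarith
  qed (use finU[OF X(1)] finS[OF X(1)] in auto)
  then obtain g where "inj_on g (\<Union>(N ` X))" "\<forall>p\<in>\<Union>(N ` X). g p \<in> {h \<in> X. p \<in> N h}" by blast
  then show ?thesis using X f by (intro exI[of _ X] exI[of _ f] exI[of _ g]) auto
qed

section \<open>Copies, cliques and blow-ups in concrete graphs\<close>

definition adj_of :: "'a set set \<Rightarrow> 'a \<Rightarrow> 'a \<Rightarrow> bool" where
  "adj_of E x y \<longleftrightarrow> {x, y} \<in> E"

lemma is_graph_pair: "is_graph (V, E) \<longleftrightarrow> finite V \<and> (\<forall>e\<in>E. e \<subseteq> V \<and> card e = 2)"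
  by (auto simp: is_graph_def uniform_hypergraph_def is_hypergraph_def)

lemma symp_adj_of: "symp (adj_of E)"
  by (simp add: symp_def adj_of_def insert_commute)

lemma irreflp_adj_of: "is_graph (V, E) \<Longrightarrow> irreflp (adj_of E)"
  by (fastforce simp: irreflp_def adj_of_def is_graph_pair)

lemma contains_copy_iff:
  assumes "is_graph F"
  shows "contains_copy F G \<longleftrightarrow> (\<exists>\<phi>. inj_on \<phi> (verts F) \<and> \<phi> ` verts F \<subseteq> verts G \<and> (\<forall>e\<in>edges F. \<phi> ` e \<in> edges G))"
proof
  assume "contains_copy F G"
  then obtain S \<phi> where "subhypergraph S G" "bij_betw \<phi> (verts F) (verts S)" "edges S = (\<lambda>e. \<phi> ` e) ` edges F"
    by (auto simp: contains_copy_def isomorphic_def)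
  then show "\<exists>\<phi>. inj_on \<phi> (verts F) \<and> \<phi> ` verts F \<subseteq> verts G \<and> (\<forall>e\<in>edges F. \<phi> ` e \<in> edges G)"
    by (intro exI[of _ \<phi>]) (auto simp: subhypergraph_def bij_betw_def)
next
  assume "\<exists>\<phi>. inj_on \<phi> (verts F) \<and> \<phi> ` verts F \<subseteq> verts G \<and> (\<forall>e\<in>edges F. \<phi> ` e \<in> edges G)"
  then obtain \<phi> where \<phi>: "inj_on \<phi> (verts F)" "\<phi> ` verts F \<subseteq> verts G" "\<forall>e\<in>edges F. \<phi> ` e \<in> edges G" by blast
  have "finite (verts F)" "\<forall>e\<in>edges F. e \<subseteq> verts F"
    using assms by (auto simp: is_graph_def uniform_hypergraph_def is_hypergraph_def)
  then have "subhypergraph (\<phi> ` verts F, (\<lambda>e. \<phi> ` e) ` edges F) G"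
    using \<phi> by (auto simp: subhypergraph_def is_hypergraph_def)
  moreover have "isomorphic F (\<phi> ` verts F, (\<lambda>e. \<phi> ` e) ` edges F)"
    using \<phi> by (auto simp: isomorphic_def bij_betw_def)
  ultimately show "contains_copy F G" unfolding contains_copy_def by blast
qed

lemma image_pairs:
  assumes "bij_betw \<phi> A B"
  shows "(\<lambda>e. \<phi> ` e) ` {e. e \<subseteq> A \<and> card e = 2} = {e. e \<subseteq> B \<and> card e = 2}"
proof (intro equalityI subsetI)
  fix e assume "e \<in> (\<lambda>e. \<phi> ` e) ` {e. e \<subseteq> A \<and> card e = 2}"
  then obtain e' where e': "e = \<phi> ` e'" "e' \<subseteq> A" "card e' = 2" by auto
  then have "card e = 2" using assms by (metis bij_betw_def card_image inj_on_subset)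
  then show "e \<in> {e. e \<subseteq> B \<and> card e = 2}" using e' assms by (auto simp: bij_betw_def)
next
  fix e assume "e \<in> {e. e \<subseteq> B \<and> card e = 2}"
  then have e: "e \<subseteq> B" "card e = 2" by auto
  have img: "\<phi> ` A = B" and inj: "inj_on \<phi> A" using assms by (auto simp: bij_betw_def)
  have "\<phi> ` (inv_into A \<phi> ` e) = e" using e img by (simp add: image_inv_into_cancel)
  moreover have "inv_into A \<phi> ` e \<subseteq> A" using e img by (auto intro: inv_into_into)
  moreover have "card (inv_into A \<phi> ` e) = 2"
    using e img by (metis card_image inj_on_inv_into)
  ultimately show "e \<in> (\<lambda>e. \<phi> ` e) ` {e. e \<subseteq> A \<and> card e = 2}" by (metis (mono_tags, lifting) image_eqI mem_Collect_eq)
qed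

text \<open>A copy of a complete graph is determined by its vertex set, because its edges are all
  pairs in that set.\<close>

lemma num_copies_complete_graph:
  assumes "is_graph (V, E)"
  shows "num_copies (complete_graph k) (V, E) = card (cliques (adj_of E) V k)"
proof -
  define pairs where "pairs Q = {e. e \<subseteq> Q \<and> card e = 2}" for Q :: "'a set"
  have G: "finite V" using assms by (simp add: is_graph_pair)
  have "{S. subhypergraph S (V, E) \<and> isomorphic (complete_graph k) S} = (\<lambda>Q. (Q, pairs Q)) ` cliques (adj_of E) V k"
  proof (intro equalityI subsetI)
    fix S assume "S \<in> {S. subhypergraph S (V, E) \<and> isomorphic (complete_graph k) S}"
    then obtain \<phi> where S: "subhypergraph S (V, E)" and \<phi>: "bij_betw \<phi> {..<k} (verts S)"
      and es: "edges S = (\<lambda>e. \<phi> ` e) ` {e. e \<subseteq> {..<k} \<and> card e = 2}"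
      by (auto simp: isomorphic_def complete_graph_def)
    have es': "edges S = pairs (verts S)" using es image_pairs[OF \<phi>] by (simp add: pairs_def)
    have "adj_of E x y" if "x \<in> verts S" "y \<in> verts S" "x \<noteq> y" for x y
    proof -
      have "{x, y} \<in> edges S" using that unfolding es' pairs_def by auto
      then show ?thesis using S by (auto simp: subhypergraph_def adj_of_def)
    qed
    moreover have "card (verts S) = k" using bij_betw_same_card[OF \<phi>] by simp
    moreover have "verts S \<subseteq> V" "finite (verts S)" using S G by (auto simp: subhypergraph_def intro: finite_subset)
    ultimately have "verts S \<in> cliques (adj_of E) V k" by (auto simp: cliques_def pairwise_def)
    moreover have "S = (verts S, pairs (verts S))" using es' by (metis prod.collapse)
    ultimately show "S \<in> (\<lambda>Q. (Q, pairs Q)) ` cliques (adj_of E) V k" by blast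
  next
    fix S assume "S \<in> (\<lambda>Q. (Q, pairs Q)) ` cliques (adj_of E) V k"
    then obtain Q where S: "S = (Q, pairs Q)" and Q: "Q \<subseteq> V" "finite Q" "card Q = k" "pairwise (adj_of E) Q"
      by (auto simp: cliques_def)
    have "pairs Q \<subseteq> E"
    proof
      fix e assume "e \<in> pairs Q"
      then obtain x y where "e = {x, y}" "x \<noteq> y" "x \<in> Q" "y \<in> Q" by (auto simp: pairs_def card_2_iff)
      then show "e \<in> E" using Q(4) by (auto simp: pairwise_def adj_of_def)
    qed
    then have "subhypergraph S (V, E)" using Q by (auto simp: S subhypergraph_def is_hypergraph_def pairs_def)
    moreover obtain \<phi> where \<phi>: "bij_betw \<phi> {..<k} Q"
      using ex_bij_betw_nat_finite[OF Q(2)] Q(3) by (auto simp: atLeast0LessThan)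
    have "isomorphic (complete_graph k) S"
      unfolding isomorphic_def complete_graph_def S
      using \<phi> image_pairs[OF \<phi>] by (intro exI[of _ \<phi>]) (auto simp: pairs_def)
    ultimately show "S \<in> {S. subhypergraph S (V, E) \<and> isomorphic (complete_graph k) S}" by simp
  qed
  moreover have "inj_on (\<lambda>Q. (Q, pairs Q)) (cliques (adj_of E) V k)" by (auto simp: inj_on_def)
  ultimately show ?thesis unfolding num_copies_def by (simp add: card_image)
qed

text \<open>Every part has room for all of \<open>verts F\<close>, so injections into the parts can
  be chosen separately and glued along the colour classes.\<close>

lemma contains_copy_if_has_blowup:
  assumes F: "is_graph F" and col: "proper_colouring F c f" and G: "is_graph (V, E)"
    and blow: "has_blowup (adj_of E) V c t" and t: "card (verts F) \<le> t"
  shows "contains_copy F (V, E)"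
proof -
  have finF: "finite (verts F)" and eF: "\<And>e. e \<in> edges F \<Longrightarrow> e \<subseteq> verts F \<and> card e = 2"
    using F by (auto simp: is_graph_def uniform_hypergraph_def is_hypergraph_def)
  have finV: "finite V" using G by (simp add: is_graph_pair)
  obtain As where As: "length As = c" "\<And>A. A \<in> set As \<Longrightarrow> A \<subseteq> V \<and> card A = t"
    "sorted_wrt (\<lambda>A B. \<forall>x\<in>A. \<forall>y\<in>B. adj_of E x y) As"
    using blow by (auto simp: has_blowup_def)
  have "\<exists>g. g ` verts F \<subseteq> As ! i \<and> inj_on g (verts F)" if "i < c" for i
  proof (rule card_le_inj[OF finF])
    have A: "As ! i \<subseteq> V \<and> card (As ! i) = t" using As that by (intro As(2)) auto
    then show "finite (As ! i)" using finV finite_subset by blast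
    show "card (verts F) \<le> card (As ! i)" using A t by simp
  qed
  then obtain g where g: "\<And>i. i < c \<Longrightarrow> g i ` verts F \<subseteq> As ! i \<and> inj_on (g i) (verts F)" by metis
  define \<phi> where "\<phi> v = g (f v) v" for v
  have fv: "f v < c" if "v \<in> verts F" for v using col that by (auto simp: proper_colouring_def)
  have \<phi>: "\<phi> v \<in> As ! f v" if "v \<in> verts F" for v using g[OF fv[OF that]] that by (auto simp: \<phi>_def)
  have adj: "adj_of E (\<phi> u) (\<phi> v)" if "u \<in> verts F" "v \<in> verts F" "f u \<noteq> f v" for u v
  proof -
    have *: "adj_of E x y" if "i < j" "j < c" "x \<in> As ! i" "y \<in> As ! j" for i j x y
      using sorted_wrt_nth_less[OF As(3), of i j] that As(1) by auto
    show ?thesis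
    proof (cases "f u < f v")
      case True
      then show ?thesis using *[OF True fv \<phi> \<phi>] that by blast
    next
      case False
      then have "f v < f u" using that by simp
      then show ?thesis using *[OF _ fv \<phi> \<phi>] that symp_adj_of[of E] by (auto simp: symp_def)
    qed
  qed
  show ?thesis
    unfolding contains_copy_iff[OF F]
  proof (intro exI[of _ \<phi>] conjI ballI)
    show "inj_on \<phi> (verts F)"
    proof (rule inj_onI)
      fix u v assume uv: "u \<in> verts F" "v \<in> verts F" "\<phi> u = \<phi> v"
      show "u = v"
      proof (cases "f u = f v")
        case True
        then show ?thesis using g[OF fv[OF uv(1)]] uv by (auto simp: \<phi>_def inj_on_def)
      next
        case False
        then show ?thesis using adj[OF uv(1,2)] uv(3) irreflp_adj_of[OF G] by (auto simp: irreflp_def)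
      qed
    qed
    show "\<phi> ` verts F \<subseteq> verts (V, E)"
    proof
      fix y assume "y \<in> \<phi> ` verts F"
      then obtain v where v: "v \<in> verts F" "y = \<phi> v" by auto
      have "As ! f v \<in> set As" using fv[OF v(1)] As(1) by simp
      then show "y \<in> verts (V, E)" using As(2) \<phi>[OF v(1)] v(2) by auto
    qed
    fix e assume e: "e \<in> edges F"
    obtain u v where uv: "e = {u, v}" using eF[OF e] by (auto simp: card_2_iff)
    have "f u \<noteq> f v" using col e uv by (auto simp: proper_colouring_def)
    moreover have "u \<in> verts F" "v \<in> verts F" using eF[OF e] uv by auto
    ultimately show "\<phi> ` e \<in> edges (V, E)" using adj uv by (auto simp: adj_of_def)
  qed
qed

lemma not_contains_copy_if_colourable:
  assumes F: "is_graph F" and chi: "r < chromatic_number F"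
    and col: "\<And>x. col x < r" "\<And>x y. {x, y} \<in> edges G \<Longrightarrow> col x \<noteq> col y"
  shows "\<not> contains_copy F G"
proof
  assume "contains_copy F G"
  then obtain \<phi> where \<phi>: "\<forall>e\<in>edges F. \<phi> ` e \<in> edges G"
    unfolding contains_copy_iff[OF F] by blast
  have "proper_colouring F r (col \<circ> \<phi>)"
    unfolding proper_colouring_def
  proof (intro conjI ballI allI impI)
    fix u v assume "{u, v} \<in> edges F"
    then have "{\<phi> u, \<phi> v} \<in> edges G" using \<phi> by force
    then show "(col \<circ> \<phi>) u \<noteq> (col \<circ> \<phi>) v" using col(2) by simp
  qed (use col in simp)
  then have "chromatic_number F \<le> r" unfolding chromatic_number_def by (intro Least_le) blast
  with chi show False by simp
qed

text \<open>A copy of \<open>F\<close> through the clone \<open>u\<close> could be rerouted through an unused vertex of \<open>A\<close>.\<close>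

lemma not_contains_copy_clone:
  assumes F: "is_graph F" and no: "\<not> contains_copy F (V, E)"
    and A: "A \<subseteq> V" "card (verts F) \<le> card A" "u \<notin> A"
    and W: "\<And>a w. a \<in> A \<Longrightarrow> w \<in> W \<Longrightarrow> {a, w} \<in> E" and u: "u \<in> V" "u \<notin> W"
    and E': "E' \<subseteq> {e \<in> E. u \<notin> e} \<union> {{u, w} | w. w \<in> W}"
  shows "\<not> contains_copy F (V, E')"
proof
  assume "contains_copy F (V, E')"
  then obtain \<phi> where \<phi>: "inj_on \<phi> (verts F)" "\<phi> ` verts F \<subseteq> V" "\<And>e. e \<in> edges F \<Longrightarrow> \<phi> ` e \<in> E'"
    unfolding contains_copy_iff[OF F] by auto
  have finF: "finite (verts F)" and eF: "\<And>e. e \<in> edges F \<Longrightarrow> e \<subseteq> verts F \<and> card e = 2"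
    using F by (auto simp: is_graph_def uniform_hypergraph_def is_hypergraph_def)
  show False
  proof (cases "u \<in> \<phi> ` verts F")
    case False
    have "\<phi> ` e \<in> E" if "e \<in> edges F" for e
    proof -
      have "u \<notin> \<phi> ` e" using eF[OF that] False by auto
      then show ?thesis using \<phi>(3)[OF that] E' by auto
    qed
    then have "contains_copy F (V, E)" unfolding contains_copy_iff[OF F] using \<phi> by auto
    with no show False ..
  next
    case True
    \<comment> \<open>Besides \<open>u\<close>, the copy occupies fewer than \<open>card A\<close>
      vertices.\<close>
    have "\<not> A \<subseteq> \<phi> ` verts F - {u}"
    proof
      assume "A \<subseteq> \<phi> ` verts F - {u}"
      then have "card A \<le> card (\<phi> ` verts F - {u})" using finF by (intro card_mono) auto
      also have "\<dots> < card (\<phi> ` verts F)" using True finF by (intro psubset_card_mono) auto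
      also have "\<dots> \<le> card (verts F)" using finF by (rule card_image_le)
      finally show False using A by simp
    qed
    then obtain a where a: "a \<in> A" "a \<notin> \<phi> ` verts F" using A(3) by blast
    define \<psi> where "\<psi> v = (if \<phi> v = u then a else \<phi> v)" for v
    have "inj_on \<psi> (verts F)"
    proof (rule inj_onI)
      fix x y assume "x \<in> verts F" "y \<in> verts F" "\<psi> x = \<psi> y"
      then have "\<phi> x = \<phi> y" using a(2) by (auto simp: \<psi>_def split: if_splits)
      then show "x = y" using \<phi>(1) \<open>x \<in> verts F\<close> \<open>y \<in> verts F\<close> by (auto simp: inj_on_def)
    qed
    moreover have "\<psi> ` verts F \<subseteq> V" using \<phi>(2) a A by (auto simp: \<psi>_def)
    moreover have "\<psi> ` e \<in> E" if e: "e \<in> edges F" for e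
    proof (cases "u \<in> \<phi> ` e")
      case True
      then obtain w where w: "\<phi> ` e = {u, w}" "w \<in> W" using \<phi>(3)[OF e] E' by auto
      have "\<psi> ` e = (\<lambda>x. if x = u then a else x) ` \<phi> ` e" by (auto simp: \<psi>_def image_image)
      also have "\<dots> = {a, w}" unfolding w using w(2) u(2) by auto
      finally show ?thesis using W[OF a(1) w(2)] by simp
    next
      case False
      then have "\<psi> ` e = \<phi> ` e" by (intro image_cong) (auto simp: \<psi>_def)
      then show ?thesis using False \<phi>(3)[OF e] E' by auto
    qed
    ultimately have "contains_copy F (V, E)" unfolding contains_copy_iff[OF F] by auto
    with no show False ..
  qed
qed

section \<open>From Berge-free hypergraphs to red-blue graphs and back\<close>

text \<open>With \<open>N h\<close> the set of pairs in \<open>h\<close>, the pairs inside members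
  of the surplus set \<open>X\<close> become blue, so these members are blue cliques, and every
  other hyperedge receives a red pair of its own. Blue pairs are matched back into \<open>X\<close>
  and red ones into the rest, so a copy of \<open>F\<close> in the union expands to a Berge
  copy.\<close>

lemma berge_free_red_blue:
  assumes H: "uniform_hypergraph k (V, H)" and free: "berge_free F (V, H)"
  shows "\<exists>B R. is_graph (V, B) \<and> is_graph (V, R) \<and> B \<inter> R = {} \<and> \<not> contains_copy F (V, B \<union> R) \<and>
    card H \<le> card (cliques (adj_of B) V k) + card R"
proof -
  have V: "finite V" and hV: "\<And>h. h \<in> H \<Longrightarrow> h \<subseteq> V \<and> card h = k"
    using H by (auto simp: uniform_hypergraph_def is_hypergraph_def)
  have finH: "finite H" by (rule finite_subset[of _ "Pow V"]) (use hV V in auto)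
  define N where "N h = {e. e \<subseteq> h \<and> card e = 2}" for h :: "'a set"
  have finN: "\<forall>h\<in>H. finite (N h)"
  proof
    fix h assume "h \<in> H"
    then have "N h \<subseteq> Pow V" using hV by (auto simp: N_def)
    then show "finite (N h)" using V by (simp add: finite_subset)
  qed
  obtain X f g where X: "X \<subseteq> H" and f1: "inj_on f (H - X)" and f2: "\<forall>h\<in>H - X. f h \<in> N h - \<Union>(N ` X)"
    and g1: "inj_on g (\<Union>(N ` X))" and g2: "\<forall>p\<in>\<Union>(N ` X). g p \<in> X \<and> p \<in> N (g p)"
    using maximal_surplus_matching[of H N, OF finH finN] by (elim exE conjE) (rule that)
  note f = f1 bspec[OF f2] and g = g1 bspec[OF g2]
  define B where "B = \<Union>(N ` X)"
  define R where "R = f ` (H - X)"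
  have B: "is_graph (V, B)" unfolding is_graph_pair B_def N_def using V hV X by blast
  have R: "is_graph (V, R)" unfolding is_graph_pair R_def
  proof (intro conjI ballI V)
    fix e assume "e \<in> f ` (H - X)"
    then obtain h where "h \<in> H - X" "e = f h" by auto
    then have "e \<in> N h" "h \<in> H" using f(2) by auto
    then show "e \<subseteq> V" "card e = 2" using hV by (auto simp: N_def)
  qed
  have dis: "B \<inter> R = {}" using f(2) by (auto simp: B_def R_def)
  have "card R = card (H - X)" unfolding R_def by (rule card_image[OF f(1)])
  moreover have "X \<subseteq> cliques (adj_of B) V k"
  proof
    fix h assume h: "h \<in> X"
    have "adj_of B x y" if "x \<in> h" "y \<in> h" "x \<noteq> y" for x y
      unfolding adj_of_def B_def N_def using h that by auto
    moreover have "h \<subseteq> V" "card h = k" using hV h X by auto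
    moreover from this have "finite h" using V finite_subset by blast
    ultimately show "h \<in> cliques (adj_of B) V k" by (simp add: cliques_def pairwise_def)
  qed
  then have "card X \<le> card (cliques (adj_of B) V k)" using V by (intro card_mono) auto
  moreover have "card H = card X + card (H - X)"
    using X finH by (metis card_Diff_subset card_mono finite_subset le_add_diff_inverse)
  ultimately have le: "card H \<le> card (cliques (adj_of B) V k) + card R" by simp
  have "\<not> contains_copy F (V, B \<union> R)"
  proof
    assume "contains_copy F (V, B \<union> R)"
    then obtain S where S: "subhypergraph S (V, B \<union> R)" "isomorphic F S" by (auto simp: contains_copy_def)
    define m where "m p = (if p \<in> B then g p else inv_into (H - X) f p)" for p
    have mB: "m p \<in> X \<and> p \<subseteq> m p" if "p \<in> B" for p
      using g(2) that by (auto simp: m_def B_def N_def)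
    have mR: "m p \<in> H - X \<and> p \<subseteq> m p \<and> f (m p) = p" if "p \<in> R" for p
    proof -
      have "p \<notin> B" using dis that by auto
      then have "m p = inv_into (H - X) f p" by (simp add: m_def)
      then have "m p \<in> H - X" "f (m p) = p" using that unfolding R_def by (simp_all only: inv_into_into f_inv_into_f)
      then show ?thesis using f(2)[of "m p"] by (auto simp: N_def)
    qed
    have inj: "inj_on m (B \<union> R)"
    proof (rule inj_onI)
      fix p q assume p: "p \<in> B \<union> R" and q: "q \<in> B \<union> R" and eq: "m p = m q"
      consider "p \<in> B" "q \<in> B" | "p \<in> R" "q \<in> R" | "p \<in> B" "q \<in> R" | "p \<in> R" "q \<in> B" using p q by blast
      then show "p = q"
      proof cases
        case 1
        then show ?thesis using g(1) eq by (auto simp: m_def B_def inj_on_def)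
      next
        case 2
        then show ?thesis using mR eq by metis
      qed (use mB mR eq in force)+
    qed
    have ES: "edges S \<subseteq> B \<union> R" using S by (simp add: subhypergraph_def)
    define T where "T = (V, m ` edges S)"
    have mp: "m p \<in> H \<and> p \<subseteq> m p" if "p \<in> B \<union> R" for p
      using that mB mR X by blast
    have "subhypergraph T (V, H)"
      using V hV mp ES by (auto simp: T_def subhypergraph_def is_hypergraph_def)
    moreover have "is_graph S"
      using S(1) B R by (auto simp: is_graph_def uniform_hypergraph_def subhypergraph_def)
    moreover have "berge_copy_of T S"
      unfolding berge_copy_of_def
    proof (intro conjI exI[of _ "inv_into (edges S) m"] ballI)
      show "verts S \<subseteq> verts T" using S by (simp add: T_def subhypergraph_def)
      have injS: "inj_on m (edges S)" using inj ES inj_on_subset by blast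
      then show "bij_betw (inv_into (edges S) m) (edges T) (edges S)"
        by (auto simp: T_def intro!: bij_betw_inv_into bij_betw_imageI)
      fix h assume "h \<in> edges T"
      then obtain p where p: "p \<in> edges S" "h = m p" by (auto simp: T_def)
      then show "inv_into (edges S) m h \<subseteq> h" using injS mp ES by auto
    qed
    ultimately show False using free S(2) unfolding berge_free_def is_berge_def by blast
  qed
  with B R dis le show ?thesis by blast
qed

text \<open>A pair inside a clique is an edge, so the graph underlying a Berge copy would already be
  a copy of \<open>F\<close>. This bounds the Berge extremal number from below.\<close>

lemma berge_free_clique_hypergraph:
  assumes G: "is_graph (V, E)" and free: "\<not> contains_copy F (V, E)"
  shows "uniform_hypergraph k (V, cliques (adj_of E) V k)" "berge_free F (V, cliques (adj_of E) V k)"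
proof -
  have V: "finite V" using G by (simp add: is_graph_pair)
  then show "uniform_hypergraph k (V, cliques (adj_of E) V k)"
    by (auto simp: uniform_hypergraph_def is_hypergraph_def cliques_def)
  show "berge_free F (V, cliques (adj_of E) V k)"
    unfolding berge_free_def
  proof
    assume "\<exists>S. subhypergraph S (V, cliques (adj_of E) V k) \<and> is_berge F S"
    then obtain S K f where S: "subhypergraph S (V, cliques (adj_of E) V k)" and K: "is_graph K" "isomorphic F K"
      and KS: "verts K \<subseteq> verts S" and f: "bij_betw f (edges S) (edges K)" "\<And>h. h \<in> edges S \<Longrightarrow> f h \<subseteq> h"
      by (auto simp: is_berge_def berge_copy_of_def)
    have "e \<in> E" if e: "e \<in> edges K" for e
    proof -
      obtain h where h: "h \<in> edges S" "e = f h" using f(1) e by (auto simp: bij_betw_def)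
      then have "h \<in> cliques (adj_of E) V k" "e \<subseteq> h" using S f(2) by (auto simp: subhypergraph_def)
      moreover have "card e = 2" using K e by (auto simp: is_graph_def uniform_hypergraph_def)
      then obtain x y where "e = {x, y}" "x \<noteq> y" by (auto simp: card_2_iff)
      ultimately show ?thesis by (auto simp: cliques_def pairwise_def adj_of_def)
    qed
    moreover have "is_hypergraph K" using K by (simp add: is_graph_def uniform_hypergraph_def)
    ultimately have "subhypergraph K (V, E)" using KS S by (auto simp: subhypergraph_def)
    then show False using free K unfolding contains_copy_def by blast
  qed
qed

section \<open>Optimal red-blue graphs\<close>

definition red_blue :: "'b hypergraph \<Rightarrow> 'a set \<Rightarrow> 'a set set \<times> 'a set set \<Rightarrow> bool" where
  "red_blue F V BR \<longleftrightarrow> is_graph (V, fst BR) \<and> is_graph (V, snd BR) \<and> fst BR \<inter> snd BR = {} \<and>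
     \<not> contains_copy F (V, fst BR \<union> snd BR)"

definition red_blue_weight :: "nat \<Rightarrow> 'a set \<Rightarrow> 'a set set \<times> 'a set set \<Rightarrow> nat" where
  "red_blue_weight k V BR = card (cliques (adj_of (fst BR)) V k) + card (snd BR)"

lemma finite_edges: "is_graph (V, E) \<Longrightarrow> finite E"
  by (rule finite_subset[of _ "Pow V"]) (auto simp: is_graph_pair)

lemma card_edges_le:
  assumes "is_graph (V, E)"
  shows "card E \<le> card V * card V"
proof -
  have V: "finite V" using assms by (simp add: is_graph_pair)
  have "E \<subseteq> (\<lambda>(x, y). {x, y}) ` (V \<times> V)"
  proof
    fix e assume "e \<in> E"
    then have "e \<subseteq> V" "card e = 2" using assms by (auto simp: is_graph_pair)
    then obtain x y where "e = {x, y}" "x \<in> V" "y \<in> V" by (auto simp: card_2_iff)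
    then show "e \<in> (\<lambda>(x, y). {x, y}) ` (V \<times> V)" by force
  qed
  then have "card E \<le> card (V \<times> V)" by (rule surj_card_le[rotated]) (use V in simp)
  then show ?thesis by (simp add: card_cartesian_product)
qed

lemma cliques_vertex_split:
  assumes "symp adj" "irreflp adj" "u \<in> V"
  shows "cliques adj V (Suc l) = cliques adj (V - {u}) (Suc l) \<union> insert u ` cliques adj (common_nbrs adj V {u}) l"
proof (intro equalityI subsetI)
  fix Q assume "Q \<in> cliques adj V (Suc l)"
  then have Q: "Q \<subseteq> V" "finite Q" "card Q = Suc l" "pairwise adj Q" by (auto simp: cliques_def)
  show "Q \<in> cliques adj (V - {u}) (Suc l) \<union> insert u ` cliques adj (common_nbrs adj V {u}) l"
  proof (cases "u \<in> Q")
    case True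
    then have "Q - {u} \<in> cliques adj (common_nbrs adj V {u}) l"
      using Q by (auto simp: cliques_def common_nbrs_def pairwise_def)
    moreover have "Q = insert u (Q - {u})" using True by auto
    ultimately show ?thesis by blast
  next
    case False
    then show ?thesis using Q by (auto simp: cliques_def)
  qed
next
  fix Q assume "Q \<in> cliques adj (V - {u}) (Suc l) \<union> insert u ` cliques adj (common_nbrs adj V {u}) l"
  then show "Q \<in> cliques adj V (Suc l)"
  proof
    assume "Q \<in> cliques adj (V - {u}) (Suc l)"
    then show ?thesis using cliques_mono[of "V - {u}" V] by auto
  next
    assume "Q \<in> insert u ` cliques adj (common_nbrs adj V {u}) l"
    then obtain P where P: "Q = insert u P" "P \<in> cliques adj (common_nbrs adj V {u}) l" by auto
    have "u \<notin> P" using P assms(2) by (auto simp: cliques_def common_nbrs_def irreflp_def)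
    then show ?thesis using P assms(1,3)
      by (auto simp: cliques_def common_nbrs_def pairwise_insert symp_def)
  qed
qed

lemma card_cliques_vertex_split:
  assumes "finite V" "symp adj" "irreflp adj" "u \<in> V"
  shows "card (cliques adj V (Suc l)) =
    card (cliques adj (V - {u}) (Suc l)) + card (cliques adj (common_nbrs adj V {u}) l)"
proof -
  have nu: "u \<notin> P" if "P \<in> cliques adj (common_nbrs adj V {u}) l" for P
    using that assms(3) by (auto simp: cliques_def common_nbrs_def irreflp_def)
  have "card (cliques adj V (Suc l)) =
      card (cliques adj (V - {u}) (Suc l)) + card (insert u ` cliques adj (common_nbrs adj V {u}) l)"
    unfolding cliques_vertex_split[OF assms(2-4)]
    using assms(1) by (intro card_Un_disjoint) (auto simp: cliques_def)
  also have "card (insert u ` cliques adj (common_nbrs adj V {u}) l) = card (cliques adj (common_nbrs adj V {u}) l)"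
    by (rule card_image) (use nu in \<open>auto simp: inj_on_def insert_ident\<close>)
  finally show ?thesis .
qed

text \<open>All edges at \<open>u\<close>, of both colours, are replaced by blue edges to
  \<open>W\<close>. Cliques avoiding \<open>u\<close> are unaffected, those through \<open>u\<close>
  now correspond to the l-cliques of \<open>W\<close>, and at most \<open>card V\<close> red edges
  are lost.\<close>

lemma cloning_bound_if_maximal:
  assumes F: "is_graph F" and rb: "red_blue F V (B, R)" and h: "card (verts F) \<le> h"
    and max: "\<And>BR. red_blue F V BR \<Longrightarrow> red_blue_weight (Suc l) V BR \<le> red_blue_weight (Suc l) V (B, R)"
  shows "cloning_bound (adj_of B) V h l"
  unfolding cloning_bound_def
proof (intro ballI allI impI)
  fix u A W assume u: "u \<in> V" and A: "A \<subseteq> V" "h \<le> card A" "u \<notin> A" and W: "W \<subseteq> V - {u}"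
    and AW: "\<forall>a\<in>A. \<forall>w\<in>W. adj_of B a w"
  have B: "is_graph (V, B)" and R: "is_graph (V, R)" and dis: "B \<inter> R = {}" and no: "\<not> contains_copy F (V, B \<union> R)"
    using rb by (auto simp: red_blue_def)
  have V: "finite V" using B by (simp add: is_graph_pair)
  define B' where "B' = {e \<in> B. u \<notin> e} \<union> {{u, w} | w. w \<in> W}"
  define R' where "R' = {e \<in> R. u \<notin> e}"
  have gB': "is_graph (V, B')"
    unfolding is_graph_pair
  proof (intro conjI ballI V)
    fix e assume "e \<in> B'"
    then consider "e \<in> B" | w where "e = {u, w}" "w \<in> W" by (auto simp: B'_def)
    then have "e \<subseteq> V \<and> card e = 2"
    proof cases
      case 1
      then show ?thesis using B by (simp add: is_graph_pair)
    next
      case 2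
      then have "w \<noteq> u" "w \<in> V" using W by auto
      then show ?thesis using 2 u by auto
    qed
    then show "e \<subseteq> V" "card e = 2" by auto
  qed
  have gR': "is_graph (V, R')" using R by (auto simp: is_graph_pair R'_def)
  have "\<not> contains_copy F (V, B' \<union> R')"
  proof (rule not_contains_copy_clone[OF F no A(1) _ A(3) _ u])
    show "card (verts F) \<le> card A" using h A by simp
    show "{a, w} \<in> B \<union> R" if "a \<in> A" "w \<in> W" for a w using AW that by (auto simp: adj_of_def)
    show "u \<notin> W" using W by auto
    show "B' \<union> R' \<subseteq> {e \<in> B \<union> R. u \<notin> e} \<union> {{u, w} | w. w \<in> W}" by (auto simp: B'_def R'_def)
  qed
  moreover have "B' \<inter> R' = {}" using dis by (auto simp: B'_def R'_def)
  ultimately have "red_blue F V (B', R')" using gB' gR' by (simp add: red_blue_def)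
  then have wt: "card (cliques (adj_of B') V (Suc l)) + card R' \<le> card (cliques (adj_of B) V (Suc l)) + card R"
    using max[of "(B', R')"] by (simp add: red_blue_weight_def)
  have "cliques (adj_of B') (V - {u}) (Suc l) = cliques (adj_of B) (V - {u}) (Suc l)"
    unfolding cliques_def pairwise_def adj_of_def B'_def by (intro Collect_cong) (auto simp: doubleton_eq_iff)
  moreover have "common_nbrs (adj_of B') V {u} = W"
    using W by (auto simp: common_nbrs_def adj_of_def B'_def doubleton_eq_iff)
  moreover have "cliques (adj_of B') W l = cliques (adj_of B) W l"
    using W unfolding cliques_def pairwise_def adj_of_def B'_def by (intro Collect_cong) (auto simp: doubleton_eq_iff)
  ultimately have c': "card (cliques (adj_of B') V (Suc l)) = card (cliques (adj_of B) (V - {u}) (Suc l)) + card (cliques (adj_of B) W l)"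
    using card_cliques_vertex_split[OF V symp_adj_of irreflp_adj_of[OF gB'] u, of l] by simp
  have c: "card (cliques (adj_of B) V (Suc l)) = card (cliques (adj_of B) (V - {u}) (Suc l)) + card (cliques (adj_of B) (common_nbrs (adj_of B) V {u}) l)"
    using card_cliques_vertex_split[OF V symp_adj_of irreflp_adj_of[OF B] u] .
  have "R \<subseteq> R' \<union> (\<lambda>x. {u, x}) ` V"
  proof
    fix e assume e: "e \<in> R"
    then have "e \<subseteq> V" "card e = 2" using R by (auto simp: is_graph_pair)
    then obtain x y where xy: "e = {x, y}" "x \<in> V" "y \<in> V" by (auto simp: card_2_iff)
    then show "e \<in> R' \<union> (\<lambda>x. {u, x}) ` V" using e by (cases "u \<in> e") (auto simp: R'_def insert_commute)
  qed
  then have "card R \<le> card (R' \<union> (\<lambda>x. {u, x}) ` V)"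
    using V finite_edges[OF gR'] by (intro card_mono) auto
  also have "\<dots> \<le> card R' + card ((\<lambda>x. {u, x}) ` V)" by (rule card_Un_le)
  also have "card ((\<lambda>x. {u, x}) ` V) \<le> card V" using V by (rule card_image_le)
  finally have "card R \<le> card R' + card V" by simp
  then show "card (cliques (adj_of B) W l) \<le> card (cliques (adj_of B) (common_nbrs (adj_of B) V {u}) l) + card V"
    using wt c c' by linarith
qed

text \<open>\<open>P\<close> together with \<open>u\<close> and \<open>v\<close> becomes a blue
  clique that was not one before and makes up for the lost red edge. The union of the colours stays
  the same, so no copy of \<open>F\<close> appears.\<close>

lemma recolour_increases:
  assumes rb: "red_blue F V (B, R)" and uv: "{u, v} \<in> R" and l: "1 \<le> l"
    and P: "P \<in> cliques (adj_of B) (common_nbrs (adj_of B) V {u, v}) (l - 1)"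
  shows "red_blue F V (insert {u, v} B, R - {{u, v}})"
    and "red_blue_weight (Suc l) V (B, R) \<le> red_blue_weight (Suc l) V (insert {u, v} B, R - {{u, v}})"
proof -
  let ?B = "insert {u, v} B"
  have B: "is_graph (V, B)" and R: "is_graph (V, R)" and dis: "B \<inter> R = {}" and no: "\<not> contains_copy F (V, B \<union> R)"
    using rb by (auto simp: red_blue_def)
  have V: "finite V" using B by (simp add: is_graph_pair)
  have e: "{u, v} \<subseteq> V" "card {u, v} = 2" using R uv unfolding is_graph_pair by blast+
  then have uv': "u \<noteq> v" "u \<in> V" "v \<in> V" by auto
  have "?B \<union> (R - {{u, v}}) = B \<union> R" using uv by auto
  then show rb': "red_blue F V (?B, R - {{u, v}})"
    using B R dis no e unfolding red_blue_def is_graph_pair by auto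
  have irr: "irreflp (adj_of B)" by (rule irreflp_adj_of[OF B])
  have P': "P \<subseteq> V" "finite P" "card P = l - 1" "pairwise (adj_of B) P"
    and Puv: "\<And>x. x \<in> P \<Longrightarrow> adj_of B x u \<and> adj_of B x v"
    using P by (auto simp: cliques_def common_nbrs_def)
  have nP: "u \<notin> P" "v \<notin> P" using Puv irr by (auto simp: irreflp_def)
  define Q where "Q = insert u (insert v P)"
  have "Q \<in> cliques (adj_of ?B) V (Suc l)"
  proof -
    have "card Q = Suc l" using P' nP uv' l by (simp add: Q_def)
    moreover have "pairwise (adj_of ?B) Q"
      using P'(4) Puv unfolding Q_def pairwise_def adj_of_def by (auto simp: insert_commute)
    ultimately show ?thesis using P' uv' by (simp add: cliques_def Q_def)
  qed
  moreover have "Q \<notin> cliques (adj_of B) V (Suc l)"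
    using uv uv' dis by (auto simp: cliques_def pairwise_def Q_def adj_of_def)
  moreover have "cliques (adj_of B) V (Suc l) \<subseteq> cliques (adj_of ?B) V (Suc l)"
    by (auto simp: cliques_def pairwise_def adj_of_def)
  ultimately have "cliques (adj_of B) V (Suc l) \<subset> cliques (adj_of ?B) V (Suc l)" by blast
  then have "card (cliques (adj_of B) V (Suc l)) < card (cliques (adj_of ?B) V (Suc l))"
    using V by (intro psubset_card_mono) auto
  moreover have "card R = Suc (card (R - {{u, v}}))"
    using finite_edges[OF R] uv by (metis card.remove)
  ultimately show "red_blue_weight (Suc l) V (B, R) \<le> red_blue_weight (Suc l) V (?B, R - {{u, v}})"
    by (simp add: red_blue_weight_def)
qed

lemma red_blue_optimum_blue:
  fixes F :: "'b hypergraph"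
  assumes F: "is_graph F" and chi: "chromatic_number F = Suc r" and l: "2 \<le> l" "Suc l \<le> r"
    and num: "((real r + real l - 2) / (2 * real r)) ^ l < 1 - real l / real r"
  shows "\<exists>N. \<forall>V :: 'a set. finite V \<longrightarrow> N \<le> card V \<longrightarrow> (\<forall>BR. red_blue F V BR \<longrightarrow>
    (\<exists>E. is_graph (V, E) \<and> \<not> contains_copy F (V, E) \<and>
      red_blue_weight (Suc l) V BR \<le> card (cliques (adj_of E) V (Suc l))))"
proof -
  define h where "h = max 1 (card (verts F))"
  have h: "1 \<le> h" "card (verts F) \<le> h" by (auto simp: h_def)
  obtain N1 \<eta> where \<eta>: "0 < \<eta>" and N1: "\<forall>adj (V :: 'a set) u v. finite V \<longrightarrow> symp adj \<longrightarrow> irreflp adj \<longrightarrow> N1 \<le> card V \<longrightarrow>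
    \<not> has_blowup adj V (Suc r) h \<longrightarrow>
    real (card V) ^ Suc l * ((\<Prod>s<Suc l. 1 - real s / real r) - \<eta>) \<le> fact (Suc l) * real (card (cliques adj V (Suc l))) \<longrightarrow>
    cloning_bound adj V h l \<longrightarrow> u \<in> V \<longrightarrow> v \<in> V \<longrightarrow>
    cliques adj (common_nbrs adj V {u, v}) (l - 1) \<noteq> {}"
    using common_nbrs_contain_clique[OF l h(1) num, where 'a = 'a] by (elim exE conjE) (rule that)
  have "1 \<le> Suc l" "0 < \<eta> / 2" using \<eta> by auto
  from turan_card_cliques_lower[OF this(1) l(2) this(2), where 'a = 'a]
  obtain N2 where N2: "\<forall>V :: 'a set. finite V \<longrightarrow> N2 \<le> card V \<longrightarrow> (\<exists>col. (\<forall>x. col x < r) \<and>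
    real (card V) ^ Suc l * ((\<Prod>s<Suc l. 1 - real s / real r) - \<eta> / 2) \<le>
      fact (Suc l) * real (card (cliques (\<lambda>x y. col x \<noteq> col y) V (Suc l))))"
    by (elim exE) (rule that)
  \<comment> \<open>Makes (l+1)! n^2 at most \<eta>/2 n^(l+1), as l + 1 \<ge> 3; the other half of
    \<eta> is spent on the Turan count.\<close>
  define N3 where "N3 = nat \<lceil>fact (Suc l) * 2 / \<eta>\<rceil>"
  show ?thesis
  proof (rule exI[of _ "max (max N1 1) (max N2 N3)"], intro allI impI)
    fix V :: "'a set" and BR0
    assume V: "finite V" and N: "max (max N1 1) (max N2 N3) \<le> card V" and rb0: "red_blue F V BR0"
    define n where "n = real (card V)"
    have n1: "1 \<le> n" using N by (simp add: n_def)
    let ?w = "red_blue_weight (Suc l) V"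
    \<comment> \<open>A crude bound on the weights, so that a maximum exists.\<close>
    have bound: "\<forall>BR. red_blue F V BR \<longrightarrow> ?w BR < Suc (card V ^ Suc l + card V * card V)"
      using card_cliques_le_power[OF V, of _ "Suc l"] card_edges_le
      by (auto simp: red_blue_weight_def red_blue_def less_Suc_eq_le intro!: add_mono simp del: power_Suc)
    obtain BR1 where BR1: "red_blue F V BR1" "\<And>BR. red_blue F V BR \<Longrightarrow> ?w BR \<le> ?w BR1"
      using ex_has_greatest_nat[of "red_blue F V", OF rb0 bound] by blast
    \<comment> \<open>Ties are broken by the number of red edges, because recolouring is only known
      not to decrease the weight.\<close>
    obtain BR where BR: "red_blue F V BR" "?w BR = ?w BR1"
      and least: "\<And>BR'. red_blue F V BR' \<Longrightarrow> ?w BR' = ?w BR1 \<Longrightarrow> card (snd BR) \<le> card (snd BR')"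
      using ex_has_least_nat[of "\<lambda>BR. red_blue F V BR \<and> ?w BR = ?w BR1" BR1 "\<lambda>BR. card (snd BR)"] BR1(1) by blast
    obtain B R where BRe: "BR = (B, R)" by (cases BR)
    have rb: "red_blue F V (B, R)" using BR BRe by simp
    have max: "?w BR' \<le> ?w (B, R)" if "red_blue F V BR'" for BR'
      using BR1(2)[OF that] BR(2) BRe by simp
    have B: "is_graph (V, B)" and R: "is_graph (V, R)" and no: "\<not> contains_copy F (V, B \<union> R)"
      using rb by (auto simp: red_blue_def)
    have noB: "\<not> contains_copy F (V, B)"
      using no unfolding contains_copy_iff[OF F] fst_conv snd_conv by blast
    have "R = {}"
    proof (rule ccontr)
      assume "R \<noteq> {}"
      then obtain e where e: "e \<in> R" by blast
      then have "e \<subseteq> V" "card e = 2" using R by (auto simp: is_graph_pair)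
      then obtain u v where uv: "e = {u, v}" "u \<in> V" "v \<in> V" by (auto simp: card_2_iff)
      obtain f where "proper_colouring F (Suc r) f"
        using chromatic_number_attained[OF F] chi by auto
      then have noblow: "\<not> has_blowup (adj_of B) V (Suc r) h"
        using contains_copy_if_has_blowup[OF F _ B _ h(2)] noB by blast
      have NN: "N2 \<le> card V" "N1 \<le> card V" using N by auto
      obtain col :: "'a \<Rightarrow> nat" where col: "\<forall>x. col x < r"
        and low: "n ^ Suc l * ((\<Prod>s<Suc l. 1 - real s / real r) - \<eta> / 2) \<le>
          fact (Suc l) * real (card (cliques (\<lambda>x y. col x \<noteq> col y) V (Suc l)))"
        using N2[rule_format, OF V NN(1), folded n_def] by (elim exE conjE) (rule that)
      \<comment> \<open>The Turan graph, coloured blue throughout, competes with the optimum. As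
        \<open>R\<close> has at most n^2 edges, the blue cliques alone come close to its
        weight.\<close>
      define T where "T = {{x, y} | x y. x \<in> V \<and> y \<in> V \<and> col x \<noteq> col y}"
      have T: "adj_of T x y \<longleftrightarrow> x \<in> V \<and> y \<in> V \<and> col x \<noteq> col y" for x y
        by (auto simp: adj_of_def T_def doubleton_eq_iff)
      have "is_graph (V, T)" using V by (auto simp: is_graph_pair T_def card_2_iff)
      moreover have "\<not> contains_copy F (V, T)"
        by (rule not_contains_copy_if_colourable[OF F, of r col]) (use chi col T in \<open>auto simp: adj_of_def\<close>)
      ultimately have "red_blue F V (T, {})" using V by (simp add: red_blue_def is_graph_pair)
      then have "?w (T, {}) \<le> ?w (B, R)" by (rule max)
      moreover have "cliques (adj_of T) V (Suc l) = cliques (\<lambda>x y. col x \<noteq> col y) V (Suc l)"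
        unfolding cliques_def by (intro Collect_cong) (auto simp: T pairwise_def)
      ultimately have "card (cliques (\<lambda>x y. col x \<noteq> col y) V (Suc l)) \<le> card (cliques (adj_of B) V (Suc l)) + card V * card V"
        using card_edges_le[OF R] by (simp add: red_blue_weight_def)
      then have "real (card (cliques (\<lambda>x y. col x \<noteq> col y) V (Suc l))) \<le>
          real (card (cliques (adj_of B) V (Suc l)) + card V * card V)" by (rule of_nat_mono)
      then have "fact (Suc l) * real (card (cliques (\<lambda>x y. col x \<noteq> col y) V (Suc l))) \<le>
          fact (Suc l) * (real (card (cliques (adj_of B) V (Suc l))) + n * n)"
        by (intro mult_left_mono) (auto simp: n_def)
      with low have "n ^ Suc l * ((\<Prod>s<Suc l. 1 - real s / real r) - \<eta> / 2) \<le>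
          fact (Suc l) * real (card (cliques (adj_of B) V (Suc l))) + fact (Suc l) * (n * n)"
        unfolding distrib_left by linarith
      moreover have "fact (Suc l) * (n * n) \<le> n ^ Suc l * (\<eta> / 2)"
      proof -
        have "fact (Suc l) * 2 / \<eta> \<le> n"
          using N real_nat_ceiling_ge[of "fact (Suc l) * 2 / \<eta>"] unfolding N3_def n_def by linarith
        then have "fact (Suc l) \<le> n * (\<eta> / 2)" using \<eta> by (simp add: field_simps)
        then have "fact (Suc l) * (n * n) \<le> n * (\<eta> / 2) * (n * n)" using n1 by (intro mult_right_mono) auto
        also have "\<dots> = n ^ 3 * (\<eta> / 2)" by (simp add: power3_eq_cube)
        also have "\<dots> \<le> n ^ Suc l * (\<eta> / 2)" using n1 l \<eta> by (intro mult_right_mono power_increasing) auto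
        finally show ?thesis .
      qed
      ultimately have near: "n ^ Suc l * ((\<Prod>s<Suc l. 1 - real s / real r) - \<eta>) \<le>
          fact (Suc l) * real (card (cliques (adj_of B) V (Suc l)))"
        by (simp add: algebra_simps del: power_Suc fact_Suc)
      have clone: "cloning_bound (adj_of B) V h l"
        by (rule cloning_bound_if_maximal[OF F rb h(2) max])
      obtain P where "P \<in> cliques (adj_of B) (common_nbrs (adj_of B) V {u, v}) (l - 1)"
        using N1[rule_format, OF V symp_adj_of irreflp_adj_of[OF B] NN(2) noblow near[unfolded n_def] clone uv(2,3)] by blast
      note rec = recolour_increases[OF rb e[unfolded uv(1)] _ this]
      have l1: "1 \<le> l" using l by simp
      \<comment> \<open>The recoloured pair is again of maximum weight but has one red edge
        less.\<close>
      have "?w (insert {u, v} B, R - {{u, v}}) = ?w BR1"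
        using rec(2)[OF l1] max[OF rec(1)[OF l1]] BR(2) BRe by simp
      then have "card R \<le> card (R - {{u, v}})" using least[OF rec(1)[OF l1]] BRe by simp
      moreover have "card (R - {{u, v}}) < card R"
        using e uv finite_edges[OF R] by (intro psubset_card_mono) auto
      ultimately show False by simp
    qed
    then have "?w BR0 \<le> card (cliques (adj_of B) V (Suc l))"
      using max[OF rb0] by (simp add: red_blue_weight_def)
    then show "\<exists>E. is_graph (V, E) \<and> \<not> contains_copy F (V, E) \<and> ?w BR0 \<le> card (cliques (adj_of E) V (Suc l))"
      using B noB by blast
  qed
qed

section \<open>Equality of the two extremal numbers\<close>

lemma ex_berge_eq_ex_copies:
  fixes F :: "'b hypergraph"
  assumes F: "is_graph F" and chi: "chromatic_number F = Suc r" and l: "2 \<le> l" "Suc l \<le> r"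
    and num: "((real r + real l - 2) / (2 * real r)) ^ l < 1 - real l / real r"
  shows "\<exists>n0. \<forall>n\<ge>n0. ex_berge (Suc l) n F = ex_copies n (complete_graph (Suc l)) F"
proof -
  let ?k = "Suc l"
  obtain N where N: "\<forall>V :: nat set. finite V \<longrightarrow> N \<le> card V \<longrightarrow> (\<forall>BR. red_blue F V BR \<longrightarrow>
    (\<exists>E. is_graph (V, E) \<and> \<not> contains_copy F (V, E) \<and>
      red_blue_weight ?k V BR \<le> card (cliques (adj_of E) V ?k)))"
    using red_blue_optimum_blue[OF assms, where 'a = nat] by (elim exE) (rule that)
  show ?thesis
  proof (intro exI[of _ N] allI impI)
    fix n assume n: "N \<le> n"
    let ?B = "{card (edges H) | H :: nat hypergraph. uniform_hypergraph ?k H \<and> card (verts H) = n \<and> berge_free F H}"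
    let ?C = "{num_copies (complete_graph ?k) G | G :: nat hypergraph. is_graph G \<and> card (verts G) = n \<and> \<not> contains_copy F G}"
    have finB: "finite ?B" by (rule finite_ex_berge_values)
    have finC: "finite ?C" by (rule finite_ex_copies_values)
    \<comment> \<open>Every value counted in \<open>?C\<close> is attained in \<open>?B\<close> by
      the hypergraph of \<open>?k\<close>-cliques.\<close>
    have C_le_B: "c \<in> ?B" if "c \<in> ?C" for c
    proof -
      obtain V E where G: "is_graph (V, E)" "card V = n" "\<not> contains_copy F (V, E)"
        and c: "c = num_copies (complete_graph ?k) (V, E :: nat set set)" using \<open>c \<in> ?C\<close> by auto
      have "c = card (cliques (adj_of E) V ?k)" unfolding c by (rule num_copies_complete_graph[OF G(1)])
      then show ?thesis
        using berge_free_clique_hypergraph[OF G(1,3), of ?k] G(2)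
        by (intro CollectI exI[of _ "(V, cliques (adj_of E) V ?k)"]) simp
    qed
    \<comment> \<open>The edgeless graph is \<open>F\<close>-free, as \<open>F\<close> has chromatic
      number above 1; so both maxima are over nonempty sets.\<close>
    have "\<not> contains_copy F ({..<n}, {} :: nat set set)"
      by (rule not_contains_copy_if_colourable[OF F, of 1 "\<lambda>_. 0"]) (use chi l in auto)
    moreover have "is_graph ({..<n}, {} :: nat set set)" by (simp add: is_graph_pair)
    ultimately have neC: "?C \<noteq> {}" by (metis (mono_tags, lifting) card_lessThan empty_iff fst_conv mem_Collect_eq)
    then have neB: "?B \<noteq> {}" using C_le_B by blast
    have "Max ?C \<le> Max ?B"
      using Max_in[OF finC neC] finB C_le_B by (intro Max_ge) auto
    moreover have "Max ?B \<le> Max ?C"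
    proof -
      have "Max ?B \<in> ?B" by (rule Max_in[OF finB neB])
      then obtain V and H :: "nat set set" where H: "uniform_hypergraph ?k (V, H)" "card V = n" "berge_free F (V, H)"
        and m: "Max ?B = card H" by auto
      have V: "finite V" using H(1) by (simp add: uniform_hypergraph_def is_hypergraph_def)
      obtain B R where "is_graph (V, B)" "is_graph (V, R)" "B \<inter> R = {}" "\<not> contains_copy F (V, B \<union> R)"
        and le: "card H \<le> card (cliques (adj_of B) V ?k) + card R"
        using berge_free_red_blue[OF H(1,3)] by blast
      then have "red_blue F V (B, R)" by (simp add: red_blue_def)
      then obtain E where E: "is_graph (V, E)" "\<not> contains_copy F (V, E)"
        "red_blue_weight ?k V (B, R) \<le> card (cliques (adj_of E) V ?k)"
        using N V H(2) n by blast
      have "card H \<le> num_copies (complete_graph ?k) (V, E)"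
        using le E(3) num_copies_complete_graph[OF E(1), of ?k] by (simp add: red_blue_weight_def)
      also have "num_copies (complete_graph ?k) (V, E) \<in> ?C" using E(1,2) H(2) by force
      then have "num_copies (complete_graph ?k) (V, E) \<le> Max ?C" by (rule Max_ge[OF finC])
      finally show ?thesis using m by simp
    qed
    ultimately show "ex_berge ?k n F = ex_copies n (complete_graph ?k) F"
      unfolding ex_berge_def ex_copies_def by simp
  qed
qed

theorem theorem1p5:
  shows "(\<forall>k\<in>{3, 4 :: nat}. \<forall>F :: nat hypergraph.
            is_graph F \<and> chromatic_number F > k \<longrightarrow>
            (\<exists>n0. \<forall>n\<ge>n0. ex_berge k n F = ex_copies n (complete_graph k) F)) \<and>
         (\<forall>k\<ge>(3 :: nat). \<exists>r0. \<forall>r\<ge>r0. \<forall>F :: nat hypergraph.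
            is_graph F \<and> chromatic_number F = r + 1 \<longrightarrow>
            (\<exists>n0. \<forall>n\<ge>n0. ex_berge k n F = ex_copies n (complete_graph k) F))"
proof (intro conjI ballI allI impI)
  fix k :: nat and F :: "nat hypergraph"
  assume k: "k \<in> {3, 4}" and F: "is_graph F \<and> k < chromatic_number F"
  define l where "l = k - 1"
  define r where "r = chromatic_number F - 1"
  have l: "l \<in> {2, 3}" "k = Suc l" and r: "chromatic_number F = Suc r" "Suc l \<le> r"
    using k F by (auto simp: l_def r_def)
  then have "2 \<le> l" by auto
  then show "\<exists>n0. \<forall>n\<ge>n0. ex_berge k n F = ex_copies n (complete_graph k) F"
    unfolding l(2) using ex_berge_eq_ex_copies[OF _ r(1) _ r(2) numeric_condition_small[OF l(1) r(2)]] F by blast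
next
  fix k :: nat assume k: "3 \<le> k"
  define l where "l = k - 1"
  have l: "2 \<le> l" "k = Suc l" using k by (auto simp: l_def)
  show "\<exists>r0. \<forall>r\<ge>r0. \<forall>F :: nat hypergraph.
            is_graph F \<and> chromatic_number F = r + 1 \<longrightarrow>
            (\<exists>n0. \<forall>n\<ge>n0. ex_berge k n F = ex_copies n (complete_graph k) F)"
  \<comment> \<open>The threshold of \<open>numeric_condition_large\<close>, that is, 4 (k -
    1).\<close>
  proof (rule exI[of _ "4 * l"], intro allI impI)
    fix r and F :: "nat hypergraph"
    assume r: "4 * l \<le> r" and F: "is_graph F \<and> chromatic_number F = r + 1"
    then have "chromatic_number F = Suc r" "Suc l \<le> r" using l by auto
    then show "\<exists>n0. \<forall>n\<ge>n0. ex_berge k n F = ex_copies n (complete_graph k) F"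
      unfolding l(2) using ex_berge_eq_ex_copies[OF _ _ l(1) _ numeric_condition_large[OF l(1) r]] F by blast
  qed
qed

end
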